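(* Fix constants $c_5>0$, $\delta\in(0,1)$. There exist constants $c_0,C_2>0$ such that the following holds for all sufficiently large $n$. Let $B_1,\dots,B_m\in\mathbb{R}^{n\times n}$ be i.i.d. random matrices satisfying, for some $K\le n^2$, $\|B_i\|\le K$ almost surely and $\|\mathbb{E}[\mathcal B_i^*\mathcal B_i]-\mathcal I\|\le c_5/n$. If $m>c_0rK^2\log^7n$, then with probability at least $1-1/n^2$: (i) for all $X\in\mathbb{R}^{n\times n}$ of rank at most $r$, $\big|\frac1m\|\mathcal B(X)\|_2^2-\|X\|_{\mathrm F}^2\big|\le\delta\|X\|_{\mathrm F}^2$; (ii) for every convex set $\mathcal K\subseteq\mathbb{R}^{n\times n}$, every $\epsilon_2\ge0$, every $\Sigma\in\mathcal K$ of rank at most $r$ and every $y\in\mathbb{R}^m$ with $\|y-\mathcal B(\Sigma)\|_2\le\epsilon_2$, any minimizer $\hat\Sigma$ of $\min_M\|M\|_*$ subject to $\|y-\mathcal B(M)\|_2\le\epsilon_2$, $M\in\mathcal K$, satisfies $\|\hat\Sigma-\Sigma\|_{\mathrm F}\le C_2\epsilon_2/\sqrt m$.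
   Context: $\mathcal B_i(X)=\langle B_i,X\rangle=\operatorname{Tr}(B_i^\top X)$, $\mathcal B(X)=(\mathcal B_i(X))_{i=1}^m$, and $\mathcal B_i^*\mathcal B_i$ is the linear operator $X\mapsto\langle B_i,X\rangle B_i$ on $\mathbb{R}^{n\times n}$; $\mathcal I$ is the identity operator, and operator norms are with respect to the Frobenius norm. $\|B_i\|$ is the spectral norm. *)

theory Defs
  imports "HOL-Probability.Probability" "Jordan_Normal_Form.DL_Rank" "Jordan_Normal_Form.Char_Poly"
begin

text \<open>n-by-n real matrices are represented as functions nat => nat => real;
only the entries with indices below n are relevant.\<close>

definition sqmats :: "nat \<Rightarrow> (nat \<Rightarrow> nat \<Rightarrow> real) set" where
  "sqmats n = {X. \<forall>i j. \<not> (i < n \<and> j < n) \<longrightarrow> X i j = 0}"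

definition to_mat :: "nat \<Rightarrow> (nat \<Rightarrow> nat \<Rightarrow> real) \<Rightarrow> real Matrix.mat" where
  "to_mat n X = Matrix.mat n n (\<lambda>(i,j). X i j)"

definition mrank :: "nat \<Rightarrow> (nat \<Rightarrow> nat \<Rightarrow> real) \<Rightarrow> nat" where
  "mrank n X = vec_space.rank n (to_mat n X)"

definition frob :: "nat \<Rightarrow> (nat \<Rightarrow> nat \<Rightarrow> real) \<Rightarrow> real" where
  "frob n X = sqrt (\<Sum>i<n. \<Sum>j<n. (X i j)\<^sup>2)"

definition minner :: "nat \<Rightarrow> (nat \<Rightarrow> nat \<Rightarrow> real) \<Rightarrow> (nat \<Rightarrow> nat \<Rightarrow> real) \<Rightarrow> real" where
  "minner n A X = (\<Sum>i<n. \<Sum>j<n. A i j * X i j)"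

definition vnorm :: "nat \<Rightarrow> (nat \<Rightarrow> real) \<Rightarrow> real" where
  "vnorm k x = sqrt (\<Sum>i<k. (x i)\<^sup>2)"

definition spec_norm :: "nat \<Rightarrow> (nat \<Rightarrow> nat \<Rightarrow> real) \<Rightarrow> real" where
  "spec_norm n B = Sup {vnorm n (\<lambda>i. \<Sum>j<n. B i j * x j) | x. vnorm n x \<le> 1}"

text \<open>Nuclear norm: sum of the singular values (with multiplicity), i.e. of the square
roots of the eigenvalues of X^T X counted with algebraic multiplicity.\<close>
definition nuc_norm :: "nat \<Rightarrow> (nat \<Rightarrow> nat \<Rightarrow> real) \<Rightarrow> real" where
  "nuc_norm n X = (let p = char_poly (Matrix.transpose_mat (to_mat n X) * to_mat n X) in
     (\<Sum>t\<in>{x. poly p x = 0}. real (Polynomial.order t p) * sqrt t))"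

definition matsp :: "nat \<Rightarrow> (nat \<Rightarrow> nat \<Rightarrow> real) measure" where
  "matsp n = PiM {..<n} (\<lambda>_. PiM {..<n} (\<lambda>_. borel))"

definition meas :: "nat \<Rightarrow> (nat \<Rightarrow> nat \<Rightarrow> nat \<Rightarrow> real) \<Rightarrow> (nat \<Rightarrow> nat \<Rightarrow> real) \<Rightarrow> nat \<Rightarrow> real" where
  "meas n Bs X = (\<lambda>l. minner n (Bs l) X)"

definition EBB_minus_I :: "nat \<Rightarrow> (nat \<Rightarrow> nat \<Rightarrow> real) measure \<Rightarrow> (nat \<Rightarrow> nat \<Rightarrow> real) \<Rightarrow> (nat \<Rightarrow> nat \<Rightarrow> real)" where
  "EBB_minus_I n \<mu> X = (\<lambda>i j. if i < n \<and> j < n then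
      (\<integral>B. minner n B X * B i j \<partial>\<mu>) - X i j else 0)"

definition op_norm_F :: "nat \<Rightarrow> ((nat \<Rightarrow> nat \<Rightarrow> real) \<Rightarrow> (nat \<Rightarrow> nat \<Rightarrow> real)) \<Rightarrow> real" where
  "op_norm_F n L = Sup {frob n (L X) | X. X \<in> sqmats n \<and> frob n X \<le> 1}"

definition mconvex :: "(nat \<Rightarrow> nat \<Rightarrow> real) set \<Rightarrow> bool" where
  "mconvex S \<longleftrightarrow> (\<forall>X\<in>S. \<forall>Y\<in>S. \<forall>t::real. 0 \<le> t \<and> t \<le> 1 \<longrightarrow>
      (\<lambda>i j. t * X i j + (1 - t) * Y i j) \<in> S)"

end

theory Submission
  imports Defs
begin

text \<open>
  Both claims follow from one uniform bound: with high probability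
  \<open>\<bar>\<parallel>\<B>(X)\<parallel>\<^sup>2 / m - \<parallel>X\<parallel>\<^sub>F\<^sup>2\<bar> \<le> \<delta> \<parallel>X\<parallel>\<^sub>F\<^sup>2\<close> for every \<open>X\<close> whose nuclear norm is at most
  \<open>3 \<surd>r\<close> times its Frobenius norm. Matrices of rank at most \<open>r\<close> are of this kind, and so is the error
  of any nuclear norm minimiser, because a direction in which the nuclear norm does not increase at
  a matrix of rank \<open>r\<close> has nuclear norm at most \<open>3 \<surd>r\<close> times its Frobenius norm.

  For fixed measurements of spectral norm at most \<open>K\<close>, the nuclear ball of radius \<open>s\<close> is covered, up
  to error \<open>\<epsilon>\<close> in every measurement, by \<open>(2 m + 1)\<^sup>T\<close> points with \<open>T = O(K\<^sup>2 s\<^sup>2 ln n / \<epsilon>\<^sup>2)\<close>. This comes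
  from the mistake bound of an online algorithm (the matrix \<open>p\<close>-norm perceptron with \<open>p\<close> of order
  \<open>ln n\<close>), which identifies \<open>X\<close> by its list of mistakes; it replaces the usual duality of entropy
  numbers. Chaining over dyadic scales with Hoeffding's inequality bounds the process with random
  signs, relative to the largest empirical second moment. A ghost sample and random swaps transfer
  this to the centred process, and the self-referential second moment is removed by a descent over
  deviation levels.
\<close>

section \<open>Vectors, matrices and orthonormal families\<close>

definition vinner :: "nat \<Rightarrow> (nat \<Rightarrow> real) \<Rightarrow> (nat \<Rightarrow> real) \<Rightarrow> real" where
  "vinner n x y = (\<Sum>i<n. x i * y i)"

definition mvmult :: "nat \<Rightarrow> (nat \<Rightarrow> nat \<Rightarrow> real) \<Rightarrow> (nat \<Rightarrow> real) \<Rightarrow> nat \<Rightarrow> real" where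
  "mvmult n A x = (\<lambda>i. \<Sum>j<n. A i j * x j)"

definition mmult :: "nat \<Rightarrow> (nat \<Rightarrow> nat \<Rightarrow> real) \<Rightarrow> (nat \<Rightarrow> nat \<Rightarrow> real) \<Rightarrow> nat \<Rightarrow> nat \<Rightarrow> real" where
  "mmult n A B = (\<lambda>i j. \<Sum>k<n. A i k * B k j)"

definition mtranspose :: "(nat \<Rightarrow> nat \<Rightarrow> real) \<Rightarrow> nat \<Rightarrow> nat \<Rightarrow> real" where
  "mtranspose A = (\<lambda>i j. A j i)"

definition mat_eq :: "nat \<Rightarrow> (nat \<Rightarrow> nat \<Rightarrow> real) \<Rightarrow> (nat \<Rightarrow> nat \<Rightarrow> real) \<Rightarrow> bool" where
  "mat_eq n A B \<longleftrightarrow> (\<forall>i<n. \<forall>j<n. A i j = B i j)"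

definition msymmetric :: "nat \<Rightarrow> (nat \<Rightarrow> nat \<Rightarrow> real) \<Rightarrow> bool" where
  "msymmetric n A \<longleftrightarrow> mat_eq n A (mtranspose A)"

lemma mtranspose_apply [simp]: "mtranspose A i j = A j i"
  by (simp add: mtranspose_def)

lemma vinner_commute: "vinner n x y = vinner n y x"
  by (simp add: vinner_def mult.commute)

lemma vinner_add_left: "vinner n (\<lambda>i. x i + y i) z = vinner n x z + vinner n y z"
  by (simp add: vinner_def distrib_right sum.distrib)

lemma vinner_diff_left: "vinner n (\<lambda>i. x i - y i) z = vinner n x z - vinner n y z"
  by (simp add: vinner_def left_diff_distrib sum_subtractf)

lemma vinner_scale_left: "vinner n (\<lambda>i. c * x i) z = c * vinner n x z"
  by (simp add: vinner_def sum_distrib_left mult.assoc)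

lemma vinner_sum_left: "vinner n (\<lambda>i. \<Sum>k\<in>S. f k i) z = (\<Sum>k\<in>S. vinner n (f k) z)"
  unfolding vinner_def sum_distrib_right by (rule sum.swap)

lemma vinner_add_right: "vinner n z (\<lambda>i. x i + y i) = vinner n z x + vinner n z y"
  unfolding vinner_commute[of n z] by (rule vinner_add_left)

lemma vinner_diff_right: "vinner n z (\<lambda>i. x i - y i) = vinner n z x - vinner n z y"
  unfolding vinner_commute[of n z] by (rule vinner_diff_left)

lemma vinner_scale_right: "vinner n z (\<lambda>i. c * x i) = c * vinner n z x"
  unfolding vinner_commute[of n z] by (rule vinner_scale_left)

lemma vinner_sum_right: "vinner n z (\<lambda>i. \<Sum>k\<in>S. f k i) = (\<Sum>k\<in>S. vinner n z (f k))"
  unfolding vinner_commute[of n z] by (rule vinner_sum_left)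

lemmas vinner_linear = vinner_add_left vinner_diff_left vinner_scale_left vinner_sum_left
  vinner_add_right vinner_diff_right vinner_scale_right vinner_sum_right

lemma vinner_cong:
  "(\<And>i. i < n \<Longrightarrow> x i = x' i) \<Longrightarrow> (\<And>i. i < n \<Longrightarrow> y i = y' i) \<Longrightarrow> vinner n x y = vinner n x' y'"
  by (simp add: vinner_def)

lemma vinner_self_nonneg [simp]: "0 \<le> vinner n x x"
  by (simp add: vinner_def sum_nonneg)

lemma vinner_self_eq_0_iff: "vinner n x x = 0 \<longleftrightarrow> (\<forall>i<n. x i = 0)"
  by (auto simp: vinner_def sum_nonneg_eq_0_iff)

lemma vnorm_eq_L2_set: "vnorm n x = L2_set x {..<n}"
  by (simp add: vnorm_def L2_set_def)

lemma vnorm_eq_sqrt_vinner: "vnorm n x = sqrt (vinner n x x)"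
  by (simp add: vnorm_def vinner_def power2_eq_square)

lemma vnorm_power2: "(vnorm n x)\<^sup>2 = vinner n x x"
  by (simp add: vnorm_eq_sqrt_vinner)

lemma vnorm_nonneg [simp]: "0 \<le> vnorm n x"
  by (simp add: vnorm_eq_L2_set)

lemma vnorm_scale: "vnorm n (\<lambda>i. c * x i) = \<bar>c\<bar> * vnorm n x"
  by (simp add: vnorm_def power_mult_distrib real_sqrt_mult flip: sum_distrib_left)

lemma vnorm_diff_le: "vnorm n (\<lambda>i. x i - y i) \<le> vnorm n x + vnorm n y"
  using L2_set_triangle_ineq[of x "\<lambda>i. - y i" "{..<n}"] by (simp add: vnorm_def L2_set_def)

lemma abs_vinner_le: "\<bar>vinner n x y\<bar> \<le> vnorm n x * vnorm n y"
proof -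
  have "\<bar>vinner n x y\<bar> \<le> (\<Sum>i<n. \<bar>x i\<bar> * \<bar>y i\<bar>)"
    unfolding vinner_def abs_mult[symmetric] by (rule sum_abs)
  also have "\<dots> \<le> vnorm n x * vnorm n y"
    unfolding vnorm_eq_L2_set by (rule L2_set_mult_ineq)
  finally show ?thesis .
qed

lemma mvmult_add: "mvmult n A (\<lambda>i. x i + y i) = (\<lambda>i. mvmult n A x i + mvmult n A y i)"
  by (simp add: mvmult_def distrib_left sum.distrib)

lemma mvmult_diff: "mvmult n A (\<lambda>i. x i - y i) = (\<lambda>i. mvmult n A x i - mvmult n A y i)"
  by (simp add: mvmult_def right_diff_distrib sum_subtractf)

lemma mvmult_scale: "mvmult n A (\<lambda>i. c * x i) = (\<lambda>i. c * mvmult n A x i)"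
  by (simp add: mvmult_def sum_distrib_left mult.left_commute)

lemma mvmult_sum: "mvmult n A (\<lambda>i. \<Sum>k\<in>S. f k i) = (\<lambda>i. \<Sum>k\<in>S. mvmult n A (f k) i)"
  unfolding mvmult_def sum_distrib_left by (intro ext) (rule sum.swap)

lemma mvmult_mmult: "mvmult n (mmult n A B) x = mvmult n A (mvmult n B x)"
proof
  fix i
  show "mvmult n (mmult n A B) x i = mvmult n A (mvmult n B x) i"
    unfolding mvmult_def mmult_def sum_distrib_left sum_distrib_right mult.assoc by (rule sum.swap)
qed

lemma vinner_mvmult_transpose: "vinner n x (mvmult n A y) = vinner n (mvmult n (mtranspose A) x) y"
proof -
  have "vinner n x (mvmult n A y) = (\<Sum>i<n. \<Sum>j<n. x i * A i j * y j)"
    by (simp add: vinner_def mvmult_def sum_distrib_left mult.assoc)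
  also have "\<dots> = (\<Sum>j<n. \<Sum>i<n. x i * A i j * y j)"
    by (rule sum.swap)
  finally show ?thesis
    by (simp add: vinner_def mvmult_def sum_distrib_right mult.commute[of "x _" "A _ _"])
qed

lemma mat_eq_sym: "mat_eq n A B \<Longrightarrow> mat_eq n B A"
  by (simp add: mat_eq_def)

lemma mat_eq_trans [trans]: "mat_eq n A B \<Longrightarrow> mat_eq n B C \<Longrightarrow> mat_eq n A C"
  by (simp add: mat_eq_def)

lemma mvmult_cong: "mat_eq n A B \<Longrightarrow> i < n \<Longrightarrow> mvmult n A x i = mvmult n B x i"
  by (simp add: mvmult_def mat_eq_def)

lemma vinner_mvmult_cong: "mat_eq n A B \<Longrightarrow> vinner n x (mvmult n A y) = vinner n x (mvmult n B y)"
  by (intro vinner_cong mvmult_cong) auto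

lemma vinner_mvmult_symmetric:
  assumes "msymmetric n A"
  shows "vinner n x (mvmult n A y) = vinner n (mvmult n A x) y"
  unfolding vinner_mvmult_transpose
  by (intro vinner_cong mvmult_cong) (use assms in \<open>auto simp: msymmetric_def mat_eq_def\<close>)

definition orthonormal_on :: "nat \<Rightarrow> 'k set \<Rightarrow> ('k \<Rightarrow> nat \<Rightarrow> real) \<Rightarrow> bool" where
  "orthonormal_on n S e \<longleftrightarrow> (\<forall>k\<in>S. \<forall>l\<in>S. vinner n (e k) (e l) = (if k = l then 1 else 0))"

lemma orthonormal_onD:
  "orthonormal_on n S e \<Longrightarrow> k \<in> S \<Longrightarrow> l \<in> S \<Longrightarrow> vinner n (e k) (e l) = (if k = l then 1 else 0)"
  by (simp add: orthonormal_on_def)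

lemma orthonormal_on_subset: "orthonormal_on n T e \<Longrightarrow> S \<subseteq> T \<Longrightarrow> orthonormal_on n S e"
  unfolding orthonormal_on_def by blast

lemma orthonormal_on_vnorm: "orthonormal_on n S e \<Longrightarrow> k \<in> S \<Longrightarrow> vnorm n (e k) = 1"
  by (simp add: orthonormal_on_def vnorm_eq_sqrt_vinner)

lemma orthonormal_on_sum:
  fixes c :: "'k \<Rightarrow> real"
  assumes "orthonormal_on n S e" "finite S" "k \<in> S"
  shows "(\<Sum>l\<in>S. c l * vinner n (e l) (e k)) = c k"
proof -
  have "(\<Sum>l\<in>S. c l * vinner n (e l) (e k)) = (\<Sum>l\<in>S. if l = k then c l else 0)"
    using assms by (intro sum.cong) (auto simp: orthonormal_on_def)
  then show ?thesis
    using assms by simp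
qed

definition residual :: "nat \<Rightarrow> 'k set \<Rightarrow> ('k \<Rightarrow> nat \<Rightarrow> real) \<Rightarrow> (nat \<Rightarrow> real) \<Rightarrow> nat \<Rightarrow> real" where
  "residual n S e x = (\<lambda>i. x i - (\<Sum>k\<in>S. vinner n (e k) x * e k i))"

lemma vinner_residual_left:
  "vinner n (residual n S e x) y = vinner n x y - (\<Sum>k\<in>S. vinner n (e k) x * vinner n (e k) y)"
  unfolding residual_def vinner_linear ..

lemma vinner_residual_symmetric: "vinner n (residual n S e x) y = vinner n x (residual n S e y)"
  unfolding vinner_commute[of n x "residual n S e y"] vinner_residual_left
  by (simp add: vinner_commute[of n x] mult.commute)

lemma residual_member:
  assumes "orthonormal_on n S e" "finite S" "k \<in> S"
  shows "residual n S e (e k) i = 0"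
  using orthonormal_on_sum[OF assms, of "\<lambda>l. e l i"] by (simp add: residual_def mult.commute)

lemma vinner_member_residual:
  assumes "orthonormal_on n S e" "finite S" "k \<in> S"
  shows "vinner n (e k) (residual n S e x) = 0"
  unfolding vinner_residual_symmetric[symmetric] by (simp add: vinner_def residual_member[OF assms])

lemma vnorm_residual_power2:
  assumes "orthonormal_on n S e" "finite S"
  shows "(vnorm n (residual n S e x))\<^sup>2 = (vnorm n x)\<^sup>2 - (\<Sum>k\<in>S. (vinner n (e k) x)\<^sup>2)"
proof -
  have "vinner n (residual n S e x) (residual n S e x) = vinner n x (residual n S e x)"
    unfolding vinner_residual_left[of n S e x "residual n S e x"]
    by (simp add: vinner_member_residual[OF assms])
  then show ?thesis
    unfolding vnorm_power2 vinner_residual_symmetric[of n S e x x, symmetric] vinner_residual_left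
    by (simp add: power2_eq_square)
qed

lemma Bessel_inequality:
  assumes "orthonormal_on n S e" "finite S"
  shows "(\<Sum>k\<in>S. (vinner n (e k) x)\<^sup>2) \<le> (vnorm n x)\<^sup>2"
  using vnorm_residual_power2[OF assms, of x] zero_le_power2[of "vnorm n (residual n S e x)"] by simp

lemma vnorm_residual_le:
  assumes "orthonormal_on n S e" "finite S"
  shows "vnorm n (residual n S e x) \<le> vnorm n x"
  using vnorm_residual_power2[OF assms, of x] by (intro power2_le_imp_le[OF _ vnorm_nonneg]) (simp add: sum_nonneg)

definition std_basis :: "nat \<Rightarrow> nat \<Rightarrow> real" where
  "std_basis i = (\<lambda>j. if j = i then 1 else 0)"

lemma vinner_std_basis: "i < n \<Longrightarrow> vinner n x (std_basis i) = x i"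
  by (simp add: vinner_def std_basis_def if_distrib cong: if_cong)

lemma vnorm_std_basis: "i < n \<Longrightarrow> vnorm n (std_basis i) = 1"
  by (simp add: vnorm_eq_sqrt_vinner vinner_std_basis) (simp add: std_basis_def)

lemma sum_vnorm_residual_std_basis:
  assumes "orthonormal_on n S e" "finite S"
  shows "(\<Sum>i<n. (vnorm n (residual n S e (std_basis i)))\<^sup>2) = real n - real (card S)"
proof -
  have "(\<Sum>i<n. \<Sum>k\<in>S. (e k i)\<^sup>2) = (\<Sum>k\<in>S. vinner n (e k) (e k))"
    unfolding vinner_def power2_eq_square by (rule sum.swap)
  also have "\<dots> = real (card S)"
    using assms by (simp add: orthonormal_on_def)
  finally show ?thesis
    by (simp add: vnorm_residual_power2[OF assms] vnorm_std_basis vinner_std_basis sum_subtractf)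
qed

lemma orthonormal_basis_complete:
  assumes "orthonormal_on n {..<n} e" "i < n" "j < n"
  shows "(\<Sum>k<n. e k i * e k j) = (if i = j then 1 else 0)"
proof -
  have "(\<Sum>i<n. (vnorm n (residual n {..<n} e (std_basis i)))\<^sup>2) = 0"
    using sum_vnorm_residual_std_basis[OF assms(1)] by simp
  then have "(vnorm n (residual n {..<n} e (std_basis i)))\<^sup>2 = 0"
    using assms(2) by (subst (asm) sum_nonneg_eq_0_iff) auto
  then have "residual n {..<n} e (std_basis i) j = 0"
    using assms(3) by (simp add: vnorm_power2 vinner_self_eq_0_iff del: power_eq_0_iff)
  then show ?thesis
    using assms(2) by (auto simp: residual_def vinner_std_basis) (auto simp: std_basis_def)
qed

lemma orthonormal_basis_expansion:
  assumes "orthonormal_on n {..<n} e" "j < n"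
  shows "x j = (\<Sum>k<n. vinner n (e k) x * e k j)"
proof -
  have "(\<Sum>k<n. vinner n (e k) x * e k j) = (\<Sum>i<n. x i * (\<Sum>k<n. e k i * e k j))"
    unfolding vinner_def sum_distrib_left sum_distrib_right by (subst sum.swap) (simp add: mult_ac)
  also have "\<dots> = (\<Sum>i<n. if i = j then x i else 0)"
    by (intro sum.cong) (auto simp: orthonormal_basis_complete[OF assms(1) _ assms(2)])
  finally show ?thesis
    using assms(2) by simp
qed

lemma Parseval_identity:
  assumes "orthonormal_on n {..<n} e"
  shows "(\<Sum>k<n. (vinner n (e k) x)\<^sup>2) = (vnorm n x)\<^sup>2"
proof -
  have "vinner n x x = vinner n x (\<lambda>j. \<Sum>k<n. vinner n (e k) x * e k j)"
    by (rule vinner_cong) (auto intro: orthonormal_basis_expansion[OF assms])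
  then show ?thesis
    unfolding vinner_sum_right vinner_scale_right
    by (simp add: vnorm_power2 vinner_commute[of n x "e _"] flip: power2_eq_square)
qed

lemma exists_unit_orthogonal:
  assumes "orthonormal_on n {..<k} e" "k < n"
  shows "\<exists>x. vnorm n x = 1 \<and> (\<forall>l<k. vinner n (e l) x = 0)"
proof -
  have "(\<Sum>i<n. (vnorm n (residual n {..<k} e (std_basis i)))\<^sup>2) \<noteq> 0"
    using sum_vnorm_residual_std_basis[OF assms(1)] assms(2) by simp
  then obtain i where "vnorm n (residual n {..<k} e (std_basis i)) \<noteq> 0"
    by (auto elim: sum.not_neutral_contains_not_neutral)
  moreover define z where "z = residual n {..<k} e (std_basis i)"
  ultimately have "vnorm n (\<lambda>j. 1 / vnorm n z * z j) = 1"
    unfolding vnorm_scale by simp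
  moreover have "vinner n (e l) (\<lambda>j. 1 / vnorm n z * z j) = 0" if "l < k" for l
    unfolding vinner_scale_right z_def using that by (simp add: vinner_member_residual[OF assms(1)])
  ultimately show ?thesis
    by blast
qed

section \<open>The spectral theorem\<close>

definition outer_sum ::
  "'k set \<Rightarrow> ('k \<Rightarrow> real) \<Rightarrow> ('k \<Rightarrow> nat \<Rightarrow> real) \<Rightarrow> ('k \<Rightarrow> nat \<Rightarrow> real) \<Rightarrow> nat \<Rightarrow> nat \<Rightarrow> real" where
  "outer_sum S s u v = (\<lambda>i j. \<Sum>k\<in>S. s k * u k i * v k j)"

definition eigen_decomposition ::
  "nat \<Rightarrow> (nat \<Rightarrow> nat \<Rightarrow> real) \<Rightarrow> (nat \<Rightarrow> nat \<Rightarrow> real) \<Rightarrow> (nat \<Rightarrow> real) \<Rightarrow> bool" where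
  "eigen_decomposition n A e \<mu> \<longleftrightarrow>
    orthonormal_on n {..<n} e \<and> mat_eq n A (outer_sum {..<n} \<mu> e e)"

lemma mvmult_outer_sum:
  "mvmult n (outer_sum S s u v) y = (\<lambda>i. \<Sum>k\<in>S. s k * vinner n (v k) y * u k i)"
  unfolding mvmult_def outer_sum_def vinner_def sum_distrib_left sum_distrib_right
  by (intro ext, subst sum.swap) (simp add: mult_ac)

lemma vinner_mvmult_outer_sum:
  "vinner n x (mvmult n (outer_sum S s u v) y) = (\<Sum>k\<in>S. s k * (vinner n x (u k) * vinner n (v k) y))"
  unfolding mvmult_outer_sum vinner_sum_right vinner_scale_right by (simp add: mult_ac)

lemma eigen_decomposition_eigenvector:
  assumes "eigen_decomposition n A e \<mu>" "l < n" "i < n"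
  shows "mvmult n A (e l) i = \<mu> l * e l i"
proof -
  have "mvmult n A (e l) i = (\<Sum>k<n. \<mu> k * e k i * vinner n (e k) (e l))"
    using assms mvmult_cong[of n A "outer_sum {..<n} \<mu> e e" i]
    by (simp add: eigen_decomposition_def mvmult_outer_sum mult_ac)
  also have "\<dots> = \<mu> l * e l i"
    using assms by (intro orthonormal_on_sum) (auto simp: eigen_decomposition_def)
  finally show ?thesis .
qed

lemma mat_eq_outer_sum_mvmult:
  assumes "orthonormal_on n {..<n} e"
  shows "mat_eq n A (outer_sum {..<n} (\<lambda>_. 1) (\<lambda>k. mvmult n A (e k)) e)"
  unfolding mat_eq_def outer_sum_def
proof (intro allI impI)
  fix i j assume "j < n"
  then have "A i j = (\<Sum>k<n. vinner n (e k) (A i) * e k j)"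
    by (rule orthonormal_basis_expansion[OF assms])
  then show "A i j = (\<Sum>k<n. 1 * mvmult n A (e k) i * e k j)"
    by (simp add: mvmult_def vinner_def mult.commute[of "A _ _"])
qed

text \<open>The truncation \<open>x i = 0\<close> for \<open>i \<ge> n\<close> makes this a compact set of functions.\<close>

definition unit_orthogonal_set :: "nat \<Rightarrow> nat \<Rightarrow> (nat \<Rightarrow> nat \<Rightarrow> real) \<Rightarrow> (nat \<Rightarrow> real) set" where
  "unit_orthogonal_set n k e =
    {x. vinner n x x = 1 \<and> (\<forall>l<k. vinner n (e l) x = 0) \<and> (\<forall>i\<ge>n. x i = 0)}"

lemma unit_orthogonal_set_truncate:
  assumes "vnorm n x = 1" "\<And>l. l < k \<Longrightarrow> vinner n (e l) x = 0"
  shows "(\<lambda>i. if i < n then x i else 0) \<in> unit_orthogonal_set n k e"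
  using assms by (auto simp: unit_orthogonal_set_def vnorm_eq_sqrt_vinner cong: vinner_cong)

lemma continuous_on_vinner [continuous_intros]:
  fixes f g :: "'a::topological_space \<Rightarrow> nat \<Rightarrow> real"
  assumes "\<And>i. i < n \<Longrightarrow> continuous_on T (\<lambda>x. f x i)" "\<And>i. i < n \<Longrightarrow> continuous_on T (\<lambda>x. g x i)"
  shows "continuous_on T (\<lambda>x. vinner n (f x) (g x))"
  unfolding vinner_def by (intro continuous_intros) (use assms in auto)

lemma compact_unit_orthogonal_set: "compact (unit_orthogonal_set n k e)"
proof -
  let ?cube = "PiE UNIV (\<lambda>_::nat. {-1..1::real})"
  have "unit_orthogonal_set n k e = {x. vinner n x x = 1} \<inter> (\<Inter>l\<in>{..<k}. {x. vinner n (e l) x = 0})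
      \<inter> (\<Inter>i\<in>{n..}. {x. x i = 0})"
    by (auto simp: unit_orthogonal_set_def)
  moreover have "closed \<dots>"
    by (intro closed_Int closed_INT ballI closed_Collect_eq continuous_intros
        continuous_on_product_coordinates)
  ultimately have "closed (unit_orthogonal_set n k e)"
    by simp
  moreover have "compactin (product_topology (\<lambda>_. euclidean) UNIV) ?cube"
    by (simp add: compactin_PiE)
  then have "compact ?cube"
    by (simp add: euclidean_product_topology)
  moreover have "unit_orthogonal_set n k e \<subseteq> ?cube"
  proof
    fix x assume x: "x \<in> unit_orthogonal_set n k e"
    have "\<bar>x i\<bar> \<le> 1" for i
    proof (cases "i < n")
      case True
      then have "(x i)\<^sup>2 \<le> vinner n x x"
        unfolding vinner_def power2_eq_square by (intro member_le_sum) auto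
      then show ?thesis
        using x by (simp add: unit_orthogonal_set_def abs_square_le_1)
    qed (use x in \<open>simp add: unit_orthogonal_set_def\<close>)
    then show "x \<in> ?cube"
      by (auto simp: abs_le_iff minus_le_iff)
  qed
  ultimately show ?thesis
    using compact_Int_closed[of ?cube "unit_orthogonal_set n k e"] by (simp add: inf.absorb2)
qed

lemma Rayleigh_quotient_attains_max:
  assumes "orthonormal_on n {..<k} e" "k < n"
  obtains x where "vnorm n x = 1" "\<And>l. l < k \<Longrightarrow> vinner n (e l) x = 0"
    "\<And>y. (\<And>l. l < k \<Longrightarrow> vinner n (e l) y = 0) \<Longrightarrow>
      vinner n y (mvmult n A y) \<le> vinner n x (mvmult n A x) * (vnorm n y)\<^sup>2"
proof -
  let ?C = "unit_orthogonal_set n k e" and ?q = "\<lambda>x. vinner n x (mvmult n A x)"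
  obtain z where "vnorm n z = 1" "\<forall>l<k. vinner n (e l) z = 0"
    using exists_unit_orthogonal[OF assms] by blast
  then have "?C \<noteq> {}"
    using unit_orthogonal_set_truncate[of n z k e] by auto
  moreover have "continuous_on ?C ?q"
    unfolding mvmult_def
    by (intro continuous_intros continuous_on_subset[OF continuous_on_product_coordinates]) auto
  ultimately obtain x where x: "x \<in> ?C" and max: "\<And>y. y \<in> ?C \<Longrightarrow> ?q y \<le> ?q x"
    using continuous_attains_sup[OF compact_unit_orthogonal_set[of n k e], of ?q] by blast
  have "?q y \<le> ?q x * (vnorm n y)\<^sup>2" if orth: "\<And>l. l < k \<Longrightarrow> vinner n (e l) y = 0" for y
  proof (cases "vnorm n y = 0")
    case True
    then show ?thesis
      using abs_vinner_le[of n y "mvmult n A y"] by simp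
  next
    case False
    then have "0 < (vnorm n y)\<^sup>2"
      by simp
    define c where "c = 1 / vnorm n y"
    have "(\<lambda>i. if i < n then c * y i else 0) \<in> ?C"
      using False orth
      by (intro unit_orthogonal_set_truncate) (unfold vnorm_scale vinner_scale_right, auto simp: c_def)
    then have "?q (\<lambda>i. if i < n then c * y i else 0) \<le> ?q x"
      by (rule max)
    moreover have "?q (\<lambda>i. if i < n then c * y i else 0) = ?q (\<lambda>i. c * y i)"
      by (rule vinner_cong) (auto simp: mvmult_def)
    ultimately have "c * (c * ?q y) \<le> ?q x"
      by (simp only: mvmult_scale vinner_scale_left vinner_scale_right)
    then show ?thesis
      using \<open>0 < (vnorm n y)\<^sup>2\<close> by (simp add: c_def pos_divide_le_eq flip: power2_eq_square)
  qed
  moreover have "vnorm n x = 1" "\<And>l. l < k \<Longrightarrow> vinner n (e l) x = 0"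
    using x by (auto simp: unit_orthogonal_set_def vnorm_eq_sqrt_vinner)
  ultimately show ?thesis
    using that by blast
qed

lemma quadratic_nonpos_imp_linear_coeff_zero:
  fixes a b :: real
  assumes "\<And>t. 2 * t * a + t\<^sup>2 * b \<le> 0"
  shows "a = 0"
proof (rule ccontr)
  assume "a \<noteq> 0"
  define c where "c = \<bar>b\<bar> + 1"
  have "0 < c"
    by (simp add: c_def)
  have "2 * (a / c) * a + (a / c)\<^sup>2 * b = a\<^sup>2 / c\<^sup>2 * (2 * c + b)"
    using \<open>0 < c\<close> by (simp add: field_simps power2_eq_square)
  moreover have "0 < a\<^sup>2 / c\<^sup>2 * (2 * c + b)"
    using \<open>a \<noteq> 0\<close> \<open>0 < c\<close> by (intro mult_pos_pos) (auto simp: c_def)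
  ultimately show False
    using assms[of "a / c"] by linarith
qed

text \<open>The first-order condition along \<open>x + t y\<close>, where \<open>y = A x - \<nu> x\<close> is an admissible direction,
  says \<open>\<langle>y, y\<rangle> = 0\<close>.\<close>

lemma exists_next_eigenvector:
  assumes sym: "msymmetric n A" and orthonormal: "orthonormal_on n {..<k} e" and "k < n"
    and eigen: "\<And>l i. l < k \<Longrightarrow> i < n \<Longrightarrow> mvmult n A (e l) i = \<mu> l * e l i"
  shows "\<exists>x \<nu>. vnorm n x = 1 \<and> (\<forall>l<k. vinner n (e l) x = 0) \<and> (\<forall>i<n. mvmult n A x i = \<nu> * x i)"
proof -
  obtain x where x_unit: "vnorm n x = 1" and x_orth: "\<And>l. l < k \<Longrightarrow> vinner n (e l) x = 0"
    and max: "\<And>y. (\<And>l. l < k \<Longrightarrow> vinner n (e l) y = 0) \<Longrightarrow>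
      vinner n y (mvmult n A y) \<le> vinner n x (mvmult n A x) * (vnorm n y)\<^sup>2"
    using Rayleigh_quotient_attains_max[OF orthonormal \<open>k < n\<close>] by blast
  define \<nu> where "\<nu> = vinner n x (mvmult n A x)"
  define y where "y = (\<lambda>i. mvmult n A x i - \<nu> * x i)"
  have y_orth: "vinner n (e l) y = 0" if "l < k" for l
  proof -
    have "vinner n (e l) (mvmult n A x) = vinner n (\<lambda>i. \<mu> l * e l i) x"
      unfolding vinner_mvmult_symmetric[OF sym] by (rule vinner_cong) (auto simp: eigen that)
    then show ?thesis
      using x_orth[OF that] by (simp add: y_def vinner_linear)
  qed
  have "2 * t * vinner n y y + t\<^sup>2 * (vinner n y (mvmult n A y) - \<nu> * vinner n y y) \<le> 0" for t
  proof -
    have "vinner n (\<lambda>i. x i + t * y i) (mvmult n A (\<lambda>i. x i + t * y i))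
        \<le> \<nu> * vinner n (\<lambda>i. x i + t * y i) (\<lambda>i. x i + t * y i)"
      using max[of "\<lambda>i. x i + t * y i"] by (simp add: vinner_linear x_orth y_orth \<nu>_def vnorm_power2)
    moreover have "vinner n x (mvmult n A y) = vinner n y (mvmult n A x)"
      unfolding vinner_mvmult_symmetric[OF sym, of x] by (rule vinner_commute)
    moreover have "vinner n y (mvmult n A x) = vinner n y y + \<nu> * vinner n x y"
      by (subst (3) y_def) (simp add: vinner_linear vinner_commute[of n x y])
    moreover have "vinner n x x = 1"
      using x_unit by (simp add: vnorm_eq_sqrt_vinner)
    ultimately show ?thesis
      unfolding mvmult_add mvmult_scale vinner_linear \<nu>_def[symmetric] vinner_commute[of n y x]
      by (simp add: power2_eq_square algebra_simps)
  qed
  then have "vinner n y y = 0"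
    by (rule quadratic_nonpos_imp_linear_coeff_zero)
  then have "\<forall>i<n. mvmult n A x i = \<nu> * x i"
    by (simp add: vinner_self_eq_0_iff y_def)
  then show ?thesis
    using x_unit x_orth by blast
qed

theorem spectral_theorem:
  assumes sym: "msymmetric n A"
  obtains e \<mu> where "eigen_decomposition n A e \<mu>"
proof -
  have "\<exists>e \<mu>. orthonormal_on n {..<k} e \<and> (\<forall>l<k. \<forall>i<n. mvmult n A (e l) i = \<mu> l * e l i)"
    if "k \<le> n" for k
    using that
  proof (induction k)
    case 0
    show ?case
      by (simp add: orthonormal_on_def)
  next
    case (Suc k)
    then obtain e \<mu> where e: "orthonormal_on n {..<k} e"
      and eigen: "\<forall>l<k. \<forall>i<n. mvmult n A (e l) i = \<mu> l * e l i"
      by auto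
    obtain x \<nu> where x: "vnorm n x = 1" "\<forall>l<k. vinner n (e l) x = 0" "\<forall>i<n. mvmult n A x i = \<nu> * x i"
      using exists_next_eigenvector[OF sym e, of \<mu>] eigen Suc.prems by auto
    have "orthonormal_on n {..<Suc k} (e(k := x))"
      using e x(1,2)
      by (auto simp: orthonormal_on_def less_Suc_eq vinner_commute[of n x "e _"] vnorm_eq_sqrt_vinner)
    moreover have "\<forall>l<Suc k. \<forall>i<n. mvmult n A ((e(k := x)) l) i = (\<mu>(k := \<nu>)) l * (e(k := x)) l i"
      using eigen x(3) by (auto simp: less_Suc_eq)
    ultimately show ?case
      by blast
  qed
  from this[of n] obtain e \<mu> where e: "orthonormal_on n {..<n} e"
    and eigen: "\<forall>l<n. \<forall>i<n. mvmult n A (e l) i = \<mu> l * e l i"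
    by auto
  have "mat_eq n (outer_sum {..<n} (\<lambda>_. 1) (\<lambda>k. mvmult n A (e k)) e) (outer_sum {..<n} \<mu> e e)"
    using eigen by (simp add: mat_eq_def outer_sum_def)
  then have "eigen_decomposition n A e \<mu>"
    using e mat_eq_trans[OF mat_eq_outer_sum_mvmult[OF e]] by (simp add: eigen_decomposition_def)
  then show ?thesis
    by (rule that)
qed

section \<open>The Frobenius inner product and operator bounds\<close>

lemma minner_add_left: "minner n (\<lambda>i j. A i j + B i j) X = minner n A X + minner n B X"
  by (simp add: minner_def distrib_right sum.distrib)

lemma minner_add_right: "minner n X (\<lambda>i j. A i j + B i j) = minner n X A + minner n X B"
  by (simp add: minner_def distrib_left sum.distrib)

lemma minner_diff_left: "minner n (\<lambda>i j. A i j - B i j) X = minner n A X - minner n B X"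
  by (simp add: minner_def left_diff_distrib sum_subtractf)

lemma minner_diff_right: "minner n X (\<lambda>i j. A i j - B i j) = minner n X A - minner n X B"
  by (simp add: minner_def right_diff_distrib sum_subtractf)

lemma minner_scale_left: "minner n (\<lambda>i j. c * A i j) X = c * minner n A X"
  by (simp add: minner_def sum_distrib_left mult.assoc)

lemma minner_scale_right: "minner n X (\<lambda>i j. c * A i j) = c * minner n X A"
  by (simp add: minner_def sum_distrib_left mult.left_commute)

lemma minner_cong: "mat_eq n X Y \<Longrightarrow> minner n W X = minner n W Y"
  by (simp add: minner_def mat_eq_def)

lemma minner_eq_sum_vinner: "minner n A X = (\<Sum>i<n. vinner n (A i) (X i))"
  by (simp add: minner_def vinner_def)

lemma minner_outer_sum:
  "minner n W (outer_sum S s u v) = (\<Sum>k\<in>S. s k * vinner n (u k) (mvmult n W (v k)))"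
proof -
  have "minner n W (outer_sum S s u v) = (\<Sum>i<n. \<Sum>k\<in>S. \<Sum>j<n. s k * (u k i * (W i j * v k j)))"
    unfolding minner_def outer_sum_def sum_distrib_left
    by (intro sum.cong refl, subst sum.swap) (simp add: mult_ac)
  also have "\<dots> = (\<Sum>k\<in>S. \<Sum>i<n. \<Sum>j<n. s k * (u k i * (W i j * v k j)))"
    by (rule sum.swap)
  finally show ?thesis
    by (simp add: vinner_def mvmult_def sum_distrib_left)
qed

lemma frob_power2: "(frob n X)\<^sup>2 = minner n X X"
  by (simp add: frob_def minner_def power2_eq_square sum_nonneg)

lemma frob_eq_L2_set: "frob n X = L2_set (\<lambda>i. vnorm n (X i)) {..<n}"
  by (simp add: frob_def L2_set_def vnorm_def sum_nonneg)

lemma frob_nonneg [simp]: "0 \<le> frob n X"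
  by (simp add: frob_eq_L2_set)

lemma frob_scale: "frob n (\<lambda>i j. c * X i j) = \<bar>c\<bar> * frob n X"
  by (simp add: frob_eq_L2_set vnorm_scale L2_set_right_distrib)

lemma frob_transpose: "frob n (mtranspose X) = frob n X"
  unfolding frob_def mtranspose_apply by (subst sum.swap) (rule refl)

lemma abs_minner_le: "\<bar>minner n A X\<bar> \<le> frob n A * frob n X"
proof -
  have "\<bar>minner n A X\<bar> \<le> (\<Sum>i<n. \<bar>vinner n (A i) (X i)\<bar>)"
    unfolding minner_eq_sum_vinner by (rule sum_abs)
  also have "\<dots> \<le> (\<Sum>i<n. \<bar>vnorm n (A i)\<bar> * \<bar>vnorm n (X i)\<bar>)"
    by (intro sum_mono) (simp add: abs_vinner_le)
  also have "\<dots> \<le> frob n A * frob n X"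
    unfolding frob_eq_L2_set by (rule L2_set_mult_ineq)
  finally show ?thesis .
qed

lemma vnorm_mvmult_le_frob: "vnorm n (mvmult n B x) \<le> frob n B * vnorm n x"
proof -
  have "vnorm n (mvmult n B x) = L2_set (\<lambda>i. \<bar>vinner n (B i) x\<bar>) {..<n}"
    by (simp add: vnorm_def mvmult_def vinner_def L2_set_def)
  also have "\<dots> \<le> L2_set (\<lambda>i. vnorm n (B i) * vnorm n x) {..<n}"
    by (intro L2_set_mono abs_vinner_le) auto
  also have "\<dots> = frob n B * vnorm n x"
    by (simp add: frob_eq_L2_set L2_set_left_distrib)
  finally show ?thesis .
qed

lemma frob_outer_sum:
  assumes "orthonormal_on n S v" "finite S"
  shows "(frob n (outer_sum S (\<lambda>_. 1) z v))\<^sup>2 = (\<Sum>k\<in>S. (vnorm n (z k))\<^sup>2)"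
proof -
  have "vinner n (z k) (mvmult n (outer_sum S (\<lambda>_. 1) z v) (v k)) = (vnorm n (z k))\<^sup>2" if "k \<in> S" for k
    unfolding vinner_mvmult_outer_sum vnorm_power2
    using orthonormal_on_sum[OF assms that, of "\<lambda>l. vinner n (z k) (z l)"] by simp
  then show ?thesis
    by (simp add: frob_power2 minner_outer_sum)
qed

lemma frob_outer_sum_le_sqrt_card:
  assumes "orthonormal_on n S v" "finite S" "\<And>k. k \<in> S \<Longrightarrow> vnorm n (z k) \<le> 1"
  shows "frob n (outer_sum S (\<lambda>_. 1) z v) \<le> sqrt (real (card S))"
proof (rule real_le_rsqrt)
  have "(\<Sum>k\<in>S. (vnorm n (z k))\<^sup>2) \<le> (\<Sum>k\<in>S. 1)"
    using assms(3) by (intro sum_mono) (simp add: abs_square_le_1)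
  then show "(frob n (outer_sum S (\<lambda>_. 1) z v))\<^sup>2 \<le> real (card S)"
    by (simp add: frob_outer_sum[OF assms(1,2)])
qed

lemma mtranspose_outer_sum: "mtranspose (outer_sum S s u v) = outer_sum S s v u"
  by (simp add: outer_sum_def mtranspose_def mult_ac)

definition op_bounded :: "nat \<Rightarrow> real \<Rightarrow> (nat \<Rightarrow> nat \<Rightarrow> real) \<Rightarrow> bool" where
  "op_bounded n c A \<longleftrightarrow> (\<forall>x y. vinner n x (mvmult n A y) \<le> c * vnorm n x * vnorm n y)"

lemma op_boundedD: "op_bounded n c A \<Longrightarrow> vinner n x (mvmult n A y) \<le> c * vnorm n x * vnorm n y"
  by (simp add: op_bounded_def)

lemma op_boundedI:
  assumes "\<And>y. vnorm n (mvmult n B y) \<le> c * vnorm n y"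
  shows "op_bounded n c B"
  unfolding op_bounded_def
proof (intro allI)
  fix x y
  have "vinner n x (mvmult n B y) \<le> vnorm n x * vnorm n (mvmult n B y)"
    using abs_vinner_le[of n x "mvmult n B y"] by simp
  also have "\<dots> \<le> vnorm n x * (c * vnorm n y)"
    using assms by (intro mult_left_mono) auto
  finally show "vinner n x (mvmult n B y) \<le> c * vnorm n x * vnorm n y"
    by (simp add: mult_ac)
qed

lemma op_bounded_vnorm_mvmult_le:
  assumes "op_bounded n c A" "0 \<le> c"
  shows "vnorm n (mvmult n A y) \<le> c * vnorm n y"
proof (cases "vnorm n (mvmult n A y) = 0")
  case False
  have "vnorm n (mvmult n A y) * vnorm n (mvmult n A y) \<le> c * vnorm n y * vnorm n (mvmult n A y)"
    using op_boundedD[OF assms(1), of "mvmult n A y" y] vnorm_power2[of n "mvmult n A y"]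
    by (simp add: power2_eq_square mult_ac)
  moreover have "0 < vnorm n (mvmult n A y)"
    using False by (simp add: less_le)
  ultimately show ?thesis
    by simp
qed (use assms in simp)

lemma op_bounded_transpose:
  assumes "op_bounded n c A"
  shows "op_bounded n c (mtranspose A)"
  unfolding op_bounded_def
proof (intro allI)
  fix x y
  have "vinner n x (mvmult n (mtranspose A) y) = vinner n y (mvmult n A x)"
    unfolding vinner_mvmult_transpose[of n y] by (rule vinner_commute)
  then show "vinner n x (mvmult n (mtranspose A) y) \<le> c * vnorm n x * vnorm n y"
    using op_boundedD[OF assms, of y x] by (simp add: mult_ac)
qed

lemma op_bounded_scale:
  assumes "op_bounded n c A"
  shows "op_bounded n (\<bar>t\<bar> * c) (\<lambda>i j. t * A i j)"
  unfolding op_bounded_def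
proof (intro allI)
  fix x y
  have "vinner n x (mvmult n (\<lambda>i j. t * A i j) y) = \<bar>t\<bar> * vinner n (\<lambda>i. sgn t * x i) (mvmult n A y)"
    by (simp add: vinner_def mvmult_def sum_distrib_left mult_ac abs_mult_sgn)
      (simp add: abs_mult_sgn flip: mult.assoc)
  also have "\<dots> \<le> \<bar>t\<bar> * (c * vnorm n (\<lambda>i. sgn t * x i) * vnorm n y)"
    by (intro mult_left_mono op_boundedD[OF assms]) simp
  also have "\<dots> = \<bar>t\<bar> * c * vnorm n x * vnorm n y"
    by (cases "t = 0") (simp_all add: vnorm_scale)
  finally show "vinner n x (mvmult n (\<lambda>i j. t * A i j) y) \<le> \<bar>t\<bar> * c * vnorm n x * vnorm n y" .
qed

lemma op_bounded_nonneg: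
  assumes "op_bounded n c B" "1 \<le> n"
  shows "0 \<le> c"
proof -
  have unit: "vnorm n (std_basis 0) = 1"
    using assms(2) by (simp add: vnorm_std_basis)
  have "vinner n (\<lambda>i. - 1 * std_basis 0 i) (mvmult n B (std_basis 0))
      \<le> c * vnorm n (\<lambda>i. - 1 * std_basis 0 i) * vnorm n (std_basis 0)"
    by (rule op_boundedD[OF assms(1)])
  then have "- vinner n (std_basis 0) (mvmult n B (std_basis 0)) \<le> c"
    unfolding vinner_scale_left vnorm_scale unit by simp
  then show ?thesis
    using op_boundedD[OF assms(1), of "std_basis 0" "std_basis 0"] by (simp add: unit)
qed

lemma op_bounded_frob: "op_bounded n (frob n B) B"
  by (intro op_boundedI vnorm_mvmult_le_frob)

lemma op_bounded_spec_norm: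
  assumes "spec_norm n B \<le> c"
  shows "op_bounded n c B"
proof (rule op_boundedI)
  fix y
  have le_spec_norm: "vnorm n (mvmult n B x) \<le> spec_norm n B" if "vnorm n x \<le> 1" for x
    unfolding spec_norm_def
  proof (rule cSup_upper)
    show "bdd_above {vnorm n (\<lambda>i. \<Sum>j<n. B i j * x j) | x. vnorm n x \<le> 1}"
    proof (rule bdd_aboveI)
      fix w assume "w \<in> {vnorm n (\<lambda>i. \<Sum>j<n. B i j * x j) | x. vnorm n x \<le> 1}"
      then obtain x where "w = vnorm n (mvmult n B x)" "vnorm n x \<le> 1"
        by (auto simp: mvmult_def)
      then show "w \<le> frob n B"
        using vnorm_mvmult_le_frob[of n B x] mult_left_le[of "vnorm n x" "frob n B"] by simp
    qed
  qed (use that in \<open>auto simp: mvmult_def\<close>)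
  show "vnorm n (mvmult n B y) \<le> c * vnorm n y"
  proof (cases "vnorm n y = 0")
    case True
    then show ?thesis
      using vnorm_mvmult_le_frob[of n B y] by simp
  next
    case False
    then have "0 < vnorm n y"
      by (simp add: less_le)
    have "vnorm n (mvmult n B (\<lambda>i. 1 / vnorm n y * y i)) \<le> c"
      using le_spec_norm[of "\<lambda>i. 1 / vnorm n y * y i"] False assms unfolding vnorm_scale by simp
    then show ?thesis
      using \<open>0 < vnorm n y\<close> unfolding mvmult_scale vnorm_scale by (simp add: field_simps)
  qed
qed

lemma mult_add_mult_le_sqrt: "a * c + b * d \<le> sqrt (a\<^sup>2 + b\<^sup>2) * sqrt (c\<^sup>2 + d\<^sup>2)" for a b c d :: real
  using norm_cauchy_schwarz[of "(a, b)" "(c, d)"] by (simp add: norm_Pair)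

lemma vinner_mvmult_outer_sum_le:
  "vinner n x (mvmult n (outer_sum S (\<lambda>_. 1) u v) y)
    \<le> sqrt (\<Sum>k\<in>S. (vinner n (u k) x)\<^sup>2) * sqrt (\<Sum>k\<in>S. (vinner n (v k) y)\<^sup>2)"
proof -
  have "(\<Sum>k\<in>S. vinner n (u k) x * vinner n (v k) y)
      \<le> (\<Sum>k\<in>S. \<bar>vinner n (u k) x\<bar> * \<bar>vinner n (v k) y\<bar>)"
    by (intro sum_mono) (simp flip: abs_mult)
  also have "\<dots> \<le> L2_set (\<lambda>k. vinner n (u k) x) S * L2_set (\<lambda>k. vinner n (v k) y) S"
    by (rule L2_set_mult_ineq)
  finally show ?thesis
    unfolding vinner_mvmult_outer_sum by (simp add: L2_set_def vinner_commute[of n x])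
qed

lemma op_bounded_outer_sum:
  assumes "orthonormal_on n S u" "orthonormal_on n S v" "finite S"
  shows "op_bounded n 1 (outer_sum S (\<lambda>_. 1) u v)"
  unfolding op_bounded_def
proof (intro allI)
  fix x y
  have "vinner n x (mvmult n (outer_sum S (\<lambda>_. 1) u v) y)
      \<le> sqrt (\<Sum>k\<in>S. (vinner n (u k) x)\<^sup>2) * sqrt (\<Sum>k\<in>S. (vinner n (v k) y)\<^sup>2)"
    by (rule vinner_mvmult_outer_sum_le)
  also have "\<dots> \<le> vnorm n x * vnorm n y"
    using Bessel_inequality[OF assms(1,3)] Bessel_inequality[OF assms(2,3)]
    by (intro mult_mono real_le_lsqrt) (auto intro: sum_nonneg)
  finally show "vinner n x (mvmult n (outer_sum S (\<lambda>_. 1) u v) y) \<le> 1 * vnorm n x * vnorm n y"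
    by simp
qed

section \<open>The singular value decomposition\<close>

lemma sum_order_prod_linear:
  fixes \<mu> :: "'k \<Rightarrow> real" and f :: "real \<Rightarrow> real"
  assumes "finite S" and p: "p = (\<Prod>k\<in>S. [:- \<mu> k, 1:])"
  shows "(\<Sum>t\<in>{x. poly p x = 0}. real (Polynomial.order t p) * f t) = (\<Sum>k\<in>S. f (\<mu> k))"
proof -
  have "p \<noteq> 0" and roots: "{x. poly p x = 0} = \<mu> ` S"
    using assms(1) by (auto simp: p poly_prod)
  have "Polynomial.order t p = (\<Sum>k\<in>S. if \<mu> k = t then 1 else 0)" for t
    using count_proots[OF \<open>p \<noteq> 0\<close>, of t] unfolding p by (simp add: proots_prod count_sum cong: if_cong)
  then have "(\<Sum>t\<in>{x. poly p x = 0}. real (Polynomial.order t p) * f t)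
      = (\<Sum>t\<in>\<mu> ` S. \<Sum>k\<in>S. if t = \<mu> k then f (\<mu> k) else 0)"
    unfolding roots by (intro sum.cong) (auto simp: sum_distrib_right intro!: sum.cong)
  also have "\<dots> = (\<Sum>k\<in>S. \<Sum>t\<in>\<mu> ` S. if t = \<mu> k then f (\<mu> k) else 0)"
    by (rule sum.swap)
  also have "\<dots> = (\<Sum>k\<in>S. f (\<mu> k))"
    using assms(1) by (intro sum.cong) auto
  finally show ?thesis .
qed

lemma char_poly_eigen_decomposition:
  assumes "eigen_decomposition n A e \<mu>"
  shows "char_poly (to_mat n A) = (\<Prod>l<n. [:- \<mu> l, 1 :: real:])"
proof -
  have orthonormal: "orthonormal_on n {..<n} e"
    and A: "\<And>i j. i < n \<Longrightarrow> j < n \<Longrightarrow> A i j = (\<Sum>l<n. \<mu> l * e l i * e l j)"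
    using assms by (auto simp: eigen_decomposition_def mat_eq_def outer_sum_def)
  define P where "P = Matrix.mat n n (\<lambda>(i, k). e k i)"
  define D where "D = Matrix.mat n n (\<lambda>(i, k). if i = k then \<mu> i else 0)"
  have PD: "P * D = Matrix.mat n n (\<lambda>(i, k). e k i * \<mu> k)"
    by (rule eq_matI) (auto simp: P_def D_def scalar_prod_def if_distrib atLeast0LessThan cong: if_cong)
  have "similar_mat (to_mat n A) D"
  proof (rule similar_matI[where P = P and Q = "transpose_mat P"])
    show "{to_mat n A, D, P, transpose_mat P} \<subseteq> carrier_mat n n"
      by (auto simp: P_def D_def to_mat_def)
    show "P * transpose_mat P = 1\<^sub>m n"
      by (rule eq_matI)
        (auto simp: P_def scalar_prod_def atLeast0LessThan orthonormal_basis_complete[OF orthonormal])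
    show "transpose_mat P * P = 1\<^sub>m n"
      using orthonormal
      by (intro eq_matI) (auto simp: P_def scalar_prod_def atLeast0LessThan orthonormal_on_def vinner_def)
    show "to_mat n A = P * D * transpose_mat P"
      unfolding PD
      by (intro eq_matI) (auto simp: P_def to_mat_def scalar_prod_def atLeast0LessThan A mult_ac)
  qed
  then have "char_poly (to_mat n A) = char_poly D"
    by (rule char_poly_similar)
  also have "\<dots> = (\<Prod>a\<leftarrow>diag_mat D. [:- a, 1:])"
    by (rule char_poly_upper_triangular[of _ n]) (auto simp: D_def)
  also have "diag_mat D = map \<mu> [0..<n]"
    by (auto simp: diag_mat_def D_def intro: nth_equalityI)
  finally show ?thesis
    by (simp add: comp_def prod.distinct_set_conv_list[symmetric] atLeast0LessThan)
qed

lemma to_mat_mmult: "to_mat n (mmult n A B) = to_mat n A * to_mat n B"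
  by (rule eq_matI) (auto simp: to_mat_def mmult_def scalar_prod_def atLeast0LessThan)

lemma transpose_to_mat: "transpose_mat (to_mat n A) = to_mat n (mtranspose A)"
  by (rule eq_matI) (auto simp: to_mat_def)

lemma nuc_norm_eq_sum_sqrt_eigenvalues:
  assumes "eigen_decomposition n (mmult n (mtranspose X) X) v \<mu>"
  shows "nuc_norm n X = (\<Sum>l<n. sqrt (\<mu> l))"
  unfolding nuc_norm_def Let_def transpose_to_mat to_mat_mmult[symmetric]
  by (intro sum_order_prod_linear char_poly_eigen_decomposition[OF assms]) simp

definition is_svd :: "nat \<Rightarrow> nat set \<Rightarrow> (nat \<Rightarrow> real) \<Rightarrow> (nat \<Rightarrow> nat \<Rightarrow> real) \<Rightarrow> (nat \<Rightarrow> nat \<Rightarrow> real)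
    \<Rightarrow> (nat \<Rightarrow> nat \<Rightarrow> real) \<Rightarrow> bool" where
  "is_svd n S s u v X \<longleftrightarrow> finite S \<and> (\<forall>k\<in>S. 0 < s k) \<and> orthonormal_on n S u \<and> orthonormal_on n S v
    \<and> mat_eq n X (outer_sum S s u v)"

lemma is_svdD:
  assumes "is_svd n S s u v X"
  shows "finite S" "\<And>k. k \<in> S \<Longrightarrow> 0 < s k" "orthonormal_on n S u" "orthonormal_on n S v"
    "mat_eq n X (outer_sum S s u v)"
  using assms by (auto simp: is_svd_def)

lemma vinner_mvmult_eigenvectors_gram:
  assumes "eigen_decomposition n (mmult n (mtranspose X) X) v \<mu>" "k < n" "l < n"
  shows "vinner n (mvmult n X (v k)) (mvmult n X (v l)) = (if k = l then \<mu> k else 0)"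
proof -
  have "vinner n (mvmult n X (v k)) (mvmult n X (v l))
      = vinner n (v k) (mvmult n (mmult n (mtranspose X) X) (v l))"
    unfolding mvmult_mmult vinner_mvmult_transpose[of n "v k"] by (simp add: mtranspose_def)
  also have "\<dots> = vinner n (v k) (\<lambda>i. \<mu> l * v l i)"
    by (rule vinner_cong) (auto simp: eigen_decomposition_eigenvector[OF assms(1,3)])
  also have "\<dots> = (if k = l then \<mu> k else 0)"
    using assms by (auto simp: vinner_scale_right eigen_decomposition_def orthonormal_on_def)
  finally show ?thesis .
qed

lemma is_svd_of_eigen_decomposition:
  assumes eigen: "eigen_decomposition n (mmult n (mtranspose X) X) v \<mu>"
  shows "is_svd n {k. k < n \<and> 0 < \<mu> k} (\<lambda>k. sqrt (\<mu> k)) (\<lambda>k i. 1 / sqrt (\<mu> k) * mvmult n X (v k) i) v X"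
    (is "is_svd n ?S ?s ?u v X")
proof -
  have orthonormal: "orthonormal_on n {..<n} v"
    using eigen by (simp add: eigen_decomposition_def)
  note gram = vinner_mvmult_eigenvectors_gram[OF eigen]
  have "1 / ?s k * (1 / ?s l * vinner n (mvmult n X (v k)) (mvmult n X (v l))) = (if k = l then 1 else 0)"
    if "k \<in> ?S" "l \<in> ?S" for k l
    using that by (auto simp: gram real_div_sqrt)
  then have "orthonormal_on n ?S ?u"
    unfolding orthonormal_on_def vinner_scale_left vinner_scale_right by blast
  moreover have "orthonormal_on n ?S v"
    by (rule orthonormal_on_subset[OF orthonormal]) auto
  moreover have "outer_sum {..<n} (\<lambda>_. 1) (\<lambda>k. mvmult n X (v k)) v i j = outer_sum ?S ?s ?u v i j"
    if "i < n" for i j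
    unfolding outer_sum_def
  proof (rule sum.mono_neutral_cong_right)
    show "\<forall>k\<in>{..<n} - ?S. 1 * mvmult n X (v k) i * v k j = 0"
    proof
      fix k assume "k \<in> {..<n} - ?S"
      then have "vinner n (mvmult n X (v k)) (mvmult n X (v k)) = 0"
        using gram[of k k] vinner_self_nonneg[of n "mvmult n X (v k)"] by auto
      then show "1 * mvmult n X (v k) i * v k j = 0"
        using that by (simp add: vinner_self_eq_0_iff)
    qed
  qed auto
  then have "mat_eq n X (outer_sum ?S ?s ?u v)"
    using mat_eq_outer_sum_mvmult[OF orthonormal, of X] by (simp add: mat_eq_def)
  ultimately show ?thesis
    by (simp add: is_svd_def)
qed

theorem singular_value_decomposition:
  obtains S s u v where "is_svd n S s u v X" "nuc_norm n X = (\<Sum>k\<in>S. s k)"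
proof -
  have "msymmetric n (mmult n (mtranspose X) X)"
    by (simp add: msymmetric_def mat_eq_def mmult_def mult.commute)
  then obtain v \<mu> where eigen: "eigen_decomposition n (mmult n (mtranspose X) X) v \<mu>"
    by (rule spectral_theorem)
  have "0 \<le> \<mu> k" if "k < n" for k
    using vinner_mvmult_eigenvectors_gram[OF eigen that that] vinner_self_nonneg[of n "mvmult n X (v k)"]
    by simp
  then have "(\<Sum>l<n. sqrt (\<mu> l)) = (\<Sum>k | k < n \<and> 0 < \<mu> k. sqrt (\<mu> k))"
    by (intro sum.mono_neutral_right) (auto simp: less_le)
  then show ?thesis
    using nuc_norm_eq_sum_sqrt_eigenvalues[OF eigen]
    by (intro that[OF is_svd_of_eigen_decomposition[OF eigen]]) simp
qed

lemma is_svd_minner: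
  assumes "is_svd n S s u v X"
  shows "minner n W X = (\<Sum>k\<in>S. s k * vinner n (u k) (mvmult n W (v k)))"
  using minner_cong[OF is_svdD(5)[OF assms]] by (simp add: minner_outer_sum)

lemma is_svd_right_singular_vector:
  assumes "is_svd n S s u v X" "k \<in> S" "i < n"
  shows "mvmult n X (v k) i = s k * u k i"
proof -
  have "mvmult n X (v k) i = (\<Sum>l\<in>S. s l * u l i * vinner n (v l) (v k))"
    using mvmult_cong[OF is_svdD(5)[OF assms(1)] assms(3)] by (simp add: mvmult_outer_sum mult_ac)
  also have "\<dots> = s k * u k i"
    by (rule orthonormal_on_sum[OF is_svdD(4,1)[OF assms(1)] assms(2)])
  finally show ?thesis .
qed

lemma is_svd_frob:
  assumes "is_svd n S s u v X"
  shows "(frob n X)\<^sup>2 = (\<Sum>k\<in>S. (s k)\<^sup>2)"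
  unfolding frob_power2 is_svd_minner[OF assms]
proof (rule sum.cong[OF refl])
  fix k assume "k \<in> S"
  then have "vinner n (u k) (mvmult n X (v k)) = vinner n (u k) (\<lambda>i. s k * u k i)"
    by (intro vinner_cong) (auto simp: is_svd_right_singular_vector[OF assms])
  then show "s k * vinner n (u k) (mvmult n X (v k)) = (s k)\<^sup>2"
    using orthonormal_onD[OF is_svdD(3)[OF assms] \<open>k \<in> S\<close> \<open>k \<in> S\<close>]
    by (simp add: vinner_scale_right power2_eq_square)
qed

text \<open>The matrix \<open>U V\<^sup>T\<close> is a dual certificate for the nuclear norm.\<close>

lemma is_svd_minner_dual:
  assumes "is_svd n S s u v X"
  shows "minner n (outer_sum S (\<lambda>_. 1) u v) X = (\<Sum>k\<in>S. s k)"
  unfolding is_svd_minner[OF assms]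
proof (rule sum.cong[OF refl])
  fix k assume "k \<in> S"
  then have "vinner n (u k) (mvmult n (outer_sum S (\<lambda>_. 1) u v) (v k)) = vinner n (u k) (u k)"
    unfolding vinner_mvmult_outer_sum
    using orthonormal_on_sum[OF is_svdD(4,1)[OF assms] \<open>k \<in> S\<close>, of "\<lambda>l. vinner n (u k) (u l)"] by simp
  then show "s k * vinner n (u k) (mvmult n (outer_sum S (\<lambda>_. 1) u v) (v k)) = s k"
    using orthonormal_onD[OF is_svdD(3)[OF assms] \<open>k \<in> S\<close> \<open>k \<in> S\<close>] by simp
qed

lemma (in vec_space) lin_indpt_orthonormal:
  assumes "finite Z" "Z \<subseteq> carrier_vec n"
    and orthonormal: "\<And>y z. y \<in> Z \<Longrightarrow> z \<in> Z \<Longrightarrow> scalar_prod y z = (if y = z then 1 else 0)"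
  shows "lin_indpt Z"
proof
  assume "lin_dep Z"
  then obtain a z where a: "lincomb a Z = 0\<^sub>v n" "z \<in> Z" "a z \<noteq> 0"
    using finite_lin_dep[OF assms(1)] assms(2) by auto
  have "scalar_prod (lincomb a Z) z = (\<Sum>i\<in>{0..<n}. \<Sum>y\<in>Z. a y * (y $ i * z $ i))"
    using a(2) assms(2)
    by (auto simp: scalar_prod_def lincomb_index sum_distrib_right mult.assoc intro!: sum.cong)
  also have "\<dots> = (\<Sum>y\<in>Z. \<Sum>i\<in>{0..<n}. a y * (y $ i * z $ i))"
    by (rule sum.swap)
  also have "\<dots> = (\<Sum>y\<in>Z. a y * scalar_prod y z)"
    using a(2) assms(2) by (auto simp: scalar_prod_def sum_distrib_left intro!: sum.cong)
  also have "\<dots> = a z"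
    using a(2) assms(1) by (simp add: orthonormal if_distrib cong: if_cong)
  finally show False
    using a assms(2) by auto
qed

lemma (in vec_space) mult_mat_vec_in_span_cols:
  assumes "A \<in> carrier_mat n nc" "w \<in> carrier_vec nc"
  shows "A *\<^sub>v w \<in> span (set (cols A))"
proof -
  have cols: "set (cols A) \<subseteq> carrier_vec n"
    using cols_dim assms(1) by blast
  have "vec (length (cols A)) (($) w) = w"
    by (rule eq_vecI) (use assms in auto)
  then have "A *\<^sub>v w = A *\<^sub>v vec (length (cols A)) (($) w)"
    by simp
  also have "\<dots> = lincomb_list (($) w) (cols A)"
    using assms cols by (subst lincomb_list_as_mat_mult) (auto simp: mat_of_cols_cols)
  also have "\<dots> = lincomb (mk_coeff (cols A) (($) w)) (set (cols A))"
    using cols by (rule lincomb_list_as_lincomb)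
  finally show ?thesis
    by (auto simp: span_def)
qed

lemma (in vec_space) card_le_rank:
  assumes "A \<in> carrier_mat n nc" "Z \<subseteq> span (set (cols A))" "lin_indpt Z"
  shows "card Z \<le> rank A"
proof -
  have cols: "set (cols A) \<subseteq> carrier_vec n"
    using cols_dim assms(1) by blast
  interpret colspace: vectorspace class_ring "span_vs (set (cols A))"
    by (rule subspace_is_vs[OF span_is_subspace[OF cols]])
  have "\<not> colspace.lin_dep Z"
    using assms(2,3) span_li_not_depend(2)[OF assms(2) span_is_submodule[OF cols]] by simp
  then show ?thesis
    unfolding rank_def
    using assms(2) by (intro colspace.li_le_dim(2) fin_dim_span_cols[OF assms(1)]) auto
qed

lemma is_svd_card_le_mrank:
  assumes "is_svd n S s u v X"
  shows "card S \<le> mrank n X"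
proof -
  interpret vec_space "TYPE(real)" n .
  note svd = is_svdD[OF assms]
  define z where "z k = vec n (u k)" for k
  have z_carrier: "z k \<in> carrier_vec n" for k
    by (simp add: z_def)
  have dot: "scalar_prod (z k) (z l) = (if k = l then 1 else 0)" if "k \<in> S" "l \<in> S" for k l
    using orthonormal_onD[OF svd(3) that] by (simp add: z_def scalar_prod_def vinner_def atLeast0LessThan)
  then have inj: "inj_on z S"
    by (intro inj_onI) (metis one_neq_zero)
  have "z k \<in> span (set (cols (to_mat n X)))" if "k \<in> S" for k
  proof -
    have "z k = to_mat n X *\<^sub>v vec n (\<lambda>j. v k j / s k)"
    proof (rule eq_vecI)
      fix i assume "i < dim_vec (to_mat n X *\<^sub>v vec n (\<lambda>j. v k j / s k))"
      then have "i < n"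
        by (simp add: to_mat_def)
      then show "z k $ i = (to_mat n X *\<^sub>v vec n (\<lambda>j. v k j / s k)) $ i"
        using is_svd_right_singular_vector[OF assms that] svd(2)[OF that]
        by (simp add: z_def to_mat_def mvmult_def scalar_prod_def atLeast0LessThan field_simps
            flip: sum_divide_distrib)
    qed (simp add: z_def to_mat_def)
    also have "\<dots> \<in> span (set (cols (to_mat n X)))"
      by (rule mult_mat_vec_in_span_cols) (auto simp: to_mat_def)
    finally show ?thesis .
  qed
  moreover have "lin_indpt (z ` S)"
    using svd(1) by (intro lin_indpt_orthonormal) (auto simp: dot inj_on_eq_iff[OF inj] z_carrier)
  ultimately have "card (z ` S) \<le> rank (to_mat n X)"
    by (intro card_le_rank[of _ n]) (auto simp: to_mat_def)
  then show ?thesis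
    using inj by (simp add: card_image mrank_def)
qed

section \<open>The nuclear norm\<close>

lemma minner_le_nuc_norm:
  assumes "op_bounded n c W"
  shows "minner n W X \<le> c * nuc_norm n X"
proof -
  obtain S s u v where svd: "is_svd n S s u v X" and nuc: "nuc_norm n X = (\<Sum>k\<in>S. s k)"
    by (rule singular_value_decomposition)
  have "minner n W X \<le> (\<Sum>k\<in>S. s k * c)"
    unfolding is_svd_minner[OF svd]
  proof (rule sum_mono)
    fix k assume "k \<in> S"
    then have "vinner n (u k) (mvmult n W (v k)) \<le> c"
      using op_boundedD[OF assms, of "u k" "v k"] is_svdD(3,4)[OF svd] by (simp add: orthonormal_on_vnorm)
    then show "s k * vinner n (u k) (mvmult n W (v k)) \<le> s k * c"
      using is_svdD(2)[OF svd \<open>k \<in> S\<close>] by simp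
  qed
  then show ?thesis
    by (simp add: nuc sum_distrib_left mult.commute)
qed

lemma abs_minner_le_nuc_norm:
  assumes "op_bounded n c B"
  shows "\<bar>minner n B X\<bar> \<le> c * nuc_norm n X"
proof -
  have "minner n (\<lambda>i j. - 1 * B i j) X \<le> c * nuc_norm n X"
    using minner_le_nuc_norm[OF op_bounded_scale[OF assms, of "- 1"], of X] by simp
  then show ?thesis
    using minner_le_nuc_norm[OF assms, of X] unfolding minner_scale_left by simp
qed

lemma nuc_norm_attained:
  obtains W where "op_bounded n 1 W" "minner n W X = nuc_norm n X"
proof -
  obtain S s u v where svd: "is_svd n S s u v X" and "nuc_norm n X = (\<Sum>k\<in>S. s k)"
    by (rule singular_value_decomposition)
  then show ?thesis
    using that[OF op_bounded_outer_sum[OF is_svdD(3,4,1)[OF svd]]] is_svd_minner_dual[OF svd] by simp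
qed

lemma nuc_norm_nonneg: "0 \<le> nuc_norm n X"
proof -
  obtain S s u v where svd: "is_svd n S s u v X" and "nuc_norm n X = (\<Sum>k\<in>S. s k)"
    by (rule singular_value_decomposition)
  then show ?thesis
    using is_svdD(2)[OF svd] by (simp add: sum_nonneg less_imp_le)
qed

lemma nuc_norm_scale:
  assumes "0 \<le> c"
  shows "nuc_norm n (\<lambda>i j. c * X i j) = c * nuc_norm n X"
proof (rule antisym)
  obtain W where W: "op_bounded n 1 W" "minner n W (\<lambda>i j. c * X i j) = nuc_norm n (\<lambda>i j. c * X i j)"
    by (rule nuc_norm_attained)
  have "c * minner n W X \<le> c * nuc_norm n X"
    using minner_le_nuc_norm[OF W(1), of X] assms by (intro mult_left_mono) auto
  then show "nuc_norm n (\<lambda>i j. c * X i j) \<le> c * nuc_norm n X"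
    using W(2) by (simp add: minner_scale_right)
next
  obtain W where W: "op_bounded n 1 W" "minner n W X = nuc_norm n X"
    by (rule nuc_norm_attained)
  show "c * nuc_norm n X \<le> nuc_norm n (\<lambda>i j. c * X i j)"
    using minner_le_nuc_norm[OF W(1), of "\<lambda>i j. c * X i j"] W(2) by (simp add: minner_scale_right)
qed

lemma frob_le_nuc_norm: "frob n X \<le> nuc_norm n X"
proof (cases "frob n X = 0")
  case False
  then have "0 < frob n X"
    by (simp add: less_le)
  moreover have "frob n X * frob n X \<le> frob n X * nuc_norm n X"
    using minner_le_nuc_norm[OF op_bounded_frob, of n X X]
    by (simp add: frob_power2[symmetric] power2_eq_square)
  ultimately show ?thesis
    by simp
qed (simp add: nuc_norm_nonneg)

lemma nuc_norm_le_sqrt_rank: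
  assumes "mrank n X \<le> r"
  shows "nuc_norm n X \<le> sqrt (real r) * frob n X"
proof -
  obtain S s u v where svd: "is_svd n S s u v X" and nuc: "nuc_norm n X = (\<Sum>k\<in>S. s k)"
    by (rule singular_value_decomposition)
  have "nuc_norm n X \<le> (\<Sum>k\<in>S. \<bar>1\<bar> * \<bar>s k\<bar>)"
    unfolding nuc by (intro sum_mono) simp
  also have "\<dots> \<le> L2_set (\<lambda>_. 1) S * L2_set s S"
    by (rule L2_set_mult_ineq)
  also have "\<dots> = sqrt (real (card S)) * frob n X"
    by (simp add: L2_set_def flip: is_svd_frob[OF svd])
  also have "\<dots> \<le> sqrt (real r) * frob n X"
    using is_svd_card_le_mrank[OF svd] assms by (intro mult_right_mono) auto
  finally show ?thesis .
qed

lemma mrank_le_dim: "mrank n X \<le> n"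
  unfolding mrank_def by (rule vec_space.rank_le_nc) (simp add: to_mat_def)

text \<open>With \<open>P\<close>, \<open>R\<close> the orthogonal projections onto the spans of \<open>u\<close> and \<open>v\<close>, this is
  \<open>(I - P) W (I - R) = W - P W - (I - P) W R\<close>.\<close>

definition compression :: "nat \<Rightarrow> 'k set \<Rightarrow> ('k \<Rightarrow> nat \<Rightarrow> real) \<Rightarrow> ('k \<Rightarrow> nat \<Rightarrow> real)
    \<Rightarrow> (nat \<Rightarrow> nat \<Rightarrow> real) \<Rightarrow> nat \<Rightarrow> nat \<Rightarrow> real" where
  "compression n S u v W = (\<lambda>i j. W i j
     - outer_sum S (\<lambda>_. 1) u (\<lambda>k. mvmult n (mtranspose W) (u k)) i j
     - outer_sum S (\<lambda>_. 1) (\<lambda>k. residual n S u (mvmult n W (v k))) v i j)"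

lemma vinner_mvmult_compression:
  "vinner n x (mvmult n (compression n S u v W) y)
    = vinner n (residual n S u x) (mvmult n W (residual n S v y))"
proof -
  have "mvmult n (compression n S u v W) y = (\<lambda>i. mvmult n W y i
      - mvmult n (outer_sum S (\<lambda>_. 1) u (\<lambda>k. mvmult n (mtranspose W) (u k))) y i
      - mvmult n (outer_sum S (\<lambda>_. 1) (\<lambda>k. residual n S u (mvmult n W (v k))) v) y i)"
    by (simp add: compression_def mvmult_def left_diff_distrib sum_subtractf)
  then have "vinner n x (mvmult n (compression n S u v W) y)
      = vinner n x (mvmult n W y) - (\<Sum>k\<in>S. vinner n (u k) x * vinner n (u k) (mvmult n W y))
        - (\<Sum>k\<in>S. vinner n x (residual n S u (mvmult n W (v k))) * vinner n (v k) y)"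
    by (simp add: vinner_diff_right vinner_mvmult_outer_sum vinner_commute[of n x "u _"]
        flip: vinner_mvmult_transpose)
  also have "\<dots> = vinner n (residual n S u x) (mvmult n W y)
      - (\<Sum>k\<in>S. vinner n (v k) y * vinner n (residual n S u x) (mvmult n W (v k)))"
    by (simp add: vinner_residual_left vinner_residual_symmetric[symmetric] mult.commute)
  also have "\<dots> = vinner n (residual n S u x) (mvmult n W (residual n S v y))"
    unfolding residual_def[of n S v] mvmult_diff mvmult_sum mvmult_scale
    by (simp only: vinner_diff_right vinner_sum_right vinner_scale_right)
  finally show ?thesis .
qed

lemma op_bounded_outer_sum_add_compression:
  assumes W: "op_bounded n 1 W"
    and u: "orthonormal_on n S u" and v: "orthonormal_on n S v" and S: "finite S"
  shows "op_bounded n 1 (\<lambda>i j. outer_sum S (\<lambda>_. 1) u v i j + compression n S u v W i j)"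
    (is "op_bounded n 1 (\<lambda>i j. ?U i j + ?C i j)")
  unfolding op_bounded_def
proof (intro allI)
  fix x y
  define a where "a = sqrt (\<Sum>k\<in>S. (vinner n (u k) x)\<^sup>2)"
  define c where "c = sqrt (\<Sum>k\<in>S. (vinner n (v k) y)\<^sup>2)"
  have "vinner n x (mvmult n (\<lambda>i j. ?U i j + ?C i j) y)
      = vinner n x (mvmult n ?U y) + vinner n x (mvmult n ?C y)"
    unfolding vinner_add_right[symmetric] by (simp add: mvmult_def distrib_right sum.distrib)
  also have "\<dots> \<le> a * c + vnorm n (residual n S u x) * vnorm n (residual n S v y)"
    unfolding a_def c_def vinner_mvmult_compression
    using op_boundedD[OF W] by (intro add_mono vinner_mvmult_outer_sum_le) simp
  also have "\<dots> \<le> sqrt (a\<^sup>2 + (vnorm n (residual n S u x))\<^sup>2) * sqrt (c\<^sup>2 + (vnorm n (residual n S v y))\<^sup>2)"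
    by (rule mult_add_mult_le_sqrt)
  also have "\<dots> = vnorm n x * vnorm n y"
    by (simp add: a_def c_def sum_nonneg vnorm_residual_power2 u v S)
  finally show "vinner n x (mvmult n (\<lambda>i j. ?U i j + ?C i j) y) \<le> 1 * vnorm n x * vnorm n y"
    by simp
qed

lemma minner_diff_compression_le:
  assumes W: "op_bounded n 1 W"
    and u: "orthonormal_on n S u" and v: "orthonormal_on n S v" and S: "finite S"
  shows "minner n W H - minner n (compression n S u v W) H \<le> 2 * sqrt (real (card S)) * frob n H"
proof -
  let ?row = "outer_sum S (\<lambda>_. 1) u (\<lambda>k. mvmult n (mtranspose W) (u k))"
  let ?col = "outer_sum S (\<lambda>_. 1) (\<lambda>k. residual n S u (mvmult n W (v k))) v"
  have "frob n (outer_sum S (\<lambda>_. 1) (\<lambda>k. mvmult n (mtranspose W) (u k)) u) \<le> sqrt (real (card S))"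
  proof (intro frob_outer_sum_le_sqrt_card u S)
    show "vnorm n (mvmult n (mtranspose W) (u k)) \<le> 1" if "k \<in> S" for k
      using op_bounded_vnorm_mvmult_le[OF op_bounded_transpose[OF W], of "u k"]
      by (simp add: orthonormal_on_vnorm[OF u that])
  qed
  then have row: "frob n ?row \<le> sqrt (real (card S))"
    using frob_transpose[of n ?row] by (simp add: mtranspose_outer_sum)
  have col: "frob n ?col \<le> sqrt (real (card S))"
  proof (intro frob_outer_sum_le_sqrt_card v S order_trans[OF vnorm_residual_le[OF u S]])
    show "vnorm n (mvmult n W (v k)) \<le> 1" if "k \<in> S" for k
      using op_bounded_vnorm_mvmult_le[OF W, of "v k"] by (simp add: orthonormal_on_vnorm[OF v that])
  qed
  have "minner n W H - minner n (compression n S u v W) H = minner n ?row H + minner n ?col H"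
    by (simp add: compression_def minner_diff_left)
  also have "\<dots> \<le> sqrt (real (card S)) * frob n H + sqrt (real (card S)) * frob n H"
    using mult_right_mono[OF row frob_nonneg[of n H]] mult_right_mono[OF col frob_nonneg[of n H]]
      abs_minner_le[of n ?row H] abs_minner_le[of n ?col H] by linarith
  finally show ?thesis
    by (simp add: mult_ac)
qed

text \<open>\<open>U V\<^sup>T + (I - P) W (I - R)\<close> is a contraction; testing \<open>X + H\<close> against it bounds
  \<open>\<langle>(I - P) W (I - R), H\<rangle>\<close>, and what remains of \<open>W\<close> has Frobenius norm at most \<open>2 \<surd>r\<close>.\<close>

theorem nuc_norm_descent_direction:
  assumes rank: "mrank n X \<le> r"
    and descent: "nuc_norm n (\<lambda>i j. X i j + H i j) \<le> nuc_norm n X"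
  shows "nuc_norm n H \<le> 3 * sqrt (real r) * frob n H"
proof -
  obtain S s u v where svd: "is_svd n S s u v X" and nuc: "nuc_norm n X = (\<Sum>k\<in>S. s k)"
    by (rule singular_value_decomposition)
  note u = is_svdD(3)[OF svd] and v = is_svdD(4)[OF svd] and S = is_svdD(1)[OF svd]
  obtain W where W: "op_bounded n 1 W" and WH: "minner n W H = nuc_norm n H"
    by (rule nuc_norm_attained)
  let ?U = "outer_sum S (\<lambda>_. 1) u v" and ?C = "compression n S u v W"
  have "vinner n (u k) (mvmult n ?C (v k)) = 0" if "k \<in> S" for k
    unfolding vinner_mvmult_compression by (simp add: vinner_def residual_member[OF u S that])
  then have "minner n ?C X = 0"
    by (simp add: is_svd_minner[OF svd])
  moreover have "minner n (\<lambda>i j. ?U i j + ?C i j) (\<lambda>i j. X i j + H i j) \<le> nuc_norm n X"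
    using minner_le_nuc_norm[OF op_bounded_outer_sum_add_compression[OF W u v S],
        of "\<lambda>i j. X i j + H i j"] descent by simp
  ultimately have "minner n ?C H \<le> - minner n ?U H"
    unfolding minner_add_left minner_add_right by (simp add: is_svd_minner_dual[OF svd] nuc)
  also have "\<dots> \<le> frob n ?U * frob n H"
    using abs_minner_le[of n ?U H] by simp
  also have "\<dots> \<le> sqrt (real (card S)) * frob n H"
    using orthonormal_on_vnorm[OF u] by (intro mult_right_mono frob_outer_sum_le_sqrt_card v S) auto
  finally have "nuc_norm n H \<le> 3 * sqrt (real (card S)) * frob n H"
    using minner_diff_compression_le[OF W u v S, of H] WH by simp
  also have "\<dots> \<le> 3 * sqrt (real r) * frob n H"
    using is_svd_card_le_mrank[OF svd] rank by (intro mult_right_mono mult_left_mono) auto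
  finally show ?thesis .
qed

section \<open>Traces of matrix powers\<close>

definition mtrace :: "nat \<Rightarrow> (nat \<Rightarrow> nat \<Rightarrow> real) \<Rightarrow> real" where
  "mtrace d A = (\<Sum>i<d. A i i)"

primrec mpower :: "nat \<Rightarrow> (nat \<Rightarrow> nat \<Rightarrow> real) \<Rightarrow> nat \<Rightarrow> nat \<Rightarrow> nat \<Rightarrow> real" where
  "mpower d A 0 = (\<lambda>i j. if i = j then 1 else 0)"
| "mpower d A (Suc m) = mmult d A (mpower d A m)"

lemma mmult_assoc: "mmult d (mmult d A B) C = mmult d A (mmult d B C)"
proof (intro ext)
  fix i j
  show "mmult d (mmult d A B) C i j = mmult d A (mmult d B C) i j"
    unfolding mmult_def sum_distrib_left sum_distrib_right mult.assoc by (rule sum.swap)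
qed

lemma mmult_add_right: "mmult d C (\<lambda>i j. A i j + B i j) = (\<lambda>i j. mmult d C A i j + mmult d C B i j)"
  by (simp add: mmult_def distrib_left sum.distrib)

lemma mat_eq_refl: "mat_eq d A A"
  by (simp add: mat_eq_def)

lemma mat_eq_mmult: "mat_eq d A A' \<Longrightarrow> mat_eq d B B' \<Longrightarrow> mat_eq d (mmult d A B) (mmult d A' B')"
  by (simp add: mat_eq_def mmult_def)

lemma mat_eq_mmult_mpower_0: "mat_eq d (mmult d A (mpower d B 0)) A" "mat_eq d (mmult d (mpower d B 0) A) A"
  by (simp_all add: mat_eq_def mmult_def if_distrib[of "\<lambda>x. _ * x"] if_distrib[of "\<lambda>x. x * _"] cong: if_cong)

lemma mpower_add: "mat_eq d (mmult d (mpower d A a) (mpower d A b)) (mpower d A (a + b))"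
proof (induction a)
  case 0
  show ?case
    using mat_eq_mmult_mpower_0(2)[of d A "mpower d A b"] by simp
next
  case (Suc a)
  then show ?case
    using mat_eq_mmult[OF mat_eq_refl Suc.IH, of A] by (simp add: mmult_assoc)
qed

lemma mpower_Suc_right: "mat_eq d (mmult d (mpower d A m) A) (mpower d A (Suc m))"
proof -
  have "mat_eq d (mmult d (mpower d A m) A) (mmult d (mpower d A m) (mpower d A 1))"
    using mat_eq_mmult_mpower_0(1)[of d A A] by (intro mat_eq_mmult mat_eq_refl) (simp add: mat_eq_sym)
  also have "mat_eq d \<dots> (mpower d A (Suc m))"
    using mpower_add[of d A m 1] by simp
  finally show ?thesis .
qed

lemma mtrace_add: "mtrace d (\<lambda>i j. A i j + B i j) = mtrace d A + mtrace d B"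
  by (simp add: mtrace_def sum.distrib)

lemma mtrace_cong: "mat_eq d A B \<Longrightarrow> mtrace d A = mtrace d B"
  by (simp add: mtrace_def mat_eq_def)

lemma mtrace_mmult: "mtrace d (mmult d A B) = minner d A (mtranspose B)"
  by (simp add: mtrace_def mmult_def minner_def)

lemma mtrace_mmult_commute: "mtrace d (mmult d A B) = mtrace d (mmult d B A)"
  unfolding mtrace_def mmult_def by (subst sum.swap) (simp add: mult.commute)

lemma mpower_eigen_decomposition:
  assumes eigen: "eigen_decomposition d A e \<mu>"
  shows "mat_eq d (mpower d A m) (outer_sum {..<d} (\<lambda>l. \<mu> l ^ m) e e)"
proof (induction m)
  case 0
  show ?case
    using eigen
    by (simp add: mat_eq_def outer_sum_def eigen_decomposition_def orthonormal_basis_complete)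
next
  case (Suc m)
  have "mmult d A (outer_sum {..<d} (\<lambda>l. \<mu> l ^ m) e e) i j
      = outer_sum {..<d} (\<lambda>l. \<mu> l ^ Suc m) e e i j" if "i < d" for i j
  proof -
    have "mmult d A (outer_sum {..<d} (\<lambda>l. \<mu> l ^ m) e e) i j
        = (\<Sum>l<d. \<mu> l ^ m * mvmult d A (e l) i * e l j)"
      unfolding mmult_def outer_sum_def mvmult_def sum_distrib_left sum_distrib_right
      by (subst sum.swap) (simp add: mult_ac)
    then show ?thesis
      using that by (simp add: eigen_decomposition_eigenvector[OF eigen] outer_sum_def mult_ac)
  qed
  then show ?case
    using mat_eq_mmult[OF mat_eq_refl Suc.IH, of A] by (simp add: mat_eq_def)
qed

lemma mtrace_mmult_mpower:
  assumes "eigen_decomposition d A e \<mu>"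
  shows "mtrace d (mmult d Z (mpower d A m)) = (\<Sum>l<d. \<mu> l ^ m * vinner d (e l) (mvmult d Z (e l)))"
proof -
  have "mtrace d (mmult d Z (mpower d A m))
      = mtrace d (mmult d Z (outer_sum {..<d} (\<lambda>l. \<mu> l ^ m) e e))"
    by (intro mtrace_cong mat_eq_mmult mat_eq_refl mpower_eigen_decomposition[OF assms])
  then show ?thesis
    by (simp only: mtrace_mmult mtranspose_outer_sum minner_outer_sum)
qed

lemma mtrace_mpower:
  assumes eigen: "eigen_decomposition d A e \<mu>"
  shows "mtrace d (mpower d A m) = (\<Sum>l<d. \<mu> l ^ m)"
proof -
  have "mtrace d (mpower d A m) = (\<Sum>i<d. \<Sum>l<d. \<mu> l ^ m * (e l i * e l i))"
    using mtrace_cong[OF mpower_eigen_decomposition[OF eigen]]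
    by (simp add: mtrace_def outer_sum_def mult.assoc)
  also have "\<dots> = (\<Sum>l<d. \<mu> l ^ m * vinner d (e l) (e l))"
    unfolding vinner_def sum_distrib_left by (rule sum.swap)
  finally show ?thesis
    using eigen by (simp add: eigen_decomposition_def orthonormal_on_def)
qed

lemma mtrace_mpower_even_nonneg:
  assumes "msymmetric d A"
  shows "0 \<le> mtrace d (mpower d A (2 * k))"
proof -
  obtain e \<mu> where "eigen_decomposition d A e \<mu>"
    using assms by (rule spectral_theorem)
  then show ?thesis
    by (simp add: mtrace_mpower sum_nonneg)
qed

lemma vinner_mvmult_mpower:
  assumes "eigen_decomposition d A e \<mu>"
  shows "vinner d x (mvmult d (mpower d A m) x) = (\<Sum>l<d. \<mu> l ^ m * (vinner d (e l) x)\<^sup>2)"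
  unfolding vinner_mvmult_cong[OF mpower_eigen_decomposition[OF assms]] vinner_mvmult_outer_sum
  by (simp add: vinner_commute[of d x] power2_eq_square)

lemma mult_powers_add_le:
  fixes x y :: real
  assumes "a + b = 2 * q"
  shows "x ^ a * y ^ b + y ^ a * x ^ b \<le> x ^ (2 * q) + y ^ (2 * q)"
proof -
  have "0 \<le> (\<bar>x\<bar> ^ a - \<bar>y\<bar> ^ a) * (\<bar>x\<bar> ^ b - \<bar>y\<bar> ^ b)"
  proof (cases "\<bar>x\<bar> \<le> \<bar>y\<bar>")
    case True
    then show ?thesis
      by (intro mult_nonpos_nonpos) (auto intro: power_mono)
  next
    case False
    then show ?thesis
      by (intro mult_nonneg_nonneg) (auto intro: power_mono)
  qed
  then have "\<bar>x\<bar> ^ a * \<bar>y\<bar> ^ b + \<bar>y\<bar> ^ a * \<bar>x\<bar> ^ b \<le> \<bar>x\<bar> ^ (a + b) + \<bar>y\<bar> ^ (a + b)"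
    by (simp add: algebra_simps power_add)
  moreover have "x ^ a * y ^ b \<le> \<bar>x\<bar> ^ a * \<bar>y\<bar> ^ b" "y ^ a * x ^ b \<le> \<bar>y\<bar> ^ a * \<bar>x\<bar> ^ b"
    using abs_ge_self[of "x ^ a * y ^ b"] abs_ge_self[of "y ^ a * x ^ b"]
    by (simp_all add: abs_mult power_abs)
  ultimately show ?thesis
    unfolding assms by (simp add: power_even_abs)
qed

lemma weighted_sum_mult_powers_le:
  fixes \<mu> :: "'k \<Rightarrow> real" and w :: "'k \<Rightarrow> 'k \<Rightarrow> real"
  assumes "a + b = 2 * q" "\<And>l m. w l m = w m l" "\<And>l m. 0 \<le> w l m"
  shows "(\<Sum>l\<in>S. \<Sum>m\<in>S. \<mu> l ^ a * \<mu> m ^ b * w l m) \<le> (\<Sum>l\<in>S. \<mu> l ^ (2 * q) * (\<Sum>m\<in>S. w l m))"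
    (is "?L \<le> ?R")
proof -
  have swap: "(\<Sum>l\<in>S. \<Sum>m\<in>S. f m l * w l m) = (\<Sum>l\<in>S. \<Sum>m\<in>S. f l m * w l m)" for f :: "'k \<Rightarrow> 'k \<Rightarrow> real"
    by (subst sum.swap) (simp add: assms(2))
  have "2 * ?L = (\<Sum>l\<in>S. \<Sum>m\<in>S. (\<mu> l ^ a * \<mu> m ^ b + \<mu> m ^ a * \<mu> l ^ b) * w l m)"
    using swap[of "\<lambda>l m. \<mu> l ^ a * \<mu> m ^ b"] by (simp add: distrib_right sum.distrib)
  also have "\<dots> \<le> (\<Sum>l\<in>S. \<Sum>m\<in>S. (\<mu> l ^ (2 * q) + \<mu> m ^ (2 * q)) * w l m)"
    by (intro sum_mono mult_right_mono mult_powers_add_le assms)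
  also have "\<dots> = 2 * ?R"
    using swap[of "\<lambda>l m. \<mu> l ^ (2 * q)"] by (simp add: distrib_right sum.distrib sum_distrib_left)
  finally show ?thesis
    by simp
qed

lemma mtrace_sandwich_eigen_decomposition:
  assumes eigen: "eigen_decomposition d A e \<mu>" and H: "msymmetric d H"
  shows "mtrace d (mmult d H (mmult d (mpower d A a) (mmult d H (mpower d A b))))
    = (\<Sum>l<d. \<Sum>m<d. \<mu> l ^ b * \<mu> m ^ a * (vinner d (e m) (mvmult d H (e l)))\<^sup>2)"
proof -
  have "mtrace d (mmult d H (mmult d (mpower d A a) (mmult d H (mpower d A b))))
      = mtrace d (mmult d (mmult d H (mmult d (mpower d A a) H)) (mpower d A b))"
    by (simp add: mmult_assoc)
  then show ?thesis
    unfolding mtrace_mmult_mpower[OF eigen] mvmult_mmult vinner_mvmult_symmetric[OF H]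
      vinner_mvmult_mpower[OF eigen] by (simp add: sum_distrib_left mult.assoc)
qed

lemma mtrace_sandwich_le:
  assumes A: "msymmetric d A" and H: "msymmetric d H" and h: "op_bounded d h H" "0 \<le> h"
    and ab: "a + b = 2 * q"
  shows "mtrace d (mmult d H (mmult d (mpower d A a) (mmult d H (mpower d A b))))
    \<le> h\<^sup>2 * mtrace d (mpower d A (2 * q))"
proof -
  obtain e \<mu> where eigen: "eigen_decomposition d A e \<mu>"
    using A by (rule spectral_theorem)
  then have orthonormal: "orthonormal_on d {..<d} e"
    by (simp add: eigen_decomposition_def)
  define w where "w l m = (vinner d (e m) (mvmult d H (e l)))\<^sup>2" for l m
  have w_commute: "w l m = w m l" for l m
    unfolding w_def vinner_mvmult_symmetric[OF H, of "e m"] by (simp add: vinner_commute)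
  have row_sum: "(\<Sum>m<d. w l m) \<le> h\<^sup>2" if "l < d" for l
    unfolding w_def Parseval_identity[OF orthonormal]
    using op_bounded_vnorm_mvmult_le[OF h, of "e l"] that
    by (intro power_mono) (simp_all add: orthonormal_on_vnorm[OF orthonormal])
  have "mtrace d (mmult d H (mmult d (mpower d A a) (mmult d H (mpower d A b))))
      = (\<Sum>l<d. \<Sum>m<d. \<mu> l ^ b * \<mu> m ^ a * w l m)"
    unfolding mtrace_sandwich_eigen_decomposition[OF eigen H] w_def ..
  also have "\<dots> \<le> (\<Sum>l<d. \<mu> l ^ (2 * q) * (\<Sum>m<d. w l m))"
    using ab w_commute by (intro weighted_sum_mult_powers_le) (auto simp: w_def add.commute)
  also have "\<dots> \<le> (\<Sum>l<d. \<mu> l ^ (2 * q) * h\<^sup>2)"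
    using row_sum by (intro sum_mono mult_left_mono) auto
  finally show ?thesis
    by (simp add: mtrace_mpower[OF eigen] sum_distrib_left mult.commute)
qed

text \<open>The derivative of \<open>A \<mapsto> A\<^sup>m\<close> in the direction \<open>H\<close>, by the product rule.\<close>

primrec mpower_deriv ::
  "nat \<Rightarrow> (nat \<Rightarrow> nat \<Rightarrow> real) \<Rightarrow> (nat \<Rightarrow> nat \<Rightarrow> real) \<Rightarrow> nat \<Rightarrow> nat \<Rightarrow> nat \<Rightarrow> real" where
  "mpower_deriv d A H 0 = (\<lambda>i j. 0)"
| "mpower_deriv d A H (Suc m) = (\<lambda>i j. mmult d H (mpower d A m) i j + mmult d A (mpower_deriv d A H m) i j)"

lemma mpower_has_derivative:
  "((\<lambda>t. mpower d (\<lambda>i j. A i j + t * H i j) m i j) has_real_derivative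
     mpower_deriv d (\<lambda>i j. A i j + t * H i j) H m i j) (at t)"
proof (induction m arbitrary: i)
  case (Suc m)
  show ?case
    unfolding mpower.simps mpower_deriv.simps mmult_def sum.distrib[symmetric]
    by (intro DERIV_sum) (auto intro!: derivative_eq_intros Suc.IH)
qed simp

lemma mtrace_mpower_has_derivative:
  "((\<lambda>t. mtrace d (mmult d H (mpower d (\<lambda>i j. A i j + t * H i j) m))) has_real_derivative
     mtrace d (mmult d H (mpower_deriv d (\<lambda>i j. A i j + t * H i j) H m))) (at t)"
  unfolding mtrace_def mmult_def by (intro DERIV_sum DERIV_cmult mpower_has_derivative)

lemma mtrace_mpower_mmult_mpower_deriv:
  "mtrace d (mmult d (mpower d A j) (mpower_deriv d A H m))
    = real m * mtrace d (mmult d H (mpower d A (m + j - 1)))"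
proof (induction m arbitrary: j)
  case 0
  show ?case
    by (simp add: mtrace_def mmult_def)
next
  case (Suc m)
  have "mtrace d (mmult d (mpower d A j) (mmult d H (mpower d A m)))
      = mtrace d (mmult d H (mmult d (mpower d A m) (mpower d A j)))"
    unfolding mtrace_mmult_commute[of d "mpower d A j"] by (simp add: mmult_assoc)
  also have "\<dots> = mtrace d (mmult d H (mpower d A (m + j)))"
    by (intro mtrace_cong mat_eq_mmult mat_eq_refl mpower_add)
  finally have H_term: "mtrace d (mmult d (mpower d A j) (mmult d H (mpower d A m)))
      = mtrace d (mmult d H (mpower d A (m + j)))" .
  have "mtrace d (mmult d (mpower d A j) (mmult d A (mpower_deriv d A H m)))
      = mtrace d (mmult d (mpower d A (Suc j)) (mpower_deriv d A H m))"
    unfolding mmult_assoc[symmetric] by (intro mtrace_cong mat_eq_mmult mat_eq_refl mpower_Suc_right)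
  then show ?case
    using Suc.IH[of "Suc j"] by (simp add: mmult_add_right mtrace_add H_term distrib_right)
qed

lemma mtrace_mpower_deriv:
  "mtrace d (mpower_deriv d A H m) = real m * mtrace d (mmult d H (mpower d A (m - 1)))"
  using mtrace_mpower_mmult_mpower_deriv[of d A 0 H m]
    mtrace_cong[OF mat_eq_mmult_mpower_0(2), of d A "mpower_deriv d A H m"] by simp

lemma mtrace_mmult_mpower_deriv_le:
  assumes A: "msymmetric d A" and H: "msymmetric d H" and h: "op_bounded d h H" "0 \<le> h"
    and "m + j = Suc (2 * q)"
  shows "mtrace d (mmult d H (mmult d (mpower d A j) (mpower_deriv d A H m)))
    \<le> real m * (h\<^sup>2 * mtrace d (mpower d A (2 * q)))"
  using assms(5)
proof (induction m arbitrary: j)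
  case 0
  show ?case
    by (simp add: mtrace_def mmult_def)
next
  case (Suc m)
  have "mtrace d (mmult d H (mmult d (mpower d A j) (mmult d H (mpower d A m))))
      \<le> h\<^sup>2 * mtrace d (mpower d A (2 * q))"
    using Suc.prems by (intro mtrace_sandwich_le A H h) simp
  moreover have "mtrace d (mmult d H (mmult d (mpower d A j) (mmult d A (mpower_deriv d A H m))))
      = mtrace d (mmult d H (mmult d (mpower d A (Suc j)) (mpower_deriv d A H m)))"
    unfolding mmult_assoc[of d "mpower d A j", symmetric]
    by (intro mtrace_cong mat_eq_mmult mat_eq_refl mpower_Suc_right)
  ultimately show ?case
    using Suc.IH[of "Suc j"] Suc.prems by (simp add: mmult_add_right mtrace_add distrib_right)
qed

section \<open>Smoothness of the squared Schatten norm\<close>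

text \<open>The summand \<open>\<kappa>\<close> keeps the squared Schatten \<open>2 k\<close>-norm differentiable at \<open>A = 0\<close>.\<close>

definition schatten_potential :: "nat \<Rightarrow> nat \<Rightarrow> real \<Rightarrow> (nat \<Rightarrow> nat \<Rightarrow> real) \<Rightarrow> real" where
  "schatten_potential d k \<kappa> A = (mtrace d (mpower d A (2 * k)) + \<kappa>) powr (1 / real k)"

definition schatten_potential_deriv ::
  "nat \<Rightarrow> nat \<Rightarrow> real \<Rightarrow> (nat \<Rightarrow> nat \<Rightarrow> real) \<Rightarrow> (nat \<Rightarrow> nat \<Rightarrow> real) \<Rightarrow> real" where
  "schatten_potential_deriv d k \<kappa> A H = 2 * (mtrace d (mpower d A (2 * k)) + \<kappa>) powr (1 / real k - 1)
     * mtrace d (mmult d H (mpower d A (2 * k - 1)))"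

lemma schatten_potential_nonneg: "0 \<le> schatten_potential d k \<kappa> A"
  by (simp add: schatten_potential_def)

lemma schatten_potential_deriv_scale:
  "schatten_potential_deriv d k \<kappa> A (\<lambda>i j. c * H i j) = c * schatten_potential_deriv d k \<kappa> A H"
  by (simp add: schatten_potential_deriv_def mtrace_mmult minner_scale_left)

lemma eigenvalue_power2_le_schatten_potential:
  assumes "eigen_decomposition d A e \<mu>" "l < d" "1 \<le> k" "0 < \<kappa>"
  shows "(\<mu> l)\<^sup>2 \<le> schatten_potential d k \<kappa> A"
proof -
  have "((\<mu> l)\<^sup>2) ^ k = \<mu> l ^ (2 * k)"
    by (simp add: power_mult)
  also have "\<dots> \<le> (\<Sum>l<d. \<mu> l ^ (2 * k))"
    using assms(2) by (intro member_le_sum) auto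
  also have "\<dots> \<le> mtrace d (mpower d A (2 * k)) + \<kappa>"
    using assms(4) by (simp add: mtrace_mpower[OF assms(1)])
  finally have le: "((\<mu> l)\<^sup>2) ^ k \<le> mtrace d (mpower d A (2 * k)) + \<kappa>" .
  have "0 < mtrace d (mpower d A (2 * k)) + \<kappa>"
    using assms(4) by (simp add: mtrace_mpower[OF assms(1)] add_nonneg_pos sum_nonneg)
  then have "mtrace d (mpower d A (2 * k)) + \<kappa> = schatten_potential d k \<kappa> A ^ k"
    using assms(3) by (simp add: schatten_potential_def powr_power)
  then show ?thesis
    using le assms(3) power_mono_iff[of "(\<mu> l)\<^sup>2" "schatten_potential d k \<kappa> A" k]
    by (simp add: schatten_potential_nonneg)
qed

lemma op_bounded_sqrt_schatten_potential:
  assumes "msymmetric d A" "1 \<le> k" "0 < \<kappa>"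
  shows "op_bounded d (sqrt (schatten_potential d k \<kappa> A)) A" (is "op_bounded d ?c A")
proof -
  obtain e \<mu> where eigen: "eigen_decomposition d A e \<mu>"
    using assms(1) by (rule spectral_theorem)
  have orthonormal: "orthonormal_on d {..<d} e"
    using eigen by (simp add: eigen_decomposition_def)
  have abs_eigenvalue: "\<bar>\<mu> l\<bar> \<le> ?c" if "l < d" for l
    using eigenvalue_power2_le_schatten_potential[OF eigen that assms(2,3)] by (simp add: real_le_rsqrt)
  show ?thesis
    unfolding op_bounded_def
  proof (intro allI)
    fix x y
    have "vinner d x (mvmult d A y) = (\<Sum>l<d. \<mu> l * (vinner d (e l) x * vinner d (e l) y))"
      using vinner_mvmult_cong[of d A "outer_sum {..<d} \<mu> e e"] eigen
      by (simp add: eigen_decomposition_def vinner_mvmult_outer_sum vinner_commute[of d x])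
    also have "\<dots> \<le> (\<Sum>l<d. ?c * (\<bar>vinner d (e l) x\<bar> * \<bar>vinner d (e l) y\<bar>))"
    proof (rule sum_mono)
      fix l assume "l \<in> {..<d}"
      then have "\<bar>\<mu> l\<bar> * \<bar>vinner d (e l) x * vinner d (e l) y\<bar> \<le> ?c * \<bar>vinner d (e l) x * vinner d (e l) y\<bar>"
        by (intro mult_right_mono abs_eigenvalue) auto
      then show "\<mu> l * (vinner d (e l) x * vinner d (e l) y) \<le> ?c * (\<bar>vinner d (e l) x\<bar> * \<bar>vinner d (e l) y\<bar>)"
        using abs_ge_self[of "\<mu> l * (vinner d (e l) x * vinner d (e l) y)"] by (simp add: abs_mult)
    qed
    also have "\<dots> \<le> ?c * (L2_set (\<lambda>l. vinner d (e l) x) {..<d} * L2_set (\<lambda>l. vinner d (e l) y) {..<d})"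
      unfolding sum_distrib_left[symmetric]
      by (intro mult_left_mono L2_set_mult_ineq) (simp add: schatten_potential_nonneg)
    also have "\<dots> = ?c * vnorm d x * vnorm d y"
      by (simp add: L2_set_def Parseval_identity[OF orthonormal] mult.assoc)
    finally show "vinner d x (mvmult d A y) \<le> ?c * vnorm d x * vnorm d y" .
  qed
qed

lemma power_pred_le:
  fixes y Q :: real
  assumes "0 \<le> y" "0 < Q"
  shows "y ^ k \<le> (y ^ Suc k + Q ^ Suc k) / Q"
proof -
  have "y ^ k * Q \<le> y ^ Suc k + Q ^ Suc k"
  proof (cases "y \<le> Q")
    case True
    then have "y ^ k * Q \<le> Q ^ Suc k"
      using assms by (simp add: mult.commute[of Q] mult_right_mono power_mono)
    then show ?thesis
      using assms by (simp add: add_increasing)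
  next
    case False
    then have "y ^ k * Q \<le> y ^ Suc k"
      using assms by (simp add: mult.commute[of y] mult_left_mono)
    then show ?thesis
      using assms by (simp add: add_increasing2)
  qed
  then show ?thesis
    using assms by (simp add: pos_le_divide_eq)
qed

text \<open>Hoelder's inequality up to the factor 2.\<close>

lemma sum_power_pred_le:
  fixes y :: "'k \<Rightarrow> real"
  assumes S: "finite S" "S \<noteq> {}" and y: "\<And>l. 0 \<le> y l" and F: "(\<Sum>l\<in>S. y l ^ k) \<le> F" "0 < F"
    and "1 \<le> k"
  shows "(\<Sum>l\<in>S. y l ^ (k - 1)) \<le> 2 * real (card S) powr (1 / real k) * F powr (1 - 1 / real k)"
proof -
  have card: "0 < real (card S)"
    using S by (simp add: card_gt_0_iff)
  define Q where "Q = (F / real (card S)) powr (1 / real k)"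
  have Q: "0 < Q" "Q ^ k = F / real (card S)"
    using F card \<open>1 \<le> k\<close> by (auto simp: Q_def powr_power)
  have "(\<Sum>l\<in>S. y l ^ (k - 1)) \<le> (\<Sum>l\<in>S. (y l ^ k + Q ^ k) / Q)"
    using power_pred_le[OF y Q(1), of _ "k - 1"] \<open>1 \<le> k\<close> by (intro sum_mono) simp
  also have "\<dots> = ((\<Sum>l\<in>S. y l ^ k) + F) / Q"
    using card by (simp add: sum.distrib Q(2) flip: sum_divide_distrib)
  also have "\<dots> \<le> 2 * (F / Q)"
    using F Q by (simp add: field_simps)
  also have "F / Q = real (card S) powr (1 / real k) * F powr (1 - 1 / real k)"
    using F card by (simp add: Q_def powr_divide powr_diff field_simps)
  finally show ?thesis
    by simp
qed

lemma powr_inverse_le_3: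
  assumes "0 < (x::real)" "ln x \<le> real k" "1 \<le> k"
  shows "x powr (1 / real k) \<le> 3"
proof -
  have "ln x / real k \<le> 1"
    using assms by (simp add: field_simps)
  then have "x powr (1 / real k) \<le> exp 1"
    using assms by (simp add: powr_def)
  also have "\<dots> \<le> 3"
    using exp_le by simp
  finally show ?thesis .
qed

lemma mtrace_mpower_pred_le:
  assumes "msymmetric d A" "1 \<le> d" "1 \<le> k" "ln (real d) \<le> real k"
    and "0 < \<kappa>"
  shows "mtrace d (mpower d A (2 * (k - 1)))
    \<le> 6 * (mtrace d (mpower d A (2 * k)) + \<kappa>) powr (1 - 1 / real k)"
proof -
  obtain e \<mu> where eigen: "eigen_decomposition d A e \<mu>"
    using assms(1) by (rule spectral_theorem)
  define F where "F = mtrace d (mpower d A (2 * k)) + \<kappa>"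
  have "0 < F"
    using mtrace_mpower_even_nonneg[OF assms(1), of k] assms(5) by (simp add: F_def)
  have "(\<Sum>l<d. ((\<mu> l)\<^sup>2) ^ k) \<le> F"
    using assms(5) by (simp add: F_def mtrace_mpower[OF eigen] power_mult)
  then have "(\<Sum>l<d. ((\<mu> l)\<^sup>2) ^ (k - 1)) \<le> 2 * real d powr (1 / real k) * F powr (1 - 1 / real k)"
    using sum_power_pred_le[of "{..<d}" "\<lambda>l. (\<mu> l)\<^sup>2" k F] \<open>0 < F\<close> assms(2,3)
    by (simp add: lessThan_empty_iff)
  also have "\<dots> \<le> 2 * 3 * F powr (1 - 1 / real k)"
    using assms(2-4) by (intro mult_right_mono mult_left_mono powr_inverse_le_3) auto
  finally show ?thesis
    by (simp add: F_def mtrace_mpower[OF eigen] power_mult)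
qed

text \<open>The term of the second derivative containing \<open>(f')\<^sup>2\<close> is nonpositive because \<open>1 / k \<le> 1\<close>.\<close>

lemma powr_inverse_second_order_le:
  fixes f f' f'' :: "real \<Rightarrow> real"
  assumes pos: "\<And>t. 0 < f t" and k: "1 \<le> k"
    and f: "\<And>t. (f has_real_derivative f' t) (at t)"
    and f': "\<And>t. (f' has_real_derivative f'' t) (at t)"
    and f''_le: "\<And>t. f'' t \<le> c * k * f t powr (1 - 1 / k)"
  shows "f 1 powr (1 / k) \<le> f 0 powr (1 / k) + 1 / k * f 0 powr (1 / k - 1) * f' 0 + c / 2"
proof -
  define g' where "g' t = 1 / k * f t powr (1 / k - 1) * f' t" for t
  define g'' where "g'' t = (1 / k) * (1 / k - 1) * f t powr (1 / k - 1 - 1) * (f' t)\<^sup>2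
      + 1 / k * f t powr (1 / k - 1) * f'' t" for t
  have powr_deriv: "((\<lambda>t. f t powr a) has_real_derivative a * f t powr (a - 1) * f' t) (at t)" for a t
    by (rule DERIV_chain2[where f = "\<lambda>x. x powr a" and g = f, OF has_real_derivative_powr[OF pos] f])
  have "(g' has_real_derivative g'' t) (at t)" for t
    unfolding g'_def g''_def
    by (rule DERIV_cong[OF DERIV_mult[OF DERIV_cmult[OF powr_deriv] f']]) (simp add: power2_eq_square mult_ac)
  moreover have "((\<lambda>t. f t powr (1 / k)) has_real_derivative g' t) (at t)" for t
    unfolding g'_def by (rule powr_deriv)
  ultimately have derivs: "\<forall>m t. m < 2 \<and> 0 \<le> t \<and> t \<le> 1 \<longrightarrow>
      ([\<lambda>t. f t powr (1 / k), g', g''] ! m has_real_derivative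
        ([\<lambda>t. f t powr (1 / k), g', g''] ! Suc m) t) (at t)"
    by (auto simp: less_2_cases_iff)
  obtain t where "f 1 powr (1 / k) = f 0 powr (1 / k) + g' 0 + g'' t / 2"
    using Maclaurin2[OF _ _ derivs, of "\<lambda>t. f t powr (1 / k)"] by (auto simp: numeral_2_eq_2)
  moreover have "g'' t \<le> c"
  proof -
    have "(1 / k) * (1 / k - 1) * f t powr (1 / k - 1 - 1) * (f' t)\<^sup>2 \<le> 0"
      using k by (intro mult_nonpos_nonneg mult_nonneg_nonpos) auto
    then have "g'' t \<le> 1 / k * f t powr (1 / k - 1) * (c * k * f t powr (1 - 1 / k))"
      using mult_left_mono[OF f''_le[of t], of "1 / k * f t powr (1 / k - 1)"] k unfolding g''_def by simp
    also have "\<dots> = c * (f t powr (1 / k - 1) * f t powr (1 - 1 / k))"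
      using k by simp
    also have "\<dots> = c"
      using pos[of t] by (simp flip: powr_add)
    finally show ?thesis .
  qed
  ultimately show ?thesis
    by (simp add: g'_def)
qed

lemma msymmetric_add_scale:
  "msymmetric d A \<Longrightarrow> msymmetric d H \<Longrightarrow> msymmetric d (\<lambda>i j. A i j + t * H i j)"
  by (simp add: msymmetric_def mat_eq_def)

theorem schatten_potential_smooth:
  assumes A: "msymmetric d A" and H: "msymmetric d H" and h: "op_bounded d h H" "0 \<le> h"
    and k: "1 \<le> k" and \<kappa>: "0 < \<kappa>" and d: "1 \<le> d" "ln (real d) \<le> real k"
  shows "schatten_potential d k \<kappa> (\<lambda>i j. A i j + H i j)
    \<le> schatten_potential d k \<kappa> A + schatten_potential_deriv d k \<kappa> A H + 12 * real k * h\<^sup>2"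
proof -
  define At where "At t = (\<lambda>i j. A i j + t * H i j)" for t
  define f where "f t = mtrace d (mpower d (At t) (2 * k)) + \<kappa>" for t
  define f' where "f' t = 2 * real k * mtrace d (mmult d H (mpower d (At t) (2 * k - 1)))" for t
  define f'' where "f'' t = 2 * real k * mtrace d (mmult d H (mpower_deriv d (At t) H (2 * k - 1)))" for t
  have At: "msymmetric d (At t)" for t
    unfolding At_def by (rule msymmetric_add_scale[OF A H])
  have "f 1 powr (1 / real k)
      \<le> f 0 powr (1 / real k) + 1 / real k * f 0 powr (1 / real k - 1) * f' 0 + (24 * real k * h\<^sup>2) / 2"
  proof (rule powr_inverse_second_order_le)
    show "0 < f t" for t
      using mtrace_mpower_even_nonneg[OF At, of t k] \<kappa> by (simp add: f_def)
    show "1 \<le> real k"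
      using k by simp
    have "((\<lambda>t. mtrace d (mpower d (At t) (2 * k)) + \<kappa>) has_real_derivative
        mtrace d (mpower_deriv d (At t) H (2 * k))) (at t)" for t
      unfolding At_def mtrace_def by (auto intro!: derivative_eq_intros DERIV_sum mpower_has_derivative)
    then show "(f has_real_derivative f' t) (at t)" for t
      by (simp add: f_def[abs_def] f'_def mtrace_mpower_deriv)
    show "(f' has_real_derivative f'' t) (at t)" for t
      unfolding f'_def f''_def At_def by (intro DERIV_cmult mtrace_mpower_has_derivative)
    show "f'' t \<le> 24 * real k * h\<^sup>2 * real k * f t powr (1 - 1 / real k)" for t
    proof -
      have "mtrace d (mmult d H (mpower_deriv d (At t) H (2 * k - 1)))
          = mtrace d (mmult d H (mmult d (mpower d (At t) 0) (mpower_deriv d (At t) H (2 * k - 1))))"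
        by (intro mtrace_cong mat_eq_mmult mat_eq_refl mat_eq_sym[OF mat_eq_mmult_mpower_0(2)])
      also have "\<dots> \<le> real (2 * k - 1) * (h\<^sup>2 * mtrace d (mpower d (At t) (2 * (k - 1))))"
        using k by (intro mtrace_mmult_mpower_deriv_le At H h) simp
      also have "\<dots> \<le> 2 * real k * (h\<^sup>2 * (6 * f t powr (1 - 1 / real k)))"
        unfolding f_def
        by (intro mult_mono mult_nonneg_nonneg mtrace_mpower_pred_le mtrace_mpower_even_nonneg At d k \<kappa>) auto
      finally have "f'' t \<le> 2 * real k * (2 * real k * (h\<^sup>2 * (6 * f t powr (1 - 1 / real k))))"
        unfolding f''_def by (intro mult_left_mono) auto
      then show ?thesis
        by (simp add: mult_ac)
    qed
  qed
  then show ?thesis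
    using k by (simp add: f_def f'_def At_def schatten_potential_def schatten_potential_deriv_def)
qed

section \<open>Covering the nuclear ball by a matrix perceptron\<close>

text \<open>The symmetric dilation with zero diagonal blocks and off-diagonal blocks \<open>B\<close>, \<open>B\<^sup>T\<close>.\<close>

definition dilation :: "nat \<Rightarrow> (nat \<Rightarrow> nat \<Rightarrow> real) \<Rightarrow> nat \<Rightarrow> nat \<Rightarrow> real" where
  "dilation n B = (\<lambda>i j. if i < n \<and> n \<le> j then B i (j - n) else if n \<le> i \<and> j < n then B j (i - n) else 0)"

lemma msymmetric_dilation: "msymmetric d (dilation n B)"
  by (simp add: msymmetric_def mat_eq_def dilation_def)

lemma dilation_add_scale:
  "dilation n (\<lambda>i j. A i j + c * B i j) = (\<lambda>i j. dilation n A i j + c * dilation n B i j)"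
  by (intro ext) (simp add: dilation_def)

lemma (in comm_monoid_set) lessThan_double: "F g {..<2 * n} = F g {..<n} \<^bold>* F (\<lambda>i. g (i + n)) {..<n}" for n :: nat
proof -
  have "F g {..<2 * n} = F g {0..<n} \<^bold>* F g {n..<n + n}"
    by (simp add: atLeastLessThan_concat lessThan_atLeast0 mult_2)
  also have "F g {n..<n + n} = F (\<lambda>i. g (i + n)) {0..<n}"
    using shift_bounds_nat_ivl[of g 0 n n] by simp
  finally show ?thesis
    by (simp add: lessThan_atLeast0)
qed

lemma vinner_double:
  "vinner (2 * n) x y = vinner n x y + vinner n (\<lambda>i. x (i + n)) (\<lambda>i. y (i + n))"
  by (simp add: vinner_def sum.lessThan_double)

lemma vinner_mvmult_dilation:
  "vinner (2 * n) x (mvmult (2 * n) (dilation n B) y)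
    = vinner n x (mvmult n B (\<lambda>j. y (j + n))) + vinner n y (mvmult n B (\<lambda>i. x (i + n)))"
proof -
  have "vinner (2 * n) x (mvmult (2 * n) (dilation n B) y)
      = vinner n x (mvmult n B (\<lambda>j. y (j + n))) + vinner n (\<lambda>i. x (i + n)) (mvmult n (mtranspose B) y)"
    unfolding vinner_double
    by (intro arg_cong2[where f = "(+)"] vinner_cong) (simp_all add: mvmult_def sum.lessThan_double dilation_def)
  also have "vinner n (\<lambda>i. x (i + n)) (mvmult n (mtranspose B) y) = vinner n y (mvmult n B (\<lambda>i. x (i + n)))"
    unfolding vinner_mvmult_transpose[of n y] by (rule vinner_commute)
  finally show ?thesis .
qed

lemma op_bounded_dilation:
  assumes "op_bounded n c B" "0 \<le> c"
  shows "op_bounded (2 * n) c (dilation n B)"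
  unfolding op_bounded_def
proof (intro allI)
  fix x y :: "nat \<Rightarrow> real"
  let ?x = "\<lambda>i. x (i + n)" and ?y = "\<lambda>i. y (i + n)"
  have vnorm_double: "vnorm (2 * n) z = sqrt ((vnorm n z)\<^sup>2 + (vnorm n (\<lambda>i. z (i + n)))\<^sup>2)" for z
    unfolding vnorm_power2 by (simp add: vnorm_eq_sqrt_vinner vinner_double)
  have "vinner (2 * n) x (mvmult (2 * n) (dilation n B) y)
      \<le> c * vnorm n x * vnorm n ?y + c * vnorm n y * vnorm n ?x"
    unfolding vinner_mvmult_dilation by (intro add_mono op_boundedD[OF assms(1)])
  also have "\<dots> = c * (vnorm n x * vnorm n ?y + vnorm n ?x * vnorm n y)"
    by (simp add: algebra_simps)
  also have "\<dots> \<le> c * (vnorm (2 * n) x * vnorm (2 * n) y)"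
    using assms(2) mult_add_mult_le_sqrt[of "vnorm n x" "vnorm n ?y" "vnorm n ?x" "vnorm n y"]
    unfolding vnorm_double by (intro mult_left_mono) (simp_all add: add.commute)
  finally show "vinner (2 * n) x (mvmult (2 * n) (dilation n B) y) \<le> c * vnorm (2 * n) x * vnorm (2 * n) y"
    by (simp add: mult.assoc)
qed

lemma op_bounded_of_dilation:
  assumes "op_bounded (2 * n) c (dilation n B)"
  shows "op_bounded n c B"
  unfolding op_bounded_def
proof (intro allI)
  fix x y :: "nat \<Rightarrow> real"
  define x' where "x' = (\<lambda>i. if i < n then x i else 0)"
  define y' where "y' = (\<lambda>i. if i < n then 0 else y (i - n))"
  have "vinner n x' (mvmult n B (\<lambda>j. y' (j + n))) + vinner n y' (mvmult n B (\<lambda>i. x' (i + n)))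
      = vinner n x (mvmult n B y)"
    by (simp add: vinner_def x'_def y'_def)
  moreover have "vnorm (2 * n) x' = vnorm n x" "vnorm (2 * n) y' = vnorm n y"
    by (simp_all add: vnorm_def sum.lessThan_double x'_def y'_def)
  ultimately show "vinner n x (mvmult n B y) \<le> c * vnorm n x * vnorm n y"
    using op_boundedD[OF assms, of x' y'] by (simp add: vinner_mvmult_dilation)
qed

text \<open>The matrix \<open>p\<close>-norm perceptron with \<open>p = 2 k \<approx> 2 ln (2 n)\<close>. As long as the current guess is
  off by more than \<open>\<epsilon>\<close> on some measurement \<open>i\<close>, the state moves by \<open>\<plusminus>\<eta> B\<^sub>i\<close>. Every such mistake
  raises \<open>\<langle>state, X\<rangle>\<close> against the potential, so their number is bounded; and the list of mistakes
  determines the guess.\<close>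

locale matrix_perceptron =
  fixes n k m :: nat and B :: "nat \<Rightarrow> nat \<Rightarrow> nat \<Rightarrow> real" and K s \<epsilon> :: real
  assumes B: "\<And>i. i < m \<Longrightarrow> op_bounded n K (B i)"
    and K: "0 < K" and s: "0 < s" and \<epsilon>: "0 < \<epsilon>"
    and n: "1 \<le> n" and k: "1 \<le> k" and ln_n_le_k: "ln (real (2 * n)) \<le> real k"
begin

definition rate :: real where
  "rate = \<epsilon> / (24 * real k * K\<^sup>2)"

primrec state :: "(nat \<times> real) list \<Rightarrow> nat \<Rightarrow> nat \<Rightarrow> real" where
  "state [] = (\<lambda>i j. 0)"
| "state (mistake # xs) = (\<lambda>i j. state xs i j + (rate * snd mistake) * B (fst mistake) i j)"

definition potential :: "(nat \<times> real) list \<Rightarrow> real" where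
  "potential xs = schatten_potential (2 * n) k ((s\<^sup>2 / 4) ^ k) (dilation n (state xs))"

definition guess :: "(nat \<times> real) list \<Rightarrow> nat \<Rightarrow> real" where
  "guess xs i =
    schatten_potential_deriv (2 * n) k ((s\<^sup>2 / 4) ^ k) (dilation n (state xs)) (dilation n (B i))"

definition margin :: "(nat \<Rightarrow> nat \<Rightarrow> real) \<Rightarrow> (nat \<times> real) list \<Rightarrow> real" where
  "margin X xs = minner n (state xs) X - potential xs"

lemma rate_pos: "0 < rate"
  using \<epsilon> k K by (simp add: rate_def)

lemma smoothing_pos: "0 < (s\<^sup>2 / 4) ^ k"
  using s by simp

lemma potential_Nil: "potential [] = s\<^sup>2 / 4"
proof -
  obtain k' where "2 * k = Suc k'"
    using k by (cases "2 * k") auto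
  then have "mtrace (2 * n) (mpower (2 * n) (\<lambda>i j. 0) (2 * k)) = 0"
    by (simp add: mtrace_def mmult_def)
  moreover have "dilation n (\<lambda>i j. 0) = (\<lambda>i j. 0)"
    by (intro ext) (simp add: dilation_def)
  ultimately have "potential [] = ((s\<^sup>2 / 4) ^ k) powr (1 / real k)"
    by (simp add: potential_def schatten_potential_def)
  also have "\<dots> = ((s\<^sup>2 / 4) powr real k) powr (1 / real k)"
    using s by (simp add: powr_realpow)
  also have "\<dots> = s\<^sup>2 / 4"
    using s k unfolding powr_powr by simp
  finally show ?thesis .
qed

lemma margin_le:
  assumes "nuc_norm n X \<le> s"
  shows "margin X xs \<le> s\<^sup>2 / 4"
proof -
  have nonneg: "0 \<le> potential xs"
    by (simp add: potential_def schatten_potential_nonneg)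
  have "op_bounded n (sqrt (potential xs)) (state xs)"
    unfolding potential_def
    by (rule op_bounded_of_dilation[OF op_bounded_sqrt_schatten_potential[OF msymmetric_dilation k smoothing_pos]])
  then have "minner n (state xs) X \<le> sqrt (potential xs) * nuc_norm n X"
    by (rule minner_le_nuc_norm)
  also have "\<dots> \<le> sqrt (potential xs) * s"
    using assms nonneg by (intro mult_left_mono) auto
  also have "\<dots> \<le> potential xs + s\<^sup>2 / 4"
    using sum_squares_bound[of "sqrt (potential xs)" "s / 2"] nonneg by (simp add: power_divide)
  finally show ?thesis
    by (simp add: margin_def)
qed

lemma potential_Cons_le:
  assumes i: "i < m" and \<sigma>: "\<bar>\<sigma>\<bar> = 1"
  shows "potential ((i, \<sigma>) # xs) \<le> potential xs + rate * \<sigma> * guess xs i + 12 * real k * (rate * K)\<^sup>2"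
proof -
  let ?A = "dilation n (state xs)" and ?H = "\<lambda>a b. (rate * \<sigma>) * dilation n (B i) a b"
  have "op_bounded (2 * n) (\<bar>rate * \<sigma>\<bar> * K) ?H"
    using K by (intro op_bounded_scale op_bounded_dilation B i) simp
  moreover have "msymmetric (2 * n) ?H"
    using msymmetric_dilation[of "2 * n" n "B i"] by (simp add: msymmetric_def mat_eq_def)
  ultimately have "schatten_potential (2 * n) k ((s\<^sup>2 / 4) ^ k) (\<lambda>a b. ?A a b + ?H a b)
      \<le> potential xs + schatten_potential_deriv (2 * n) k ((s\<^sup>2 / 4) ^ k) ?A ?H
        + 12 * real k * (\<bar>rate * \<sigma>\<bar> * K)\<^sup>2"
    unfolding potential_def using n k ln_n_le_k K smoothing_pos
    by (intro schatten_potential_smooth msymmetric_dilation) auto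
  then show ?thesis
    using \<sigma> by (simp add: potential_def[of "_ # _"] dilation_add_scale schatten_potential_deriv_scale
        guess_def abs_mult power_mult_distrib)
qed

lemma margin_Cons_ge:
  assumes i: "i < m" and \<sigma>: "\<bar>\<sigma>\<bar> = 1" and mistake: "\<epsilon> \<le> \<sigma> * (minner n (B i) X - guess xs i)"
  shows "margin X xs + \<epsilon>\<^sup>2 / (48 * real k * K\<^sup>2) \<le> margin X ((i, \<sigma>) # xs)"
proof -
  have "rate * \<epsilon> \<le> rate * (\<sigma> * (minner n (B i) X - guess xs i))"
    using rate_pos mistake by (intro mult_left_mono) auto
  then have "margin X xs + (rate * \<epsilon> - 12 * real k * (rate * K)\<^sup>2) \<le> margin X ((i, \<sigma>) # xs)"
    using potential_Cons_le[OF i \<sigma>, of xs]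
    unfolding margin_def state.simps fst_conv snd_conv minner_add_left minner_scale_left
    by (simp add: algebra_simps)
  also have "rate * \<epsilon> - 12 * real k * (rate * K)\<^sup>2 = \<epsilon>\<^sup>2 / (48 * real k * K\<^sup>2)"
    using k K by (simp add: rate_def field_simps power2_eq_square)
  finally show ?thesis .
qed

definition mistake_lists :: "nat \<Rightarrow> (nat \<times> real) list set" where
  "mistake_lists T = {xs. set xs \<subseteq> {..<m} \<times> {1, - 1} \<and> length xs \<le> T}"

lemma finite_mistake_lists: "finite (mistake_lists T)"
  unfolding mistake_lists_def by (rule finite_lists_length_le) auto

lemma sum_powers_le_power_Suc: "(\<Sum>i\<le>T. a ^ i) \<le> (a + 1) ^ T" for a :: nat
proof (induction T)
  case (Suc T)
  have "a * a ^ T \<le> a * (a + 1) ^ T"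
    by (intro mult_le_mono2 power_mono) auto
  then have "(\<Sum>i\<le>Suc T. a ^ i) \<le> (a + 1) ^ T + a * (a + 1) ^ T"
    unfolding sum.atMost_Suc power_Suc by (intro add_mono Suc.IH)
  then show ?case
    by simp
qed simp

lemma card_mistake_lists: "card (mistake_lists T) \<le> (2 * m + 1) ^ T"
proof -
  have "card ({..<m} \<times> {1, - 1 :: real}) = 2 * m"
    by (simp add: card_cartesian_product)
  then have "card (mistake_lists T) = (\<Sum>i\<le>T. (2 * m) ^ i)"
    unfolding mistake_lists_def by (subst card_lists_length_le) (simp, simp only:)
  also have "\<dots> \<le> (2 * m + 1) ^ T"
    by (rule sum_powers_le_power_Suc)
  finally show ?thesis .
qed

lemma mistake_list_extend:
  assumes xs: "xs \<in> mistake_lists t" and i: "i < m" "\<epsilon> < \<bar>minner n (B i) X - guess xs i\<bar>"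
  shows "\<exists>ys\<in>mistake_lists (Suc t). margin X xs + \<epsilon>\<^sup>2 / (48 * real k * K\<^sup>2) \<le> margin X ys"
proof -
  define \<sigma> :: real where "\<sigma> = (if 0 \<le> minner n (B i) X - guess xs i then 1 else - 1)"
  have "\<bar>\<sigma>\<bar> = 1" "\<epsilon> \<le> \<sigma> * (minner n (B i) X - guess xs i)"
    using i(2) by (auto simp: \<sigma>_def abs_if split: if_splits)
  then have "margin X xs + \<epsilon>\<^sup>2 / (48 * real k * K\<^sup>2) \<le> margin X ((i, \<sigma>) # xs)"
    by (rule margin_Cons_ge[OF i(1)])
  moreover have "(i, \<sigma>) # xs \<in> mistake_lists (Suc t)"
    using xs i(1) by (auto simp: mistake_lists_def \<sigma>_def)
  ultimately show ?thesis
    by blast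
qed

lemma exists_accurate_guess:
  assumes X: "nuc_norm n X \<le> s" and T: "24 * real k * K\<^sup>2 * s\<^sup>2 / \<epsilon>\<^sup>2 \<le> real T"
  shows "\<exists>xs\<in>mistake_lists T. \<forall>i<m. \<bar>minner n (B i) X - guess xs i\<bar> \<le> \<epsilon>"
proof (rule ccontr)
  assume inaccurate: "\<not> ?thesis"
  define gain where "gain = \<epsilon>\<^sup>2 / (48 * real k * K\<^sup>2)"
  have "\<exists>xs\<in>mistake_lists t. real t * gain - s\<^sup>2 / 4 \<le> margin X xs"
    if "t \<le> Suc T" for t
    using that
  proof (induction t)
    case 0
    have "margin X [] = - (s\<^sup>2 / 4)"
      by (simp add: margin_def potential_Nil minner_def)
    then show ?case
      by (intro bexI[of _ "[]"]) (auto simp: mistake_lists_def)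
  next
    case (Suc t)
    then obtain xs where xs: "xs \<in> mistake_lists t"
      and xs_margin: "real t * gain - s\<^sup>2 / 4 \<le> margin X xs"
      by auto
    have "xs \<in> mistake_lists T"
      using xs Suc.prems by (simp add: mistake_lists_def)
    then obtain i where "i < m" "\<epsilon> < \<bar>minner n (B i) X - guess xs i\<bar>"
      using inaccurate by (meson not_le)
    then obtain ys where "ys \<in> mistake_lists (Suc t)" "margin X xs + gain \<le> margin X ys"
      using mistake_list_extend[OF xs, of i X] unfolding gain_def by blast
    then show ?case
      using xs_margin by (intro bexI[of _ ys]) (auto simp: distrib_right)
  qed
  from this[of "Suc T"] obtain xs where
    "real (Suc T) * gain - s\<^sup>2 / 4 \<le> margin X xs"
    by blast
  then have "real (Suc T) * gain \<le> s\<^sup>2 / 2"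
    using margin_le[OF X, of xs] by simp
  then have "real (Suc T) \<le> 24 * real k * K\<^sup>2 * s\<^sup>2 / \<epsilon>\<^sup>2"
    using k K \<epsilon> by (simp add: gain_def field_simps)
  then show False
    using T by simp
qed

theorem nuclear_ball_cover:
  assumes "24 * real k * K\<^sup>2 * s\<^sup>2 / \<epsilon>\<^sup>2 \<le> real T"
  obtains C where "finite C" "card C \<le> (2 * m + 1) ^ T"
    "\<And>X. nuc_norm n X \<le> s \<Longrightarrow> \<exists>c\<in>C. \<forall>i<m. \<bar>minner n (B i) X - c i\<bar> \<le> \<epsilon>"
proof
  show "finite (guess ` mistake_lists T)"
    by (intro finite_imageI finite_mistake_lists)
  show "card (guess ` mistake_lists T) \<le> (2 * m + 1) ^ T"
    using card_image_le[OF finite_mistake_lists] card_mistake_lists by (rule order_trans)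
  show "\<exists>c\<in>guess ` mistake_lists T. \<forall>i<m. \<bar>minner n (B i) X - c i\<bar> \<le> \<epsilon>" if "nuc_norm n X \<le> s" for X
    using exists_accurate_guess[OF that assms] by blast
qed

end

section \<open>Chaining for squares with random signs\<close>

definition sign_of :: "nat set \<Rightarrow> nat \<Rightarrow> real" where
  "sign_of S i = (if i \<in> S then 1 else - 1)"

abbreviation random_signs :: "nat \<Rightarrow> nat set pmf" where
  "random_signs m \<equiv> pmf_of_set (Pow {..<m})"

lemma expectation_fair_sign:
  assumes "finite I" "i \<in> I"
  shows "measure_pmf.expectation (Pi_pmf I False (\<lambda>_. bernoulli_pmf (1 / 2)))
    (\<lambda>c. (if c i then 1 else - 1) * (a :: real)) = 0"
proof -
  have "measure_pmf.expectation (Pi_pmf I False (\<lambda>_. bernoulli_pmf (1 / 2))) (\<lambda>c. (if c i then 1 else - 1) * a)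
      = measure_pmf.expectation (map_pmf (\<lambda>c. c i) (Pi_pmf I False (\<lambda>_. bernoulli_pmf (1 / 2))))
          (\<lambda>c. (if c then 1 else - 1) * a)"
    by simp
  also have "map_pmf (\<lambda>c. c i) (Pi_pmf I False (\<lambda>_. bernoulli_pmf (1 / 2))) = bernoulli_pmf (1 / 2)"
    using assms by (simp add: Pi_pmf_component)
  finally show ?thesis
    by simp
qed

lemma Hoeffding_random_signs:
  assumes V: "(\<Sum>i<m. (a i)\<^sup>2) \<le> V" "0 < V" and t: "0 \<le> t"
  shows "measure_pmf.prob (random_signs m) {S. t < \<bar>\<Sum>i<m. sign_of S i * a i\<bar>}
    \<le> 2 * exp (- t\<^sup>2 / (2 * V))"
proof (cases "(\<Sum>i<m. (a i)\<^sup>2) = 0")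
  case True
  then have "{S. t < \<bar>\<Sum>i<m. sign_of S i * a i\<bar>} = {}"
    using t by (auto simp: sum_nonneg_eq_0_iff not_less)
  then show ?thesis
    by simp
next
  case False
  then have pos: "0 < (\<Sum>i<m. (a i)\<^sup>2)"
    by (simp add: sum_nonneg less_le)
  define coins where "coins = Pi_pmf {..<m} False (\<lambda>_. bernoulli_pmf (1 / 2))"
  define X where "X i c = (if c i then 1 else - 1) * a i" for i and c :: "nat \<Rightarrow> bool"
  interpret Hoeffding_ineq coins "{..<m}" X "\<lambda>i. - \<bar>a i\<bar>" "\<lambda>i. \<bar>a i\<bar>"
    "\<Sum>i<m. measure_pmf.expectation coins (X i)"
  proof unfold_locales
    show "prob_space.indep_vars coins (\<lambda>_. borel) X {..<m}"
      unfolding X_def[abs_def] coins_def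
      by (intro prob_space.indep_vars_compose2[OF _ indep_vars_Pi_pmf])
        (auto simp: measure_pmf.prob_space_axioms)
  qed (auto simp: X_def)
  have mean: "measure_pmf.expectation coins (X i) = 0" if "i < m" for i
    using that unfolding X_def[abs_def] coins_def by (intro expectation_fair_sign) auto
  have "measure_pmf.prob (random_signs m) {S. t < \<bar>\<Sum>i<m. sign_of S i * a i\<bar>}
      = measure_pmf.prob coins {c. t < \<bar>\<Sum>i<m. X i c\<bar>}"
    by (simp add: pmf_of_set_Pow_conv_bernoulli[of _ False, symmetric] coins_def vimage_def
        sign_of_def X_def cong: sum.cong_simp)
  also have "\<dots> \<le> measure_pmf.prob coins {c. t \<le> \<bar>\<Sum>i<m. X i c\<bar>}"
    by (intro measure_pmf.finite_measure_mono) auto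
  also have "\<dots> \<le> 2 * exp (- 2 * t\<^sup>2 / (\<Sum>i<m. (2 * \<bar>a i\<bar>)\<^sup>2))"
    using Hoeffding_ineq_abs_ge[OF t] pos by (simp add: mean power_mult_distrib flip: sum_distrib_left)
  also have "\<dots> = 2 * exp (- t\<^sup>2 / (2 * (\<Sum>i<m. (a i)\<^sup>2)))"
    by (simp add: power_mult_distrib flip: sum_distrib_left)
  also have "\<dots> \<le> 2 * exp (- t\<^sup>2 / (2 * V))"
    using V pos by (simp add: divide_left_mono)
  finally show ?thesis .
qed

lemma sum_add_power2_le:
  fixes x y :: "'i \<Rightarrow> real"
  assumes "(\<Sum>i\<in>I. (x i)\<^sup>2) \<le> E" "(\<Sum>i\<in>I. (y i)\<^sup>2) \<le> E"
  shows "(\<Sum>i\<in>I. (x i + y i)\<^sup>2) \<le> 4 * E"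
proof -
  have "(x i + y i)\<^sup>2 \<le> 2 * (x i)\<^sup>2 + 2 * (y i)\<^sup>2" for i
    using sum_squares_bound[of "x i" "y i"] by (simp add: power2_sum)
  then have "(\<Sum>i\<in>I. (x i + y i)\<^sup>2) \<le> (\<Sum>i\<in>I. 2 * (x i)\<^sup>2 + 2 * (y i)\<^sup>2)"
    by (rule sum_mono)
  then show ?thesis
    using assms by (simp add: sum.distrib flip: sum_distrib_left)
qed

lemma diff_power2_factor: "x\<^sup>2 - y\<^sup>2 = (x - y) * (x + y)" for x y :: real
  by (simp add: power2_eq_square algebra_simps)

lemma random_signs_diff_squares_tail:
  assumes close: "\<And>i. i < m \<Longrightarrow> \<bar>x i - y i\<bar> \<le> c"
    and energy: "(\<Sum>i<m. (x i)\<^sup>2) \<le> E" "(\<Sum>i<m. (y i)\<^sup>2) \<le> E" and pos: "0 < c" "0 < E" "0 \<le> t"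
  shows "measure_pmf.prob (random_signs m) {S. t < \<bar>\<Sum>i<m. sign_of S i * ((x i)\<^sup>2 - (y i)\<^sup>2)\<bar>}
    \<le> 2 * exp (- t\<^sup>2 / (8 * c\<^sup>2 * E))"
proof -
  have "(\<Sum>i<m. ((x i)\<^sup>2 - (y i)\<^sup>2)\<^sup>2) \<le> (\<Sum>i<m. c\<^sup>2 * (x i + y i)\<^sup>2)"
  proof (rule sum_mono)
    fix i assume "i \<in> {..<m}"
    then have "(x i - y i)\<^sup>2 \<le> c\<^sup>2"
      using close[of i] by (simp flip: abs_le_square_iff)
    then show "((x i)\<^sup>2 - (y i)\<^sup>2)\<^sup>2 \<le> c\<^sup>2 * (x i + y i)\<^sup>2"
      by (simp add: diff_power2_factor power_mult_distrib mult_right_mono)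
  qed
  also have "\<dots> \<le> c\<^sup>2 * (4 * E)"
    unfolding sum_distrib_left[symmetric] by (intro mult_left_mono sum_add_power2_le energy) simp
  finally show ?thesis
    using Hoeffding_random_signs[of "\<lambda>i. (x i)\<^sup>2 - (y i)\<^sup>2" m "c\<^sup>2 * (4 * E)" t] pos by (simp add: mult_ac)
qed

lemma abs_sum_signs_diff_squares_le:
  assumes close: "\<And>i. i < m \<Longrightarrow> \<bar>x i - y i\<bar> \<le> c"
    and energy: "(\<Sum>i<m. (x i)\<^sup>2) \<le> E" "(\<Sum>i<m. (y i)\<^sup>2) \<le> E" and "0 \<le> c"
  shows "\<bar>\<Sum>i<m. sign_of S i * ((x i)\<^sup>2 - (y i)\<^sup>2)\<bar> \<le> 2 * c * sqrt (real m * E)"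
proof -
  have "\<bar>\<Sum>i<m. sign_of S i * ((x i)\<^sup>2 - (y i)\<^sup>2)\<bar> \<le> (\<Sum>i<m. \<bar>sign_of S i * ((x i)\<^sup>2 - (y i)\<^sup>2)\<bar>)"
    by (rule sum_abs)
  also have "\<dots> \<le> (\<Sum>i<m. \<bar>c\<bar> * \<bar>x i + y i\<bar>)"
    using close \<open>0 \<le> c\<close>
    by (intro sum_mono) (simp add: diff_power2_factor abs_mult sign_of_def mult_right_mono)
  also have "\<dots> \<le> L2_set (\<lambda>_. c) {..<m} * L2_set (\<lambda>i. x i + y i) {..<m}"
    by (rule L2_set_mult_ineq)
  also have "\<dots> \<le> (sqrt (real m) * c) * sqrt (4 * E)"
    unfolding L2_set_def using \<open>0 \<le> c\<close>
    by (intro mult_mono real_sqrt_le_mono sum_add_power2_le energy) (auto simp: real_sqrt_mult sum_nonneg)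
  also have "\<dots> = 2 * c * sqrt (real m * E)"
    by (simp add: real_sqrt_mult)
  finally show ?thesis .
qed

lemma prob_UN_le:
  assumes "finite D" "\<And>z. z \<in> D \<Longrightarrow> measure_pmf.prob p (B z) \<le> \<beta>"
  shows "measure_pmf.prob p (\<Union>z\<in>D. B z) \<le> real (card D) * \<beta>"
proof -
  have "measure_pmf.prob p (\<Union>z\<in>D. B z) \<le> (\<Sum>z\<in>D. measure_pmf.prob p (B z))"
    using assms(1) by (intro measure_pmf.finite_measure_subadditive_finite) auto
  also have "\<dots> \<le> real (card D) * \<beta>"
    using assms(2) by (rule sum_bounded_above)
  finally show ?thesis .
qed

lemma cover_by_members:
  fixes V :: "(nat \<Rightarrow> real) set"
  assumes C: "finite C" and cover: "\<And>v. v \<in> V \<Longrightarrow> \<exists>c\<in>C. \<forall>i<m. \<bar>v i - c i\<bar> \<le> \<epsilon>"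
  obtains p where "\<And>v. v \<in> V \<Longrightarrow> p v \<in> V" "\<And>v i. v \<in> V \<Longrightarrow> i < m \<Longrightarrow> \<bar>v i - p v i\<bar> \<le> 2 * \<epsilon>"
    "finite (p ` V)" "card (p ` V) \<le> card C"
proof -
  obtain c where c: "\<And>v. v \<in> V \<Longrightarrow> c v \<in> C" "\<And>v i. v \<in> V \<Longrightarrow> i < m \<Longrightarrow> \<bar>v i - c v i\<bar> \<le> \<epsilon>"
    using cover by metis
  define p where "p v = inv_into V c (c v)" for v
  have p: "p v \<in> V" "c (p v) = c v" if "v \<in> V" for v
    using that by (auto simp: p_def inv_into_into f_inv_into_f)
  have "\<bar>v i - p v i\<bar> \<le> 2 * \<epsilon>" if "v \<in> V" "i < m" for v i
    using c(2)[OF that] c(2)[OF p(1)[OF that(1)] that(2)] p(2)[OF that(1)] by simp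
  moreover have image: "p ` V \<subseteq> inv_into V c ` C"
    using c(1) by (auto simp: p_def)
  then have "finite (p ` V)"
    using C finite_subset by blast
  moreover have "card (p ` V) \<le> card C"
    using card_mono[OF finite_imageI[OF C] image] card_image_le[OF C] by (rule order_trans)
  ultimately show ?thesis
    using that p(1) by blast
qed

lemma two_power_power2: "((2::real) ^ j)\<^sup>2 = 4 ^ j"
  by (simp add: power2_eq_square flip: power_mult_distrib)

locale chain_of_nets =
  fixes m J :: nat and V :: "(nat \<Rightarrow> real) set" and b E A :: real
    and net :: "nat \<Rightarrow> (nat \<Rightarrow> real) \<Rightarrow> nat \<Rightarrow> real"
  assumes b: "0 < b" and E: "0 < E" and A: "1 \<le> A"
    and energy: "\<And>v. v \<in> V \<Longrightarrow> (\<Sum>i<m. (v i)\<^sup>2) \<le> E"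
    and net_0: "\<And>v. net 0 v = (\<lambda>i. 0)"
    and net_close: "\<And>v i j. v \<in> V \<Longrightarrow> i < m \<Longrightarrow> j \<le> J \<Longrightarrow> \<bar>v i - net j v i\<bar> \<le> 2 * b / 2 ^ j"
    and net_energy: "\<And>v j. v \<in> V \<Longrightarrow> j \<le> J \<Longrightarrow> (\<Sum>i<m. (net j v i)\<^sup>2) \<le> E"
    and finite_net: "\<And>j. j \<le> J \<Longrightarrow> finite (net j ` V)"
    and card_net: "\<And>j. j \<le> J \<Longrightarrow> real (card (net j ` V)) \<le> A ^ (4 ^ j)"
begin

definition level_process :: "nat \<Rightarrow> nat set \<Rightarrow> (nat \<Rightarrow> real) \<Rightarrow> real" where
  "level_process j S v = (\<Sum>i<m. sign_of S i * (net j v i)\<^sup>2)"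

lemma card_links:
  assumes "j < J"
  shows "finite ((\<lambda>v. (net (Suc j) v, net j v)) ` V)"
    and "real (card ((\<lambda>v. (net (Suc j) v, net j v)) ` V)) \<le> exp (2 * 4 ^ Suc j * ln A)"
proof -
  let ?D = "(\<lambda>v. (net (Suc j) v, net j v)) ` V" and ?N = "(net (Suc j) ` V) \<times> (net j ` V)"
  have sub: "?D \<subseteq> ?N" and fin: "finite ?N"
    using assms by (auto intro!: finite_net)
  then show "finite ?D"
    by (rule finite_subset)
  have "real (card ?D) \<le> real (card (net (Suc j) ` V)) * real (card (net j ` V))"
    using card_mono[OF fin sub] by (simp add: card_cartesian_product flip: of_nat_mult)
  also have "\<dots> \<le> A ^ (4 ^ Suc j) * A ^ (4 ^ Suc j)"
  proof (intro mult_mono)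
    have "real (card (net j ` V)) \<le> A ^ (4 ^ j)"
      using assms by (intro card_net) simp
    also have "\<dots> \<le> A ^ (4 ^ Suc j)"
      using A by (intro power_increasing power_increasing[of j "Suc j"]) auto
    finally show "real (card (net j ` V)) \<le> A ^ (4 ^ Suc j)" .
  qed (use assms A card_net[of "Suc j"] in auto)
  also have "\<dots> = exp (2 * 4 ^ Suc j * ln A)"
    using A by (simp add: exp_of_nat_mult[of "4 ^ Suc j", simplified] flip: exp_add power_add mult_2)
      (simp add: exp_of_nat_mult[of "2 * (4 * 4 ^ j)", simplified])
  finally show "real (card ?D) \<le> exp (2 * 4 ^ Suc j * ln A)" .
qed

lemma link_tail:
  assumes v: "v \<in> V" and j: "j < J" and L: "0 \<le> L" and t: "t = sqrt (288 * b\<^sup>2 * E * (2 * ln A + L))"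
  shows "measure_pmf.prob (random_signs m)
      {S. t < \<bar>\<Sum>i<m. sign_of S i * ((net (Suc j) v i)\<^sup>2 - (net j v i)\<^sup>2)\<bar>}
    \<le> 2 * exp (- (4 ^ Suc j * (2 * ln A + L)))"
proof -
  have t_nonneg: "0 \<le> t" and t_power2: "t\<^sup>2 = 288 * b\<^sup>2 * E * (2 * ln A + L)"
    using A L E by (simp_all add: t)
  have "\<bar>net (Suc j) v i - net j v i\<bar> \<le> 6 * b / 2 ^ Suc j" if "i < m" for i
  proof -
    have "\<bar>net (Suc j) v i - net j v i\<bar> \<le> 2 * b / 2 ^ j + 2 * b / 2 ^ Suc j"
      using net_close[OF v that, of j] net_close[OF v that, of "Suc j"] j by simp
    then show ?thesis
      by simp
  qed
  then have "measure_pmf.prob (random_signs m)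
      {S. t < \<bar>\<Sum>i<m. sign_of S i * ((net (Suc j) v i)\<^sup>2 - (net j v i)\<^sup>2)\<bar>}
    \<le> 2 * exp (- t\<^sup>2 / (8 * (6 * b / 2 ^ Suc j)\<^sup>2 * E))"
    using j b E by (intro random_signs_diff_squares_tail net_energy v t_nonneg) auto
  also have "((2::real) ^ Suc j)\<^sup>2 = 4 ^ Suc j"
    by (rule two_power_power2)
  then have "- t\<^sup>2 / (8 * (6 * b / 2 ^ Suc j)\<^sup>2 * E) = - (4 ^ Suc j * (2 * ln A + L))"
    unfolding t_power2 power_divide using b E by (simp add: field_simps)
  finally show ?thesis .
qed

lemma level_increment_tail:
  assumes j: "j < J" and L: "0 \<le> L" and t: "t = sqrt (288 * b\<^sup>2 * E * (2 * ln A + L))"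
  shows "measure_pmf.prob (random_signs m)
    {S. \<exists>v\<in>V. t < \<bar>level_process (Suc j) S v - level_process j S v\<bar>} \<le> 2 * exp (- L)"
proof -
  let ?D = "(\<lambda>v. (net (Suc j) v, net j v)) ` V"
  define bad where "bad z = {S. t < \<bar>\<Sum>i<m. sign_of S i * ((fst z i)\<^sup>2 - (snd z i)\<^sup>2)\<bar>}"
    for z :: "(nat \<Rightarrow> real) \<times> (nat \<Rightarrow> real)"
  have bad: "measure_pmf.prob (random_signs m) (bad z) \<le> 2 * exp (- (4 ^ Suc j * (2 * ln A + L)))"
    if "z \<in> ?D" for z
    using that link_tail[OF _ j L t] by (auto simp: bad_def)
  have "{S. \<exists>v\<in>V. t < \<bar>level_process (Suc j) S v - level_process j S v\<bar>} = (\<Union>z\<in>?D. bad z)"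
    by (simp add: bad_def level_process_def right_diff_distrib sum_subtractf) blast
  then have "measure_pmf.prob (random_signs m)
      {S. \<exists>v\<in>V. t < \<bar>level_process (Suc j) S v - level_process j S v\<bar>}
      \<le> real (card ?D) * (2 * exp (- (4 ^ Suc j * (2 * ln A + L))))"
    using prob_UN_le[OF card_links(1)[OF j] bad] by simp
  also have "\<dots> \<le> exp (2 * 4 ^ Suc j * ln A) * (2 * exp (- (4 ^ Suc j * (2 * ln A + L))))"
    using card_links(2)[OF j] by (intro mult_right_mono) auto
  also have "\<dots> = 2 * exp (- (4 ^ Suc j * L))"
    by (simp add: algebra_simps flip: exp_add)
  also have "\<dots> \<le> 2 * exp (- L)"
    using L mult_right_mono[of 1 "4 ^ Suc j" L] one_le_power[of "4 :: real" "Suc j"] by simp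
  finally show ?thesis .
qed

lemma abs_signed_sum_squares_le:
  assumes v: "v \<in> V" and "0 \<le> t"
    and small: "\<And>j. j < J \<Longrightarrow> \<bar>level_process (Suc j) S v - level_process j S v\<bar> \<le> t"
  shows "\<bar>\<Sum>i<m. sign_of S i * (v i)\<^sup>2\<bar> \<le> real J * t + 4 * b / 2 ^ J * sqrt (real m * E)"
proof -
  have "\<bar>level_process J S v - level_process 0 S v\<bar>
      \<le> (\<Sum>j<J. \<bar>level_process (Suc j) S v - level_process j S v\<bar>)"
    unfolding sum_lessThan_telescope[of "\<lambda>j. level_process j S v", symmetric] by (rule sum_abs)
  also have "\<dots> \<le> (\<Sum>j<J. t)"
    by (intro sum_mono small) simp
  finally have "\<bar>level_process J S v\<bar> \<le> real J * t"
    by (simp add: level_process_def net_0)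
  moreover have "\<bar>\<Sum>i<m. sign_of S i * ((v i)\<^sup>2 - (net J v i)\<^sup>2)\<bar> \<le> 2 * (2 * b / 2 ^ J) * sqrt (real m * E)"
    using b v by (intro abs_sum_signs_diff_squares_le net_close energy net_energy) auto
  moreover have "(\<Sum>i<m. sign_of S i * ((v i)\<^sup>2 - (net J v i)\<^sup>2))
      = (\<Sum>i<m. sign_of S i * (v i)\<^sup>2) - level_process J S v"
    by (simp add: level_process_def right_diff_distrib sum_subtractf)
  ultimately show ?thesis
    by simp
qed

lemma chaining:
  assumes L: "0 \<le> L"
  shows "measure_pmf.prob (random_signs m) {S. \<exists>v\<in>V. real J * sqrt (288 * b\<^sup>2 * E * (2 * ln A + L))
      + 4 * b / 2 ^ J * sqrt (real m * E) < \<bar>\<Sum>i<m. sign_of S i * (v i)\<^sup>2\<bar>}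
    \<le> 2 * real J * exp (- L)"
proof -
  define t where "t = sqrt (288 * b\<^sup>2 * E * (2 * ln A + L))"
  define bad where "bad j = {S. \<exists>v\<in>V. t < \<bar>level_process (Suc j) S v - level_process j S v\<bar>}" for j
  have "0 \<le> t"
    using A L E by (simp add: t_def)
  then have "{S. \<exists>v\<in>V. real J * t + 4 * b / 2 ^ J * sqrt (real m * E) < \<bar>\<Sum>i<m. sign_of S i * (v i)\<^sup>2\<bar>}
      \<subseteq> (\<Union>j\<in>{..<J}. bad j)"
    using abs_signed_sum_squares_le by (force simp: bad_def not_less[symmetric])
  then have "measure_pmf.prob (random_signs m) {S. \<exists>v\<in>V. real J * t + 4 * b / 2 ^ J * sqrt (real m * E)
      < \<bar>\<Sum>i<m. sign_of S i * (v i)\<^sup>2\<bar>} \<le> measure_pmf.prob (random_signs m) (\<Union>j\<in>{..<J}. bad j)"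
    by (intro measure_pmf.finite_measure_mono) auto
  also have "\<dots> \<le> real (card {..<J}) * (2 * exp (- L))"
    unfolding bad_def by (intro prob_UN_le level_increment_tail L t_def) auto
  finally show ?thesis
    by (simp add: t_def mult_ac)
qed

end

theorem random_signs_chaining:
  fixes V :: "(nat \<Rightarrow> real) set"
  assumes pos: "0 < b" "0 < E" "1 \<le> A" "0 \<le> L"
    and bounded: "\<And>v i. v \<in> V \<Longrightarrow> i < m \<Longrightarrow> \<bar>v i\<bar> \<le> b"
    and energy: "\<And>v. v \<in> V \<Longrightarrow> (\<Sum>i<m. (v i)\<^sup>2) \<le> E"
    and cover: "\<And>j. 1 \<le> j \<Longrightarrow> j \<le> J \<Longrightarrow> \<exists>C. finite C \<and> real (card C) \<le> A ^ (4 ^ j) \<and>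
        (\<forall>v\<in>V. \<exists>c\<in>C. \<forall>i<m. \<bar>v i - c i\<bar> \<le> b / 2 ^ j)"
  shows "measure_pmf.prob (random_signs m) {S. \<exists>v\<in>V. real J * sqrt (288 * b\<^sup>2 * E * (2 * ln A + L))
      + 4 * b / 2 ^ J * sqrt (real m * E) < \<bar>\<Sum>i<m. sign_of S i * (v i)\<^sup>2\<bar>}
    \<le> 2 * real J * exp (- L)"
proof -
  have "\<exists>p. (\<forall>v\<in>V. p v \<in> V \<and> (\<forall>i<m. \<bar>v i - p v i\<bar> \<le> 2 * (b / 2 ^ j))) \<and> finite (p ` V)
      \<and> real (card (p ` V)) \<le> A ^ (4 ^ j)" if j: "1 \<le> j" "j \<le> J" for j
  proof -
    obtain C where C: "finite C" "real (card C) \<le> A ^ (4 ^ j)"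
      "\<And>v. v \<in> V \<Longrightarrow> \<exists>c\<in>C. \<forall>i<m. \<bar>v i - c i\<bar> \<le> b / 2 ^ j"
      using cover[OF j] by blast
    obtain p where p: "\<And>v. v \<in> V \<Longrightarrow> p v \<in> V" "\<And>v i. v \<in> V \<Longrightarrow> i < m \<Longrightarrow> \<bar>v i - p v i\<bar> \<le> 2 * (b / 2 ^ j)"
      "finite (p ` V)" "card (p ` V) \<le> card C"
      using cover_by_members[OF C(1,3)] by blast
    then show ?thesis
      using C(2) by (intro exI[of _ p]) auto
  qed
  then obtain p where p: "\<And>j. 1 \<le> j \<Longrightarrow> j \<le> J \<Longrightarrow>
      (\<forall>v\<in>V. p j v \<in> V \<and> (\<forall>i<m. \<bar>v i - p j v i\<bar> \<le> 2 * (b / 2 ^ j))) \<and> finite (p j ` V)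
      \<and> real (card (p j ` V)) \<le> A ^ (4 ^ j)"
    by metis
  interpret chain_of_nets m J V b E A "\<lambda>j. if j = 0 then \<lambda>v i. 0 else p j"
  proof
    fix j assume "j \<le> J"
    have zero_net: "(\<lambda>v. \<lambda>i. 0) ` V \<subseteq> {\<lambda>i. 0 :: real}" for V :: "(nat \<Rightarrow> real) set"
      by auto
    show "finite ((if j = 0 then \<lambda>v i. 0 else p j) ` V)"
      using p[of j] \<open>j \<le> J\<close> finite_subset[OF zero_net] by auto
    show "real (card ((if j = 0 then \<lambda>v i. 0 else p j) ` V)) \<le> A ^ (4 ^ j)"
      using p[of j] \<open>j \<le> J\<close> card_mono[OF _ zero_net, of V] pos(3) by (auto intro: order_trans[of _ 1])
    fix v assume "v \<in> V"
    then show "(\<Sum>i<m. ((if j = 0 then \<lambda>v i. 0 else p j) v i)\<^sup>2) \<le> E"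
      using p[of j] \<open>j \<le> J\<close> energy pos(2) by auto
    show "\<bar>v i - (if j = 0 then \<lambda>v i. 0 else p j) v i\<bar> \<le> 2 * b / 2 ^ j" if "i < m" for i
      using p[of j] \<open>j \<le> J\<close> \<open>v \<in> V\<close> that bounded[of v i] pos(1) by auto
  qed (use pos energy in auto)
  show ?thesis
    by (rule chaining[OF pos(4)])
qed

section \<open>Second moments and random swaps on product spaces\<close>

lemma borel_measurable_PiM_sum:
  fixes g :: "'a \<Rightarrow> real"
  assumes "g \<in> borel_measurable M"
  shows "(\<lambda>x. \<Sum>i\<in>I. g (x i)) \<in> borel_measurable (PiM I (\<lambda>_. M))"
  using assms by (intro borel_measurable_sum measurable_compose[OF measurable_component_singleton])

lemma PiM_integral_mult_components:
  fixes h :: "'a \<Rightarrow> real"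
  assumes M: "prob_space M" and I: "finite I" "i \<in> I" "j \<in> I"
    and h: "integrable M h" "integrable M (\<lambda>z. (h z)\<^sup>2)" "(\<integral>z. h z \<partial>M) = 0"
  shows "integrable (PiM I (\<lambda>_. M)) (\<lambda>z. h (z i) * h (z j))"
    and "(\<integral>z. h (z i) * h (z j) \<partial>PiM I (\<lambda>_. M)) = (if i = j then (\<integral>z. (h z)\<^sup>2 \<partial>M) else 0)"
proof -
  interpret M: prob_space M by fact
  interpret pm: product_sigma_finite "\<lambda>_. M" ..
  have "integrable (PiM I (\<lambda>_. M)) (\<lambda>z. h (z i) * h (z j)) \<and>
      (\<integral>z. h (z i) * h (z j) \<partial>PiM I (\<lambda>_. M)) = (if i = j then (\<integral>z. (h z)\<^sup>2 \<partial>M) else 0)"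
  proof (cases "i = j")
    case True
    have component: "distr (PiM I (\<lambda>_. M)) M (\<lambda>z. z i) = M"
      using I by (intro distr_PiM_component M)
    have meas: "(\<lambda>z. z i) \<in> measurable (PiM I (\<lambda>_. M)) M"
      using I by (intro measurable_component_singleton)
    have "integrable (PiM I (\<lambda>_. M)) (\<lambda>z. (h (z i))\<^sup>2)"
      using h(2) integrable_distr[OF meas, of "\<lambda>z. (h z)\<^sup>2"] by (simp add: component)
    moreover have "(\<integral>z. (h (z i))\<^sup>2 \<partial>PiM I (\<lambda>_. M)) = (\<integral>z. (h z)\<^sup>2 \<partial>M)"
      using integral_distr[OF meas, of "\<lambda>z. (h z)\<^sup>2"] h(2) by (simp add: component)
    ultimately show ?thesis
      using True by (simp add: power2_eq_square)
  next
    case False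
    define c where "c k = (if k \<in> {i, j} then h else (\<lambda>_. 1))" for k
    have c: "integrable M (c k)" for k
      using h(1) by (simp add: c_def)
    have "(\<Prod>k\<in>I. c k (z k)) = h (z i) * h (z j)" for z
    proof -
      have "(\<Prod>k\<in>I. c k (z k)) = (\<Prod>k\<in>{i, j}. h (z k))"
        using I by (intro prod.mono_neutral_cong_right) (auto simp: c_def)
      then show ?thesis
        using False by simp
    qed
    moreover have "(\<Prod>k\<in>I. integral\<^sup>L M (c k)) = 0"
      using I h(3) by (intro prod_zero) (auto simp: c_def)
    ultimately show ?thesis
      using pm.product_integrable_prod[OF I(1), of c] pm.product_integral_prod[OF I(1), of c] c False
      by simp
  qed
  then show "integrable (PiM I (\<lambda>_. M)) (\<lambda>z. h (z i) * h (z j))"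
    and "(\<integral>z. h (z i) * h (z j) \<partial>PiM I (\<lambda>_. M)) = (if i = j then (\<integral>z. (h z)\<^sup>2 \<partial>M) else 0)"
    by auto
qed

lemma PiM_integral_sum_power2:
  fixes h :: "'a \<Rightarrow> real"
  assumes "prob_space M" "finite I"
    and h: "integrable M h" "integrable M (\<lambda>z. (h z)\<^sup>2)" "(\<integral>z. h z \<partial>M) = 0"
  shows "integrable (PiM I (\<lambda>_. M)) (\<lambda>z. (\<Sum>i\<in>I. h (z i))\<^sup>2)"
    and "(\<integral>z. (\<Sum>i\<in>I. h (z i))\<^sup>2 \<partial>PiM I (\<lambda>_. M)) = real (card I) * (\<integral>z. (h z)\<^sup>2 \<partial>M)"
proof -
  note components = PiM_integral_mult_components[OF assms(1,2) _ _ h]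
  show "integrable (PiM I (\<lambda>_. M)) (\<lambda>z. (\<Sum>i\<in>I. h (z i))\<^sup>2)"
    unfolding power2_eq_square sum_product
    by (intro Bochner_Integration.integrable_sum components(1))
  have "(\<integral>z. (\<Sum>i\<in>I. h (z i))\<^sup>2 \<partial>PiM I (\<lambda>_. M))
      = (\<Sum>i\<in>I. \<Sum>j\<in>I. \<integral>z. h (z i) * h (z j) \<partial>PiM I (\<lambda>_. M))"
    unfolding power2_eq_square sum_product by (simp add: Bochner_Integration.integral_sum components(1))
  also have "\<dots> = (\<Sum>i\<in>I. (\<integral>z. (h z)\<^sup>2 \<partial>M))"
    using assms(2) by (intro sum.cong refl) (simp add: components(2))
  finally show "(\<integral>z. (\<Sum>i\<in>I. h (z i))\<^sup>2 \<partial>PiM I (\<lambda>_. M)) = real (card I) * (\<integral>z. (h z)\<^sup>2 \<partial>M)"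
    by simp
qed

lemma PiM_Chebyshev_inequality:
  fixes g :: "'a \<Rightarrow> real"
  assumes M: "prob_space M" and I: "finite I" "I \<noteq> {}"
    and g: "integrable M g" "integrable M (\<lambda>z. (g z)\<^sup>2)" and "0 < t"
  shows "measure (PiM I (\<lambda>_. M))
      {z \<in> space (PiM I (\<lambda>_. M)). t \<le> \<bar>(\<Sum>i\<in>I. g (z i)) / real (card I) - (\<integral>z. g z \<partial>M)\<bar>}
    \<le> (\<integral>z. (g z)\<^sup>2 \<partial>M) / (real (card I) * t\<^sup>2)"
proof -
  interpret M: prob_space M by fact
  interpret P: prob_space "PiM I (\<lambda>_. M)" by (intro prob_space_PiM M)
  note [measurable] = borel_measurable_integrable[OF g(1)]
  define n where "n = real (card I)"
  have n: "0 < n"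
    using I by (simp add: n_def card_gt_0_iff)
  define h where "h z = g z - (\<integral>z. g z \<partial>M)" for z
  have h: "integrable M h" "integrable M (\<lambda>z. (h z)\<^sup>2)" "(\<integral>z. h z \<partial>M) = 0"
    using g by (simp_all add: h_def[abs_def] power2_diff M.prob_space)
  have h_le: "(\<integral>z. (h z)\<^sup>2 \<partial>M) \<le> (\<integral>z. (g z)\<^sup>2 \<partial>M)"
    unfolding h_def M.variance_eq[OF g] by simp
  have "t \<le> \<bar>(\<Sum>i\<in>I. g (z i)) / real (card I) - (\<integral>z. g z \<partial>M)\<bar> \<longleftrightarrow> n * t \<le> \<bar>\<Sum>i\<in>I. h (z i)\<bar>" for z
  proof -
    have "(\<Sum>i\<in>I. g (z i)) / real (card I) - (\<integral>z. g z \<partial>M) = (\<Sum>i\<in>I. h (z i)) / n"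
      using n by (simp add: h_def sum_subtractf n_def[symmetric] diff_divide_distrib)
    then show ?thesis
      using n by (simp add: pos_le_divide_eq mult.commute)
  qed
  then have "measure (PiM I (\<lambda>_. M))
      {z \<in> space (PiM I (\<lambda>_. M)). t \<le> \<bar>(\<Sum>i\<in>I. g (z i)) / real (card I) - (\<integral>z. g z \<partial>M)\<bar>}
      = measure (PiM I (\<lambda>_. M)) {z \<in> space (PiM I (\<lambda>_. M)). n * t \<le> \<bar>\<Sum>i\<in>I. h (z i)\<bar>}"
    by simp
  also have "\<dots> \<le> P.expectation (\<lambda>z. (\<Sum>i\<in>I. h (z i))\<^sup>2) / (n * t)\<^sup>2"
    using n \<open>0 < t\<close>
    by (intro P.second_moment_method PiM_integral_sum_power2(1)[OF M I(1) h]) (simp_all add: h_def)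
  also have "\<dots> \<le> n * (\<integral>z. (g z)\<^sup>2 \<partial>M) / (n * t)\<^sup>2"
    unfolding PiM_integral_sum_power2(2)[OF M I(1) h] n_def[symmetric]
    using n h_le by (intro divide_right_mono mult_left_mono) auto
  also have "\<dots> = (\<integral>z. (g z)\<^sup>2 \<partial>M) / (n * t\<^sup>2)"
    using n by (simp add: power2_eq_square)
  finally show ?thesis
    by (simp add: n_def)
qed

lemma measure_le_of_random_preserving_maps:
  fixes T :: "'s \<Rightarrow> 'a \<Rightarrow> 'a"
  assumes P: "prob_space P" and F: "finite F" "F \<noteq> {}" and G: "G \<in> sets P"
    and T: "\<And>S. S \<in> F \<Longrightarrow> T S \<in> measurable P P" "\<And>S. S \<in> F \<Longrightarrow> distr P P (T S) = P"
    and le: "\<And>w. w \<in> space P \<Longrightarrow> measure_pmf.prob (pmf_of_set F) {S. T S w \<in> G} \<le> \<rho>"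
  shows "measure P G \<le> \<rho>"
proof -
  interpret P: prob_space P by fact
  have int: "integrable P (\<lambda>w. indicat_real G (T S w))" if "S \<in> F" for S
    using measurable_compose[OF T(1)[OF that], of "indicat_real G"] G
    by (intro P.integrable_const_bound[of _ 1]) auto
  have "real (card F) * measure P G = (\<Sum>S\<in>F. \<integral>w. indicat_real G (T S w) \<partial>P)"
  proof -
    have "(\<integral>w. indicat_real G (T S w) \<partial>P) = measure P G" if "S \<in> F" for S
      using integral_distr[OF T(1)[OF that], of "indicat_real G"] G T(2)[OF that] by simp
    then show ?thesis
      by simp
  qed
  also have "\<dots> = (\<integral>w. (\<Sum>S\<in>F. indicat_real G (T S w)) \<partial>P)"
    by (intro Bochner_Integration.integral_sum[symmetric] int)
  also have "\<dots> \<le> (\<integral>w. real (card F) * \<rho> \<partial>P)"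
  proof (rule integral_mono)
    fix w assume "w \<in> space P"
    have "(\<Sum>S\<in>F. indicat_real G (T S w)) = real (card (F \<inter> {S. T S w \<in> G}))"
      using F(1) by (simp add: indicator_def sum.If_cases)
    also have "\<dots> = real (card F) * measure_pmf.prob (pmf_of_set F) {S. T S w \<in> G}"
      using F by (simp add: measure_pmf_of_set)
    also have "\<dots> \<le> real (card F) * \<rho>"
      using le[OF \<open>w \<in> space P\<close>] by (intro mult_left_mono) auto
    finally show "(\<Sum>S\<in>F. indicat_real G (T S w)) \<le> real (card F) * \<rho>" .
  qed (auto intro: int)
  finally show ?thesis
    using F by (simp add: P.prob_space card_gt_0_iff)
qed

definition join_samples :: "nat \<Rightarrow> (nat \<Rightarrow> 'a) \<times> (nat \<Rightarrow> 'a) \<Rightarrow> nat \<Rightarrow> 'a" where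
  "join_samples m = (\<lambda>(x, y). \<lambda>i\<in>{..<2 * m}. if i < m then x i else y (i - m))"

lemma join_samples_apply:
  "i < m \<Longrightarrow> join_samples m (x, y) i = x i" "i < m \<Longrightarrow> join_samples m (x, y) (i + m) = y i"
  by (simp_all add: join_samples_def)

lemma measurable_join_samples:
  "join_samples m \<in> measurable (PiM {..<m} (\<lambda>_. M) \<Otimes>\<^sub>M PiM {..<m} (\<lambda>_. M)) (PiM {..<2 * m} (\<lambda>_. M))"
proof -
  have "(\<lambda>z. if i < m then fst z i else snd z (i - m))
      \<in> measurable (PiM {..<m} (\<lambda>_. M) \<Otimes>\<^sub>M PiM {..<m} (\<lambda>_. M)) M" if "i < 2 * m" for i
    using that by (cases "i < m")
      (auto intro: measurable_compose[OF measurable_fst measurable_component_singleton]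
        measurable_compose[OF measurable_snd measurable_component_singleton])
  then show ?thesis
    unfolding join_samples_def case_prod_beta by (intro measurable_restrict) auto
qed

lemma all_less_double_iff: "(\<forall>i<2 * m. P i) \<longleftrightarrow> (\<forall>i<m. P i) \<and> (\<forall>i<m. P (i + m))" for m :: nat
proof (intro iffI allI impI)
  fix i assume P: "(\<forall>i<m. P i) \<and> (\<forall>i<m. P (i + m))" and "i < 2 * m"
  then show "P i"
    using P[THEN conjunct2, rule_format, of "i - m"] by (cases "i < m") auto
qed auto

lemma vimage_join_samples_PiE:
  assumes E: "\<And>i. i < 2 * m \<Longrightarrow> E i \<in> sets M"
  shows "join_samples m -` (Pi\<^sub>E {..<2 * m} E) \<inter> space (PiM {..<m} (\<lambda>_. M) \<Otimes>\<^sub>M PiM {..<m} (\<lambda>_. M))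
    = Pi\<^sub>E {..<m} E \<times> Pi\<^sub>E {..<m} (\<lambda>i. E (i + m))"
proof -
  have "join_samples m (x, y) \<in> Pi\<^sub>E {..<2 * m} E \<longleftrightarrow> (\<forall>i<m. x i \<in> E i) \<and> (\<forall>i<m. y i \<in> E (i + m))" for x y
  proof -
    have "join_samples m (x, y) \<in> Pi\<^sub>E {..<2 * m} E \<longleftrightarrow> (\<forall>i<2 * m. join_samples m (x, y) i \<in> E i)"
      by (auto simp: PiE_iff join_samples_def)
    also have "\<dots> \<longleftrightarrow> (\<forall>i<m. join_samples m (x, y) i \<in> E i) \<and> (\<forall>i<m. join_samples m (x, y) (i + m) \<in> E (i + m))"
      by (rule all_less_double_iff)
    finally show ?thesis
      by (simp add: join_samples_apply)
  qed
  moreover have "z \<in> E i \<Longrightarrow> z \<in> space M" "z \<in> E (i + m) \<Longrightarrow> z \<in> space M" if "i < m" for i z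
    using sets.sets_into_space[OF E, of i] sets.sets_into_space[OF E, of "i + m"] that by auto
  ultimately show ?thesis
    by (auto simp: space_pair_measure space_PiM PiE_iff)
qed

lemma distr_join_samples:
  assumes "prob_space M"
  shows "distr (PiM {..<m} (\<lambda>_. M) \<Otimes>\<^sub>M PiM {..<m} (\<lambda>_. M)) (PiM {..<2 * m} (\<lambda>_. M)) (join_samples m)
    = PiM {..<2 * m} (\<lambda>_. M)"
proof -
  interpret M: prob_space M by fact
  interpret pm: product_sigma_finite "\<lambda>_. M" ..
  interpret A: prob_space "PiM {..<m} (\<lambda>_. M)" by (intro prob_space_PiM assms)
  show ?thesis
  proof (rule pm.PiM_eqI)
    fix E :: "nat \<Rightarrow> 'a set" assume E: "\<And>i. i \<in> {..<2 * m} \<Longrightarrow> E i \<in> sets M"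
    let ?E1 = "Pi\<^sub>E {..<m} E" and ?E2 = "Pi\<^sub>E {..<m} (\<lambda>i. E (i + m))"
    have "join_samples m -` (Pi\<^sub>E {..<2 * m} E) \<inter> space (PiM {..<m} (\<lambda>_. M) \<Otimes>\<^sub>M PiM {..<m} (\<lambda>_. M))
        = ?E1 \<times> ?E2"
      using E by (intro vimage_join_samples_PiE) simp
    moreover have "emeasure (PiM {..<m} (\<lambda>_. M)) ?E1 = (\<Prod>i<m. emeasure M (E i))"
      "emeasure (PiM {..<m} (\<lambda>_. M)) ?E2 = (\<Prod>i<m. emeasure M (E (i + m)))"
      using E by (auto intro!: pm.emeasure_PiM)
    moreover have "?E1 \<in> sets (PiM {..<m} (\<lambda>_. M))" "?E2 \<in> sets (PiM {..<m} (\<lambda>_. M))"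
      "Pi\<^sub>E {..<2 * m} E \<in> sets (PiM {..<2 * m} (\<lambda>_. M))"
      using E by (auto intro!: sets_PiM_I_finite)
    ultimately have "emeasure (distr (PiM {..<m} (\<lambda>_. M) \<Otimes>\<^sub>M PiM {..<m} (\<lambda>_. M)) (PiM {..<2 * m} (\<lambda>_. M))
        (join_samples m)) (Pi\<^sub>E {..<2 * m} E)
        = (\<Prod>i<m. emeasure M (E i)) * (\<Prod>i<m. emeasure M (E (i + m)))"
      by (simp add: emeasure_distr measurable_join_samples A.emeasure_pair_measure_Times)
    also have "\<dots> = (\<Prod>i<2 * m. emeasure M (E i))"
      by (rule prod.lessThan_double[symmetric])
    finally show "emeasure (distr (PiM {..<m} (\<lambda>_. M) \<Otimes>\<^sub>M PiM {..<m} (\<lambda>_. M)) (PiM {..<2 * m} (\<lambda>_. M))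
        (join_samples m)) (Pi\<^sub>E {..<2 * m} E) = (\<Prod>i<2 * m. emeasure M (E i))" .
  qed auto
qed

text \<open>Exchanges the coordinates \<open>i\<close> and \<open>i + m\<close> for every \<open>i < m\<close> outside \<open>S\<close>.\<close>

definition pair_swap :: "nat \<Rightarrow> nat set \<Rightarrow> nat \<Rightarrow> nat" where
  "pair_swap m S i =
    (if i < m then (if i \<in> S then i else i + m) else (if i - m \<in> S then i else i - m))"

lemma pair_swap_less: "i < 2 * m \<Longrightarrow> pair_swap m S i < 2 * m"
  by (auto simp: pair_swap_def)

lemma bij_betw_pair_swap: "bij_betw (pair_swap m S) {..<2 * m} {..<2 * m}"
  by (rule bij_betwI[where g = "pair_swap m S"]) (auto simp: pair_swap_def)

definition swap_sample :: "nat \<Rightarrow> nat set \<Rightarrow> (nat \<Rightarrow> 'a) \<Rightarrow> nat \<Rightarrow> 'a" where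
  "swap_sample m S w = (\<lambda>i\<in>{..<2 * m}. w (pair_swap m S i))"

lemma measurable_swap_sample:
  "swap_sample m S \<in> measurable (PiM {..<2 * m} (\<lambda>_. M)) (PiM {..<2 * m} (\<lambda>_. M))"
  unfolding swap_sample_def[abs_def]
  by (rule measurable_restrict) (auto intro!: measurable_component_singleton pair_swap_less)

lemma distr_swap_sample:
  assumes "prob_space M"
  shows "distr (PiM {..<2 * m} (\<lambda>_. M)) (PiM {..<2 * m} (\<lambda>_. M)) (swap_sample m S) = PiM {..<2 * m} (\<lambda>_. M)"
  unfolding swap_sample_def[abs_def] using bij_betw_pair_swap[of m S] pair_swap_less
  by (intro distr_PiM_reindex[where M = "\<lambda>_. M"]) (auto simp: bij_betw_def assms)

lemma sum_swap_sample: "(\<Sum>i<2 * m. g (swap_sample m S w i)) = (\<Sum>i<2 * m. g (w i))"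
  using sum.reindex_bij_betw[OF bij_betw_pair_swap[of m S], of "\<lambda>i. g (w i)"] by (simp add: swap_sample_def)

lemma sum_diff_swap_sample:
  fixes g :: "'a \<Rightarrow> real"
  shows "(\<Sum>i<m. g (swap_sample m S w i) - g (swap_sample m S w (i + m)))
    = (\<Sum>i<m. sign_of S i * g (w i)) - (\<Sum>i<m. sign_of S i * g (w (i + m)))"
  unfolding sum_subtractf[symmetric]
  by (intro sum.cong refl) (auto simp: swap_sample_def pair_swap_def sign_of_def)

section \<open>Ghost samples\<close>

definition energy_level :: "nat \<Rightarrow> ('q \<Rightarrow> 'a \<Rightarrow> real) \<Rightarrow> (nat \<Rightarrow> 'a) \<Rightarrow> nat \<Rightarrow> bool" where
  "energy_level m f w q \<longleftrightarrow> 1 \<le> q \<and> (\<forall>Y. (\<Sum>i<2 * m. f Y (w i)) \<le> real m * (real q)\<^sup>2)"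

definition ghost_event :: "nat \<Rightarrow> real \<Rightarrow> ('q \<Rightarrow> 'a \<Rightarrow> real) \<Rightarrow> 'a measure \<Rightarrow> (nat \<Rightarrow> 'a) set" where
  "ghost_event m \<theta> f M = {w \<in> space (PiM {..<2 * m} (\<lambda>_. M)). \<exists>q. energy_level m f w q
      \<and> (\<exists>X. \<theta> * real m * real q < \<bar>\<Sum>i<m. f X (w i) - f X (w (i + m))\<bar>)}"

definition signs_tail_le :: "nat \<Rightarrow> real \<Rightarrow> real \<Rightarrow> ('q \<Rightarrow> 'a \<Rightarrow> real) \<Rightarrow> 'a measure \<Rightarrow> bool" where
  "signs_tail_le m \<theta> \<rho> f M \<longleftrightarrow> (\<forall>z (q::nat). (\<forall>i<m. z i \<in> space M) \<longrightarrow> 1 \<le> q \<longrightarrow>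
     (\<forall>Y. (\<Sum>i<m. f Y (z i)) \<le> real m * (real q)\<^sup>2) \<longrightarrow>
     measure_pmf.prob (random_signs m) {S. \<exists>X. \<theta> * real m * real q < \<bar>\<Sum>i<m. sign_of S i * f X (z i)\<bar>} \<le> \<rho>)"

lemma energy_level_swap_sample: "energy_level m f (swap_sample m S w) q \<longleftrightarrow> energy_level m f w q"
  by (simp add: energy_level_def sum_swap_sample[of "f _"])

lemma ghost_event_sets:
  fixes f :: "'q :: countable \<Rightarrow> 'a \<Rightarrow> real"
  assumes [measurable]: "\<And>X. f X \<in> borel_measurable M"
  shows "ghost_event m \<theta> f M \<in> sets (PiM {..<2 * m} (\<lambda>_. M))"
proof -
  have [measurable]: "(\<lambda>w. f X (w i)) \<in> borel_measurable (PiM {..<2 * m} (\<lambda>_. M))" if "i < 2 * m" for X i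
    using that assms by (intro measurable_compose[OF measurable_component_singleton]) auto
  have [measurable]: "(\<lambda>w. \<Sum>i<2 * m. f X (w i)) \<in> borel_measurable (PiM {..<2 * m} (\<lambda>_. M))" for X
    by (rule borel_measurable_PiM_sum) (rule assms)
  have [measurable]: "(\<lambda>w. \<Sum>i<m. f X (w i) - f X (w (i + m))) \<in> borel_measurable (PiM {..<2 * m} (\<lambda>_. M))" for X
    by (intro borel_measurable_sum borel_measurable_diff) auto
  show ?thesis
    unfolding ghost_event_def energy_level_def by measurable
qed

lemma swap_sample_in_ghost_eventE:
  assumes ghost: "swap_sample m S w \<in> ghost_event m \<theta> f M" and "0 \<le> \<theta>"
    and least: "\<And>p. energy_level m f w p \<Longrightarrow> q \<le> p"
  obtains X where "\<theta> / 2 * real m * real q < \<bar>\<Sum>i<m. sign_of S i * f X (w i)\<bar>"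
  | X where "\<theta> / 2 * real m * real q < \<bar>\<Sum>i<m. sign_of S i * f X (w (i + m))\<bar>"
proof -
  obtain p X where p: "energy_level m f w p" and X: "\<theta> * real m * real p
      < \<bar>(\<Sum>i<m. sign_of S i * f X (w i)) - (\<Sum>i<m. sign_of S i * f X (w (i + m)))\<bar>"
    using ghost by (auto simp: ghost_event_def energy_level_swap_sample sum_diff_swap_sample[of "f _"])
  have "\<theta> * real m * real q \<le> \<theta> * real m * real p"
    using \<open>0 \<le> \<theta>\<close> least[OF p] by (intro mult_left_mono) auto
  then have "\<theta> / 2 * real m * real q < \<bar>\<Sum>i<m. sign_of S i * f X (w i)\<bar>
      \<or> \<theta> / 2 * real m * real q < \<bar>\<Sum>i<m. sign_of S i * f X (w (i + m))\<bar>"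
    using X by linarith
  then show ?thesis
    using that by blast
qed

lemma energy_level_halves:
  assumes q: "energy_level m f w q" and nonneg: "\<And>i. i < 2 * m \<Longrightarrow> 0 \<le> f Y (w i)" and "k \<in> {0, m}"
  shows "(\<Sum>i<m. f Y (w (i + k))) \<le> real m * (real q)\<^sup>2"
proof -
  have "0 \<le> (\<Sum>i<m. f Y (w i))" "0 \<le> (\<Sum>i<m. f Y (w (i + m)))"
    by (auto intro!: sum_nonneg nonneg)
  moreover have "(\<Sum>i<2 * m. f Y (w i)) \<le> real m * (real q)\<^sup>2"
    using q by (simp add: energy_level_def)
  ultimately show ?thesis
    using \<open>k \<in> {0, m}\<close> by (auto simp: sum.lessThan_double)
qed

text \<open>It suffices to consider the least admissible \<open>q\<close>: admissibility is invariant under swaps, and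
  the threshold grows with \<open>q\<close>.\<close>

lemma random_signs_ghost_event_le:
  assumes nonneg: "\<And>X z. z \<in> space M \<Longrightarrow> 0 \<le> f X z" and "0 \<le> \<theta>" "0 \<le> \<rho>"
    and signs: "signs_tail_le m (\<theta> / 2) \<rho> f M" and w: "w \<in> space (PiM {..<2 * m} (\<lambda>_. M))"
  shows "measure_pmf.prob (random_signs m) {S. swap_sample m S w \<in> ghost_event m \<theta> f M} \<le> 2 * \<rho>"
proof (cases "\<exists>q. energy_level m f w q")
  case False
  then have "{S. swap_sample m S w \<in> ghost_event m \<theta> f M} = {}"
    by (auto simp: ghost_event_def energy_level_swap_sample)
  then show ?thesis
    using \<open>0 \<le> \<rho>\<close> by simp
next
  case True
  define q where "q = (LEAST q. energy_level m f w q)"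
  have q: "energy_level m f w q"
    using True unfolding q_def by (rule LeastI_ex)
  define bad where "bad k = {S. \<exists>X. \<theta> / 2 * real m * real q < \<bar>\<Sum>i<m. sign_of S i * f X (w (i + k))\<bar>}"
    for k :: nat
  have w_space: "w i \<in> space M" if "i < 2 * m" for i
    using w that by (auto simp: space_PiM)
  have energy: "(\<Sum>i<m. f Y (w (i + k))) \<le> real m * (real q)\<^sup>2" if "k \<in> {0, m}" for Y k
    using q nonneg[OF w_space] that by (rule energy_level_halves)
  have bad_le: "measure_pmf.prob (random_signs m) (bad k) \<le> \<rho>" if "k \<in> {0, m}" for k
    using signs[unfolded signs_tail_le_def, rule_format, of "\<lambda>i. w (i + k)" q] energy[OF that] q w_space that
    by (auto simp: bad_def energy_level_def)
  have "{S. swap_sample m S w \<in> ghost_event m \<theta> f M} \<subseteq> bad 0 \<union> bad m"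
  proof
    fix S assume "S \<in> {S. swap_sample m S w \<in> ghost_event m \<theta> f M}"
    then have ghost: "swap_sample m S w \<in> ghost_event m \<theta> f M"
      by simp
    have least: "q \<le> p" if "energy_level m f w p" for p
      using that by (simp add: q_def Least_le)
    show "S \<in> bad 0 \<union> bad m"
      by (rule swap_sample_in_ghost_eventE[OF ghost \<open>0 \<le> \<theta>\<close> least]) (auto simp: bad_def)
  qed
  then have "measure_pmf.prob (random_signs m) {S. swap_sample m S w \<in> ghost_event m \<theta> f M}
      \<le> measure_pmf.prob (random_signs m) (bad 0 \<union> bad m)"
    by (intro measure_pmf.finite_measure_mono) auto
  also have "\<dots> \<le> measure_pmf.prob (random_signs m) (bad 0) + measure_pmf.prob (random_signs m) (bad m)"
    by (rule measure_Un_le) auto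
  also have "\<dots> \<le> 2 * \<rho>"
    using bad_le[of 0] bad_le[of m] by simp
  finally show ?thesis .
qed

lemma ghost_event_prob_le:
  fixes f :: "'q :: countable \<Rightarrow> 'a \<Rightarrow> real"
  assumes M: "prob_space M" and measurable: "\<And>X. f X \<in> borel_measurable M"
    and nonneg: "\<And>X z. z \<in> space M \<Longrightarrow> 0 \<le> f X z" and "0 \<le> \<theta>" "0 \<le> \<rho>"
    and signs: "signs_tail_le m (\<theta> / 2) \<rho> f M"
  shows "measure (PiM {..<2 * m} (\<lambda>_. M)) (ghost_event m \<theta> f M) \<le> 2 * \<rho>"
proof (rule measure_le_of_random_preserving_maps)
  show "prob_space (PiM {..<2 * m} (\<lambda>_. M))"
    by (intro prob_space_PiM M)
  show "ghost_event m \<theta> f M \<in> sets (PiM {..<2 * m} (\<lambda>_. M))"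
    by (rule ghost_event_sets[OF measurable])
  show "measure_pmf.prob (random_signs m) {S. swap_sample m S w \<in> ghost_event m \<theta> f M} \<le> 2 * \<rho>"
    if "w \<in> space (PiM {..<2 * m} (\<lambda>_. M))" for w
    by (rule random_signs_ghost_event_le[OF nonneg \<open>0 \<le> \<theta>\<close> \<open>0 \<le> \<rho>\<close> signs that])
qed (auto simp: measurable_swap_sample distr_swap_sample[OF M])

lemma measure_pair_ge_of_sections:
  assumes "prob_space A" "prob_space B" and G: "G \<in> sets (A \<Otimes>\<^sub>M B)" and E: "E \<in> sets A"
    and "0 \<le> c" and sections: "\<And>x. x \<in> E \<Longrightarrow> c \<le> measure B (Pair x -` G)"
  shows "c * measure A E \<le> measure (A \<Otimes>\<^sub>M B) G"
proof -
  interpret A: prob_space A by fact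
  interpret B: prob_space B by fact
  interpret AB: pair_prob_space A B ..
  have "ennreal c * emeasure A E = (\<integral>\<^sup>+x. ennreal c * indicator E x \<partial>A)"
    using E by (simp add: nn_integral_cmult_indicator)
  also have "\<dots> \<le> (\<integral>\<^sup>+x. emeasure B (Pair x -` G) \<partial>A)"
    using sections
    by (intro nn_integral_mono) (auto simp: B.emeasure_eq_measure ennreal_leI split: split_indicator)
  also have "\<dots> = emeasure (A \<Otimes>\<^sub>M B) G"
    by (rule B.emeasure_pair_measure_alt[OF G, symmetric])
  finally show ?thesis
    using \<open>0 \<le> c\<close> by (simp add: A.emeasure_eq_measure AB.emeasure_eq_measure flip: ennreal_mult)
qed

text \<open>\<open>X\<close> nearly attains the largest deviation \<open>D\<close>; the two samples then have total second moment at
  most \<open>q\<^sup>2\<close> with \<open>q \<approx> \<surd>(2 + D + u)\<close>, which is too small for \<open>\<alpha> X\<close> and \<open>\<beta> X\<close> to be \<open>\<theta> q\<close>-close.\<close>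

lemma large_deviation_witness:
  fixes \<alpha> :: "'q \<Rightarrow> real"
  assumes bdd: "bdd_above (range (\<lambda>X. \<bar>\<alpha> X - 1\<bar>))" and large: "t < \<bar>\<alpha> X0 - 1\<bar>"
    and \<theta>: "0 \<le> \<theta>" "\<theta> \<le> 1 / 2" and "0 < t" "0 \<le> u" and level: "\<eta> + \<theta> * (3 + u) \<le> t * (1 / 2 - \<theta>)"
  shows "\<exists>X. \<forall>\<beta>. \<bar>\<beta> X - 1\<bar> \<le> \<eta> \<and> (\<forall>Y. \<bar>\<beta> Y - 1\<bar> \<le> u) \<longrightarrow>
    (\<exists>q::nat. 1 \<le> q \<and> (\<forall>Y. \<alpha> Y + \<beta> Y \<le> (real q)\<^sup>2) \<and> \<theta> * real q < \<bar>\<alpha> X - \<beta> X\<bar>)"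
proof -
  define D where "D = (SUP X. \<bar>\<alpha> X - 1\<bar>)"
  have le_D: "\<bar>\<alpha> X - 1\<bar> \<le> D" for X
    unfolding D_def by (rule cSUP_upper[OF UNIV_I bdd])
  then have D: "t < D"
    using large by (rule order.strict_trans2[rotated])
  then obtain X where X: "D / 2 < \<bar>\<alpha> X - 1\<bar>"
    using less_cSUP_iff[OF _ bdd, of "D / 2"] \<open>0 < t\<close> by (auto simp: D_def)
  define q where "q = nat \<lceil>sqrt (2 + D + u)\<rceil>"
  have sqrt_pos: "0 < sqrt (2 + D + u)" and sqrt_le_q: "sqrt (2 + D + u) \<le> real q"
    using D \<open>0 < t\<close> \<open>0 \<le> u\<close> by (simp_all add: q_def real_nat_ceiling_ge)
  have "sqrt (2 + D + u) \<le> 2 + D + u"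
    using D \<open>0 < t\<close> \<open>0 \<le> u\<close> by (intro real_le_lsqrt) (auto simp: power2_eq_square)
  then have q_le: "real q \<le> 3 + D + u"
    using sqrt_pos unfolding q_def by linarith
  show ?thesis
  proof (intro exI[of _ X] allI impI)
    fix \<beta> assume \<beta>: "\<bar>\<beta> X - 1\<bar> \<le> \<eta> \<and> (\<forall>Y. \<bar>\<beta> Y - 1\<bar> \<le> u)"
    have energy: "\<alpha> Y + \<beta> Y \<le> (real q)\<^sup>2" for Y
    proof -
      have "\<alpha> Y + \<beta> Y \<le> (sqrt (2 + D + u))\<^sup>2"
        using le_D[of Y] \<beta>[THEN conjunct2, rule_format, of Y] D \<open>0 < t\<close> \<open>0 \<le> u\<close> by simp
      also have "\<dots> \<le> (real q)\<^sup>2"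
        using sqrt_le_q sqrt_pos by (intro power_mono) auto
      finally show ?thesis .
    qed
    have "t * (1 / 2 - \<theta>) \<le> D * (1 / 2 - \<theta>)"
      using D \<theta>(2) by (intro mult_right_mono) auto
    then have "\<theta> * (3 + D + u) \<le> D / 2 - \<eta>"
      using level by (simp add: algebra_simps)
    moreover have "\<theta> * real q \<le> \<theta> * (3 + D + u)"
      using q_le \<theta>(1) by (rule mult_left_mono)
    ultimately have "\<theta> * real q < \<bar>\<alpha> X - \<beta> X\<bar>"
      using X \<beta> by linarith
    moreover have "1 \<le> q"
      using sqrt_pos sqrt_le_q by (cases q) auto
    ultimately show "\<exists>q::nat. 1 \<le> q \<and> (\<forall>Y. \<alpha> Y + \<beta> Y \<le> (real q)\<^sup>2) \<and> \<theta> * real q < \<bar>\<alpha> X - \<beta> X\<bar>"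
      using energy by blast
  qed
qed

definition empirical_mean :: "nat \<Rightarrow> ('a \<Rightarrow> real) \<Rightarrow> (nat \<Rightarrow> 'a) \<Rightarrow> real" where
  "empirical_mean m g x = (\<Sum>i<m. g (x i)) / real m"

lemma borel_measurable_empirical_mean:
  "g \<in> borel_measurable M \<Longrightarrow> empirical_mean m g \<in> borel_measurable (PiM {..<m} (\<lambda>_. M))"
  unfolding empirical_mean_def[abs_def] by (intro borel_measurable_divide borel_measurable_PiM_sum) auto

definition deviation_event :: "nat \<Rightarrow> real \<Rightarrow> ('q \<Rightarrow> 'a \<Rightarrow> real) \<Rightarrow> 'a measure \<Rightarrow> (nat \<Rightarrow> 'a) set" where
  "deviation_event m t f M = {x \<in> space (PiM {..<m} (\<lambda>_. M)). \<exists>X. t < \<bar>empirical_mean m (f X) x - 1\<bar>}"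

lemma deviation_event_sets:
  fixes f :: "'q :: countable \<Rightarrow> 'a \<Rightarrow> real"
  assumes "\<And>X. f X \<in> borel_measurable M"
  shows "deviation_event m t f M \<in> sets (PiM {..<m} (\<lambda>_. M))"
proof -
  note [measurable] = borel_measurable_empirical_mean[OF assms]
  show ?thesis
    unfolding deviation_event_def by measurable
qed

locale empirical_process = prob_space M for M :: "'a measure" +
  fixes f :: "'q :: countable \<Rightarrow> 'a \<Rightarrow> real" and m :: nat and b \<delta> \<rho> :: real
  assumes m: "1 \<le> m" and f_measurable: "\<And>X. f X \<in> borel_measurable M"
    and f_nonneg: "\<And>X z. z \<in> space M \<Longrightarrow> 0 \<le> f X z" and f_le: "\<And>X z. z \<in> space M \<Longrightarrow> f X z \<le> b"
    and \<delta>: "0 < \<delta>" "\<delta> < 1" and \<rho>: "0 \<le> \<rho>" "\<rho> \<le> 1 / 16"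
    and typical: "\<And>X. measure (PiM {..<m} (\<lambda>_. M))
        {x \<in> space (PiM {..<m} (\<lambda>_. M)). \<delta> / 16 < \<bar>empirical_mean m (f X) x - 1\<bar>} \<le> 1 / 8"
    and signs: "signs_tail_le m (\<delta> / 128) \<rho> f M"
begin

abbreviation sample :: "(nat \<Rightarrow> 'a) measure" where
  "sample \<equiv> PiM {..<m} (\<lambda>_. M)"

abbreviation average :: "'q \<Rightarrow> (nat \<Rightarrow> 'a) \<Rightarrow> real" where
  "average X \<equiv> empirical_mean m (f X)"

abbreviation deviation :: "real \<Rightarrow> (nat \<Rightarrow> 'a) set" where
  "deviation t \<equiv> deviation_event m t f M"

lemma prob_space_sample: "prob_space sample"
  by (intro prob_space_PiM prob_space_axioms)

lemma abs_average_minus_1_le: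
  assumes "x \<in> space sample"
  shows "\<bar>average X x - 1\<bar> \<le> b + 1"
proof -
  have x: "x i \<in> space M" if "i < m" for i
    using assms that by (auto simp: space_PiM)
  then have "0 \<le> (\<Sum>i<m. f X (x i))" "(\<Sum>i<m. f X (x i)) \<le> real m * b"
    using sum_bounded_above[of "{..<m}" "\<lambda>i. f X (x i)" b] by (auto intro!: sum_nonneg f_nonneg f_le)
  then have "0 \<le> average X x" "average X x \<le> b"
    using m by (simp_all add: empirical_mean_def field_simps)
  then show ?thesis
    by simp
qed

lemma join_samples_in_ghost_event:
  assumes x: "x \<in> space sample" and y: "y \<in> space sample" and "1 \<le> q"
    and energy: "\<forall>Y. average Y x + average Y y \<le> (real q)\<^sup>2"
    and gap: "\<delta> / 64 * real q < \<bar>average X x - average X y\<bar>"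
  shows "join_samples m (x, y) \<in> ghost_event m (\<delta> / 64) f M"
proof -
  have "(\<Sum>i<2 * m. f Y (join_samples m (x, y) i)) = real m * (average Y x + average Y y)" for Y
    using m by (simp add: sum.lessThan_double join_samples_apply empirical_mean_def flip: add_divide_distrib)
  then have "(\<Sum>i<2 * m. f Y (join_samples m (x, y) i)) \<le> real m * (real q)\<^sup>2" for Y
    using energy by (simp add: mult_left_mono)
  moreover have "(\<Sum>i<m. f X (join_samples m (x, y) i) - f X (join_samples m (x, y) (i + m)))
      = real m * (average X x - average X y)"
    using m by (simp add: join_samples_apply empirical_mean_def sum_subtractf flip: diff_divide_distrib)
  then have "\<delta> / 64 * real m * real q
      < \<bar>\<Sum>i<m. f X (join_samples m (x, y) i) - f X (join_samples m (x, y) (i + m))\<bar>"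
    using gap m by (simp add: abs_mult mult.left_commute)
  moreover have "join_samples m (x, y) \<in> space (PiM {..<2 * m} (\<lambda>_. M))"
    using x y by (intro measurable_space[OF measurable_join_samples]) (simp add: space_pair_measure)
  ultimately show ?thesis
    using \<open>1 \<le> q\<close> by (auto simp: ghost_event_def energy_level_def)
qed

lemma ghost_section_sets:
  assumes "x \<in> space sample"
  shows "{y \<in> space sample. join_samples m (x, y) \<in> ghost_event m \<theta> f M} \<in> sets sample"
proof -
  have "(\<lambda>y. join_samples m (x, y)) \<in> measurable sample (PiM {..<2 * m} (\<lambda>_. M))"
    using measurable_compose[OF measurable_Pair1'[OF assms] measurable_join_samples] .
  then have "(\<lambda>y. join_samples m (x, y)) -` ghost_event m \<theta> f M \<inter> space sample \<in> sets sample"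
    by (rule measurable_sets) (rule ghost_event_sets[OF f_measurable])
  also have "(\<lambda>y. join_samples m (x, y)) -` ghost_event m \<theta> f M \<inter> space sample
      = {y \<in> space sample. join_samples m (x, y) \<in> ghost_event m \<theta> f M}"
    by auto
  finally show ?thesis .
qed

lemma ghost_section_prob_ge:
  assumes x: "x \<in> deviation t" and u: "measure sample (deviation u) \<le> 1 / 2"
    and "0 < t" "0 \<le> u" and level: "\<delta> / 16 + \<delta> / 64 * (3 + u) \<le> t * (1 / 2 - \<delta> / 64)"
  shows "3 / 8 \<le> measure sample {y \<in> space sample. join_samples m (x, y) \<in> ghost_event m (\<delta> / 64) f M}"
    (is "_ \<le> measure sample ?section")
proof -
  interpret sample: prob_space sample by (rule prob_space_sample)
  obtain X0 where x_space: "x \<in> space sample" and X0: "t < \<bar>average X0 x - 1\<bar>"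
    using x by (auto simp: deviation_event_def)
  have bdd: "bdd_above (range (\<lambda>X. \<bar>average X x - 1\<bar>))"
    using abs_average_minus_1_le[OF x_space] by (intro bdd_aboveI2)
  have \<theta>: "0 \<le> \<delta> / 64" "\<delta> / 64 \<le> 1 / 2"
    using \<delta> by auto
  obtain X where X: "\<And>\<beta>. \<bar>\<beta> X - 1\<bar> \<le> \<delta> / 16 \<Longrightarrow> \<forall>Y. \<bar>\<beta> Y - 1\<bar> \<le> u \<Longrightarrow>
      \<exists>q::nat. 1 \<le> q \<and> (\<forall>Y. average Y x + \<beta> Y \<le> (real q)\<^sup>2) \<and> \<delta> / 64 * real q < \<bar>average X x - \<beta> X\<bar>"
    using large_deviation_witness[OF bdd X0 \<theta> \<open>0 < t\<close> \<open>0 \<le> u\<close> level] by blast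
  note [measurable] = borel_measurable_empirical_mean[OF f_measurable]
  define atypical where "atypical = {y \<in> space sample. \<delta> / 16 < \<bar>average X y - 1\<bar>}"
  have atypical: "atypical \<in> sets sample"
    unfolding atypical_def by measurable
  have "measure sample (atypical \<union> deviation u) \<le> 1 / 8 + 1 / 2"
    using measure_Un_le[OF atypical deviation_event_sets[where t = u and f = f, OF f_measurable]] typical[of X] u
    by (simp add: atypical_def empirical_mean_def)
  then have "3 / 8 \<le> measure sample (space sample - (atypical \<union> deviation u))"
    using atypical by (subst sample.prob_compl) (auto intro: deviation_event_sets f_measurable)
  also have "\<dots> \<le> measure sample ?section"
  proof (rule sample.finite_measure_mono)
    show "space sample - (atypical \<union> deviation u) \<subseteq> ?section"
    proof
      fix y assume y: "y \<in> space sample - (atypical \<union> deviation u)"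
      then have "\<bar>average X y - 1\<bar> \<le> \<delta> / 16" "\<forall>Y. \<bar>average Y y - 1\<bar> \<le> u"
        by (auto simp: atypical_def deviation_event_def not_less)
      then obtain q :: nat where "1 \<le> q" "\<forall>Y. average Y x + average Y y \<le> (real q)\<^sup>2"
        "\<delta> / 64 * real q < \<bar>average X x - average X y\<bar>"
        using X[of "\<lambda>Y. average Y y"] by blast
      then show "y \<in> ?section"
        using x_space y join_samples_in_ghost_event by blast
    qed
  qed (rule ghost_section_sets[OF x_space])
  finally show ?thesis .
qed

text \<open>A sample with large deviation, read off against an independent sample with small deviation,
  forces the pair into the ghost event.\<close>

lemma deviation_event_step:
  assumes "measure sample (deviation u) \<le> 1 / 2" "0 < t" "0 \<le> u"
    "\<delta> / 16 + \<delta> / 64 * (3 + u) \<le> t * (1 / 2 - \<delta> / 64)"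
  shows "measure sample (deviation t) \<le> 6 * \<rho>"
proof -
  let ?P = "PiM {..<2 * m} (\<lambda>_. M)"
  define G where "G = join_samples m -` ghost_event m (\<delta> / 64) f M \<inter> space (sample \<Otimes>\<^sub>M sample)"
  have ghost: "ghost_event m (\<delta> / 64) f M \<in> sets ?P"
    by (rule ghost_event_sets[OF f_measurable])
  have G: "G \<in> sets (sample \<Otimes>\<^sub>M sample)"
    unfolding G_def by (rule measurable_sets[OF measurable_join_samples ghost])
  have "3 / 8 * measure sample (deviation t) \<le> measure (sample \<Otimes>\<^sub>M sample) G"
  proof (rule measure_pair_ge_of_sections[OF prob_space_sample prob_space_sample G])
    fix x assume x: "x \<in> deviation t"
    then have "Pair x -` G = {y \<in> space sample. join_samples m (x, y) \<in> ghost_event m (\<delta> / 64) f M}"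
      by (auto simp: G_def space_pair_measure deviation_event_def)
    then show "3 / 8 \<le> measure sample (Pair x -` G)"
      using ghost_section_prob_ge[OF x assms] by simp
  qed (auto intro: deviation_event_sets f_measurable)
  also have "\<dots> = measure ?P (ghost_event m (\<delta> / 64) f M)"
    using measure_distr[OF measurable_join_samples ghost]
    by (simp add: G_def distr_join_samples[OF prob_space_axioms])
  also have "\<dots> \<le> 2 * \<rho>"
    using \<delta> \<rho> signs by (intro ghost_event_prob_le prob_space_axioms f_measurable f_nonneg) auto
  finally show ?thesis
    using \<rho> by simp
qed

lemma deviation_event_1_prob_le: "measure sample (deviation 1) \<le> 1 / 2"
proof -
  obtain N :: nat where N: "b + 1 < 8 ^ N"
    using real_arch_pow[of 8 "b + 1"] by auto
  have "measure sample (deviation (8 ^ k)) \<le> 1 / 2" if "k \<le> N" for k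
    using that
  proof (induction rule: inc_induct)
    case base
    have "\<bar>average X x - 1\<bar> \<le> 8 ^ N" if "x \<in> space sample" for X x
      using abs_average_minus_1_le[OF that, of X] N by simp
    then have "deviation (8 ^ N) = {}"
      by (auto simp: deviation_event_def not_less)
    then show ?case
      by simp
  next
    case (step k)
    have "7 + 9 * 8 ^ k \<le> (32 * 8 ^ k :: real)"
      using one_le_power[of "8 :: real" k] by linarith
    then have "\<delta> * (7 + 9 * 8 ^ k) \<le> 1 * (32 * 8 ^ k)"
      using \<delta> by (intro mult_mono) auto
    then have "measure sample (deviation (8 ^ k)) \<le> 6 * \<rho>"
      using step.IH by (intro deviation_event_step) (auto simp: field_simps)
    then show ?case
      using \<rho> by simp
  qed
  from this[of 0] show ?thesis
    by simp
qed

lemma deviation_event_prob_le: "measure sample (deviation \<delta>) \<le> 6 * \<rho>"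
proof (rule deviation_event_step[OF deviation_event_1_prob_le])
  have "\<delta> * (\<delta> / 64) \<le> 1 * (\<delta> / 64)"
    using \<delta> by (intro mult_right_mono) auto
  then show "\<delta> / 16 + \<delta> / 64 * (3 + 1) \<le> \<delta> * (1 / 2 - \<delta> / 64)"
    using \<delta> by (simp add: right_diff_distrib)
qed (use \<delta> in auto)

end

theorem empirical_process_deviation:
  fixes f :: "'q :: countable \<Rightarrow> 'a \<Rightarrow> real"
  assumes M: "prob_space M" and m: "1 \<le> m"
    and f_measurable: "\<And>X. f X \<in> borel_measurable M"
    and f_nonneg: "\<And>X z. z \<in> space M \<Longrightarrow> 0 \<le> f X z" and f_le: "\<And>X z. z \<in> space M \<Longrightarrow> f X z \<le> b"
    and mean: "\<And>X. \<bar>(\<integral>z. f X z \<partial>M) - 1\<bar> \<le> \<delta> / 32"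
    and second_moment: "\<And>X. (\<integral>z. (f X z)\<^sup>2 \<partial>M) \<le> real m * (\<delta> / 32)\<^sup>2 / 8"
    and \<delta>: "0 < \<delta>" "\<delta> < 1" and \<rho>: "0 \<le> \<rho>" "\<rho> \<le> 1 / 16"
    and signs: "signs_tail_le m (\<delta> / 128) \<rho> f M"
  shows "measure (PiM {..<m} (\<lambda>_. M)) (deviation_event m \<delta> f M) \<le> 6 * \<rho>"
proof -
  interpret M: prob_space M by fact
  interpret P: prob_space "PiM {..<m} (\<lambda>_. M)" by (intro prob_space_PiM M)
  interpret empirical_process M f m b \<delta> \<rho>
  proof
    fix X
    have f: "integrable M (f X)"
      using f_measurable f_nonneg f_le by (intro M.integrable_const_bound[of _ b] AE_I2) auto
    have f_power2: "integrable M (\<lambda>z. (f X z)\<^sup>2)"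
      using f_measurable f_nonneg f_le
      by (intro M.integrable_const_bound[of _ "b\<^sup>2"] AE_I2) (simp_all add: power_mono)
    note [measurable] = borel_measurable_empirical_mean[OF f_measurable]
    have "\<delta> / 32 \<le> \<bar>a - (\<integral>z. f X z \<partial>M)\<bar>" if "\<delta> / 16 < \<bar>a - 1\<bar>" for a
      using that mean[of X] by linarith
    then have "measure (PiM {..<m} (\<lambda>_. M))
        {x \<in> space (PiM {..<m} (\<lambda>_. M)). \<delta> / 16 < \<bar>empirical_mean m (f X) x - 1\<bar>}
        \<le> measure (PiM {..<m} (\<lambda>_. M))
        {x \<in> space (PiM {..<m} (\<lambda>_. M)). \<delta> / 32 \<le> \<bar>empirical_mean m (f X) x - (\<integral>z. f X z \<partial>M)\<bar>}"
      by (intro P.finite_measure_mono) auto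
    also have "\<dots> \<le> (\<integral>z. (f X z)\<^sup>2 \<partial>M) / (real m * (\<delta> / 32)\<^sup>2)"
      using PiM_Chebyshev_inequality[OF M _ _ f f_power2, of "{..<m}" "\<delta> / 32"] m \<delta> by (simp add: lessThan_empty_iff empirical_mean_def)
    also have "\<dots> \<le> 1 / 8"
      using second_moment[of X] m \<delta> by (simp add: field_simps)
    finally show "measure (PiM {..<m} (\<lambda>_. M))
        {x \<in> space (PiM {..<m} (\<lambda>_. M)). \<delta> / 16 < \<bar>empirical_mean m (f X) x - 1\<bar>} \<le> 1 / 8" .
  qed (use assms in auto)
  show ?thesis
    by (rule deviation_event_prob_le)
qed

section \<open>Deviation of sampled measurements over the nuclear ball\<close>

lemma abs_minner_le_of_nuc_norm_le:
  assumes "op_bounded n c B" "0 \<le> c" "nuc_norm n X \<le> s"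
  shows "\<bar>minner n B X\<bar> \<le> c * s"
  using order_trans[OF abs_minner_le_nuc_norm[OF assms(1)] mult_left_mono[OF assms(3,2)]] .

lemma measurement_cover:
  assumes B: "\<And>i. i < m \<Longrightarrow> op_bounded n K (B i)" and K: "0 < K" and s: "0 < s"
    and n: "1 \<le> n" and k: "1 \<le> k" "ln (real (2 * n)) \<le> real k"
  shows "\<exists>C. finite C \<and> real (card C) \<le> (real (2 * m + 1) ^ (24 * k)) ^ (4 ^ j) \<and>
    (\<forall>X. nuc_norm n X \<le> s \<longrightarrow> (\<exists>c\<in>C. \<forall>i<m. \<bar>minner n (B i) X - c i\<bar> \<le> s * K / 2 ^ j))"
proof -
  interpret matrix_perceptron n k m B K s "s * K / 2 ^ j"
    using assms by unfold_locales auto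
  have "24 * real k * K\<^sup>2 * s\<^sup>2 / (s * K / 2 ^ j)\<^sup>2 \<le> real (24 * k * 4 ^ j)"
    using s K by (simp add: power_divide power_mult_distrib two_power_power2)
  then obtain C where C: "finite C" "card C \<le> (2 * m + 1) ^ (24 * k * 4 ^ j)"
    "\<And>X. nuc_norm n X \<le> s \<Longrightarrow> \<exists>c\<in>C. \<forall>i<m. \<bar>minner n (B i) X - c i\<bar> \<le> s * K / 2 ^ j"
    by (rule nuclear_ball_cover) blast
  have "real (card C) \<le> (real (2 * m + 1) ^ (24 * k)) ^ (4 ^ j)"
    using of_nat_mono[OF C(2), where 'a = real] by (simp add: power_mult)
  then show ?thesis
    using C(1,3) by blast
qed

lemma measurement_signs_chaining:
  assumes B: "\<And>i. i < m \<Longrightarrow> op_bounded n K (B i)" and K: "0 < K" and s: "0 < s" and E: "0 < E"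
    and n: "1 \<le> n" and k: "1 \<le> k" "ln (real (2 * n)) \<le> real k" and L: "0 \<le> L"
  shows "measure_pmf.prob (random_signs m) {S. \<exists>X. nuc_norm n X \<le> s \<and> (\<Sum>i<m. (minner n (B i) X)\<^sup>2) \<le> E
      \<and> real J * sqrt (288 * (s * K)\<^sup>2 * E * (48 * real k * ln (real (2 * m + 1)) + L))
        + 4 * (s * K) / 2 ^ J * sqrt (real m * E) < \<bar>\<Sum>i<m. sign_of S i * (minner n (B i) X)\<^sup>2\<bar>}
    \<le> 2 * real J * exp (- L)"
proof -
  define V where "V = {\<lambda>i. minner n (B i) X | X. nuc_norm n X \<le> s \<and> (\<Sum>i<m. (minner n (B i) X)\<^sup>2) \<le> E}"
  define A where "A = real (2 * m + 1) ^ (24 * k)"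
  have ln_A: "2 * ln A = 48 * real k * ln (real (2 * m + 1))"
    unfolding A_def by (subst ln_realpow) auto
  have "measure_pmf.prob (random_signs m) {S. \<exists>v\<in>V. real J * sqrt (288 * (s * K)\<^sup>2 * E * (2 * ln A + L))
      + 4 * (s * K) / 2 ^ J * sqrt (real m * E) < \<bar>\<Sum>i<m. sign_of S i * (v i)\<^sup>2\<bar>} \<le> 2 * real J * exp (- L)"
  proof (rule random_signs_chaining)
    show "0 < s * K" "0 < E" "0 \<le> L"
      using s K E L by auto
    show "1 \<le> A"
      unfolding A_def by (rule one_le_power) simp
    show "(\<Sum>i<m. (v i)\<^sup>2) \<le> E" if "v \<in> V" for v
      using that by (auto simp: V_def)
    show "\<bar>v i\<bar> \<le> s * K" if v: "v \<in> V" "i < m" for v i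
    proof -
      obtain X where "v = (\<lambda>i. minner n (B i) X)" "nuc_norm n X \<le> s"
        using v by (auto simp: V_def)
      then show ?thesis
        using abs_minner_le_of_nuc_norm_le[OF B[OF v(2)], of X s] K by (simp add: mult.commute)
    qed
    show "\<exists>C. finite C \<and> real (card C) \<le> A ^ (4 ^ j) \<and>
        (\<forall>v\<in>V. \<exists>c\<in>C. \<forall>i<m. \<bar>v i - c i\<bar> \<le> s * K / 2 ^ j)" for j
    proof -
      obtain C where C: "finite C \<and> real (card C) \<le> A ^ (4 ^ j) \<and>
          (\<forall>X. nuc_norm n X \<le> s \<longrightarrow> (\<exists>c\<in>C. \<forall>i<m. \<bar>minner n (B i) X - c i\<bar> \<le> s * K / 2 ^ j))"
        using measurement_cover[where j = j, OF B K s n k] unfolding A_def by (rule exE)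
      have "\<exists>c\<in>C. \<forall>i<m. \<bar>v i - c i\<bar> \<le> s * K / 2 ^ j" if "v \<in> V" for v
        using that C by (auto simp: V_def)
      then show ?thesis
        using C by blast
    qed
  qed
  moreover have "{S. \<exists>v\<in>V. real J * sqrt (288 * (s * K)\<^sup>2 * E * (2 * ln A + L))
      + 4 * (s * K) / 2 ^ J * sqrt (real m * E) < \<bar>\<Sum>i<m. sign_of S i * (v i)\<^sup>2\<bar>}
    = {S. \<exists>X. nuc_norm n X \<le> s \<and> (\<Sum>i<m. (minner n (B i) X)\<^sup>2) \<le> E
      \<and> real J * sqrt (288 * (s * K)\<^sup>2 * E * (48 * real k * ln (real (2 * m + 1)) + L))
        + 4 * (s * K) / 2 ^ J * sqrt (real m * E) < \<bar>\<Sum>i<m. sign_of S i * (minner n (B i) X)\<^sup>2\<bar>}"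
    unfolding V_def ln_A by auto
  ultimately show ?thesis
    by simp
qed

locale sampling_parameters =
  fixes n m k J :: nat and K s \<tau> L :: real
  assumes n: "1 \<le> n" and m: "1 \<le> m" and k: "1 \<le> k" "ln (real (2 * n)) \<le> real k" and J: "1 \<le> J"
    and K: "0 < K" and s: "0 < s" and \<tau>: "0 < \<tau>" and L: "0 \<le> L"
    and resolution: "8 * (s * K) \<le> \<tau> * 2 ^ J"
    and sample_size: "(real J)\<^sup>2 * 288 * (s * K)\<^sup>2 * (48 * real k * ln (real (2 * m + 1)) + L) \<le> \<tau>\<^sup>2 / 4 * real m"
begin

lemma measurement_signs_tail:
  assumes B: "\<And>i. i < m \<Longrightarrow> op_bounded n K (B i)" and q: "1 \<le> (q::nat)"
  shows "measure_pmf.prob (random_signs m) {S. \<exists>X. nuc_norm n X \<le> s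
      \<and> (\<Sum>i<m. (minner n (B i) X)\<^sup>2) \<le> real m * (real q)\<^sup>2
      \<and> \<tau> * real m * real q < \<bar>\<Sum>i<m. sign_of S i * (minner n (B i) X)\<^sup>2\<bar>}
    \<le> 2 * real J * exp (- L)"
proof -
  define E where "E = real m * (real q)\<^sup>2"
  define \<Lambda> where "\<Lambda> = 48 * real k * ln (real (2 * m + 1)) + L"
  have "0 < E"
    using m q by (simp add: E_def)
  have "0 \<le> \<Lambda>"
    using L by (simp add: \<Lambda>_def)
  have "real J * sqrt (288 * (s * K)\<^sup>2 * E * \<Lambda>) \<le> \<tau> / 2 * real m * real q"
  proof (rule power2_le_imp_le)
    have "(real J * sqrt (288 * (s * K)\<^sup>2 * E * \<Lambda>))\<^sup>2 = ((real J)\<^sup>2 * 288 * (s * K)\<^sup>2 * \<Lambda>) * E"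
      using \<open>0 \<le> \<Lambda>\<close> \<open>0 < E\<close> by (simp add: power_mult_distrib mult_ac)
    also have "\<dots> \<le> (\<tau>\<^sup>2 / 4 * real m) * E"
      using sample_size \<open>0 < E\<close> by (intro mult_right_mono) (auto simp: \<Lambda>_def)
    also have "\<dots> = (\<tau> / 2 * real m * real q)\<^sup>2"
      by (simp add: E_def power2_eq_square)
    finally show "(real J * sqrt (288 * (s * K)\<^sup>2 * E * \<Lambda>))\<^sup>2 \<le> (\<tau> / 2 * real m * real q)\<^sup>2" .
  qed (use \<tau> in simp)
  moreover have "4 * (s * K) / 2 ^ J * sqrt (real m * E) \<le> \<tau> / 2 * (real m * real q)"
  proof (rule mult_mono)
    show "4 * (s * K) / 2 ^ J \<le> \<tau> / 2"
      using resolution by (simp add: field_simps)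
    show "sqrt (real m * E) \<le> real m * real q"
      by (simp add: E_def real_sqrt_mult flip: mult.assoc)
  qed (use \<tau> \<open>0 < E\<close> in auto)
  ultimately have threshold: "real J * sqrt (288 * (s * K)\<^sup>2 * E * \<Lambda>) + 4 * (s * K) / 2 ^ J * sqrt (real m * E)
      \<le> \<tau> * real m * real q"
    by simp
  have "measure_pmf.prob (random_signs m) {S. \<exists>X. nuc_norm n X \<le> s \<and> (\<Sum>i<m. (minner n (B i) X)\<^sup>2) \<le> E
      \<and> \<tau> * real m * real q < \<bar>\<Sum>i<m. sign_of S i * (minner n (B i) X)\<^sup>2\<bar>}
    \<le> measure_pmf.prob (random_signs m) {S. \<exists>X. nuc_norm n X \<le> s \<and> (\<Sum>i<m. (minner n (B i) X)\<^sup>2) \<le> E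
      \<and> real J * sqrt (288 * (s * K)\<^sup>2 * E * \<Lambda>) + 4 * (s * K) / 2 ^ J * sqrt (real m * E)
        < \<bar>\<Sum>i<m. sign_of S i * (minner n (B i) X)\<^sup>2\<bar>}"
    using threshold by (intro measure_pmf.finite_measure_mono) (auto intro: order.strict_trans1)
  also have "\<dots> \<le> 2 * real J * exp (- L)"
    unfolding \<Lambda>_def by (rule measurement_signs_chaining[OF B K s \<open>0 < E\<close> n k L])
  finally show ?thesis
    unfolding E_def .
qed

lemma measurement_bound_power2_le: "2 * (s * K)\<^sup>2 \<le> real m * (4 * \<tau>)\<^sup>2 / 8"
proof -
  have "exp 1 \<le> real (2 * m + 1)"
    using exp_le m by linarith
  then have "1 \<le> ln (real (2 * m + 1))"
    by (simp add: ln_ge_iff)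
  then have "1 * 1 \<le> real k * ln (real (2 * m + 1))"
    using k by (intro mult_mono) auto
  then have "1 * 288 * (s * K)\<^sup>2 * 48 \<le> (real J)\<^sup>2 * 288 * (s * K)\<^sup>2 * (48 * real k * ln (real (2 * m + 1)) + L)"
    using J L by (intro mult_mono) auto
  also have "\<dots> \<le> \<tau>\<^sup>2 / 4 * real m"
    by (rule sample_size)
  finally have "55296 * (s * K)\<^sup>2 \<le> real m * \<tau>\<^sup>2"
    by (simp add: mult.commute)
  moreover have "0 \<le> (s * K)\<^sup>2"
    by simp
  ultimately have "(s * K)\<^sup>2 \<le> real m * \<tau>\<^sup>2"
    by linarith
  then show ?thesis
    by (simp add: power_mult_distrib[of 4])
qed

end

locale bounded_measurements = sampling_parameters n m k J K s \<tau> L + prob_space M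
  for n m k J :: nat and K s \<tau> L :: real and M :: "'a measure" +
  fixes \<Phi> :: "'a \<Rightarrow> nat \<Rightarrow> nat \<Rightarrow> real" and X :: "'q :: countable \<Rightarrow> nat \<Rightarrow> nat \<Rightarrow> real"
  assumes \<Phi>: "\<And>z. z \<in> space M \<Longrightarrow> op_bounded n K (\<Phi> z)"
    and minner_measurable: "\<And>q. (\<lambda>z. minner n (\<Phi> z) (X q)) \<in> borel_measurable M"
    and X: "\<And>q. nuc_norm n (X q) \<le> s"
    and mean: "\<And>q. \<bar>(\<integral>z. (minner n (\<Phi> z) (X q))\<^sup>2 \<partial>M) - 1\<bar> \<le> 4 * \<tau>"
    and \<tau>_less: "128 * \<tau> < 1" and small: "2 * real J * exp (- L) \<le> 1 / 16"
begin

definition square :: "'q \<Rightarrow> 'a \<Rightarrow> real" where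
  "square q z = (minner n (\<Phi> z) (X q))\<^sup>2"

lemma square_measurable: "square q \<in> borel_measurable M"
  unfolding square_def[abs_def] by (intro borel_measurable_power minner_measurable)

lemma square_nonneg: "0 \<le> square q z"
  by (simp add: square_def)

lemma square_le:
  assumes "z \<in> space M"
  shows "square q z \<le> (s * K)\<^sup>2"
proof -
  have "\<bar>minner n (\<Phi> z) (X q)\<bar> \<le> K * s"
    using abs_minner_le_of_nuc_norm_le[OF \<Phi>[OF assms] _ X] K by simp
  then show ?thesis
    using power_mono[of "\<bar>minner n (\<Phi> z) (X q)\<bar>" "K * s" 2] by (simp add: square_def mult.commute)
qed

lemma expectation_square_power2_le: "(\<integral>z. (square q z)\<^sup>2 \<partial>M) \<le> real m * (4 * \<tau>)\<^sup>2 / 8"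
proof -
  have integrable: "integrable M (square q)"
    using square_le square_nonneg
    by (intro integrable_const_bound[of _ "(s * K)\<^sup>2"] AE_I2 square_measurable) auto
  have "(\<integral>z. (square q z)\<^sup>2 \<partial>M) \<le> (\<integral>z. (s * K)\<^sup>2 * square q z \<partial>M)"
  proof (rule integral_mono_AE')
    show "AE z in M. (square q z)\<^sup>2 \<le> (s * K)\<^sup>2 * square q z"
      using square_le square_nonneg
      by (intro AE_I2) (simp add: power2_eq_square[of "square q _"] mult_right_mono)
  qed (use integrable square_nonneg in auto)
  also have "\<dots> = (s * K)\<^sup>2 * (\<integral>z. square q z \<partial>M)"
    by simp
  also have "\<dots> \<le> (s * K)\<^sup>2 * 2"
    using mean[of q] \<tau>_less by (intro mult_left_mono) (auto simp: square_def)
  finally show ?thesis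
    using measurement_bound_power2_le by simp
qed

lemma square_signs_tail_le: "signs_tail_le m \<tau> (2 * real J * exp (- L)) square M"
  unfolding signs_tail_le_def
proof (intro allI impI)
  fix z and q :: nat
  assume z: "\<forall>i<m. z i \<in> space M" and q: "1 \<le> q"
    and energy: "\<forall>Y. (\<Sum>i<m. square Y (z i)) \<le> real m * (real q)\<^sup>2"
  have "measure_pmf.prob (random_signs m) {S. \<exists>X. \<tau> * real m * real q < \<bar>\<Sum>i<m. sign_of S i * square X (z i)\<bar>}
    \<le> measure_pmf.prob (random_signs m) {S. \<exists>X. nuc_norm n X \<le> s
      \<and> (\<Sum>i<m. (minner n (\<Phi> (z i)) X)\<^sup>2) \<le> real m * (real q)\<^sup>2
      \<and> \<tau> * real m * real q < \<bar>\<Sum>i<m. sign_of S i * (minner n (\<Phi> (z i)) X)\<^sup>2\<bar>}"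
    using energy X unfolding square_def by (intro measure_pmf.finite_measure_mono) auto
  also have "\<dots> \<le> 2 * real J * exp (- L)"
    using z by (intro measurement_signs_tail \<Phi> q) auto
  finally show "measure_pmf.prob (random_signs m)
      {S. \<exists>X. \<tau> * real m * real q < \<bar>\<Sum>i<m. sign_of S i * square X (z i)\<bar>} \<le> 2 * real J * exp (- L)" .
qed

theorem measurement_deviation:
  "measure (PiM {..<m} (\<lambda>_. M)) (deviation_event m (128 * \<tau>) square M) \<le> 12 * real J * exp (- L)"
proof -
  have "measure (PiM {..<m} (\<lambda>_. M)) (deviation_event m (128 * \<tau>) square M) \<le> 6 * (2 * real J * exp (- L))"
  proof (rule empirical_process_deviation[OF prob_space_axioms m square_measurable square_nonneg square_le])
    show "\<bar>(\<integral>z. square q z \<partial>M) - 1\<bar> \<le> 128 * \<tau> / 32" for q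
      using mean[of q] by (simp add: square_def)
    show "(\<integral>z. (square q z)\<^sup>2 \<partial>M) \<le> real m * (128 * \<tau> / 32)\<^sup>2 / 8" for q
      using expectation_square_power2_le by simp
    show "signs_tail_le m (128 * \<tau> / 128) (2 * real J * exp (- L)) square M"
      using square_signs_tail_le by simp
  qed (use \<tau> \<tau>_less small in auto)
  then show ?thesis
    by simp
qed

end

section \<open>Second moments of random measurement matrices\<close>

lemma measurable_matrix_entry:
  assumes "sets \<mu> = sets (matsp n)" "i < n" "j < n"
  shows "(\<lambda>B. B i j) \<in> borel_measurable \<mu>"
proof -
  have "(\<lambda>B. B i) \<in> measurable (matsp n) (PiM {..<n} (\<lambda>_. borel))"
    unfolding matsp_def using assms by (intro measurable_component_singleton) auto
  moreover have "(\<lambda>x. x j) \<in> measurable (PiM {..<n} (\<lambda>_. borel)) (borel :: real measure)"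
    using assms by (intro measurable_component_singleton) auto
  ultimately have "(\<lambda>B. B i j) \<in> borel_measurable (matsp n)"
    by (rule measurable_compose)
  then show ?thesis
    using measurable_cong_sets[OF assms(1) refl] by blast
qed

lemma borel_measurable_minner:
  assumes "sets \<mu> = sets (matsp n)"
  shows "(\<lambda>B. minner n B X) \<in> borel_measurable \<mu>"
  unfolding minner_def
  by (intro borel_measurable_sum borel_measurable_times measurable_matrix_entry[OF assms]) auto

definition unit_mat :: "nat \<Rightarrow> nat \<Rightarrow> nat \<Rightarrow> nat \<Rightarrow> real" where
  "unit_mat i j = (\<lambda>a b. std_basis i a * std_basis j b)"

lemma minner_unit_mat:
  assumes "i < n" "j < n"
  shows "minner n B (unit_mat i j) = B i j"
proof -
  have "minner n B (unit_mat i j) = (\<Sum>a<n. B a j * std_basis i a)"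
    using assms by (simp add: minner_eq_sum_vinner unit_mat_def vinner_scale_right vinner_std_basis mult.commute)
  also have "\<dots> = B i j"
    using vinner_std_basis[OF assms(1), of "\<lambda>a. B a j"] by (simp add: vinner_def)
  finally show ?thesis .
qed

lemma frob_unit_mat:
  assumes "i < n" "j < n"
  shows "frob n (unit_mat i j) = 1"
proof (rule power2_eq_imp_eq)
  show "(frob n (unit_mat i j))\<^sup>2 = 1\<^sup>2"
    by (simp add: frob_power2 minner_unit_mat[OF assms]) (simp add: unit_mat_def std_basis_def)
qed auto

lemma unit_mat_in_sqmats: "i < n \<Longrightarrow> j < n \<Longrightarrow> unit_mat i j \<in> sqmats n"
  by (auto simp: sqmats_def unit_mat_def std_basis_def)

locale random_matrix = prob_space \<mu> for \<mu> :: "(nat \<Rightarrow> nat \<Rightarrow> real) measure" +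
  fixes n :: nat and K :: real
  assumes sets_eq: "sets \<mu> = sets (matsp n)" and n: "1 \<le> n" and AE_op_bounded: "AE B in \<mu>. op_bounded n K B"
begin

lemma K_nonneg: "0 \<le> K"
proof -
  have "\<exists>B. op_bounded n K B"
    using AE_op_bounded by (rule contrapos_pp) simp
  then show ?thesis
    using op_bounded_nonneg[OF _ n] by blast
qed

lemma AE_abs_minner_mult_le:
  "AE B in \<mu>. \<bar>minner n B Y * minner n B Z\<bar> \<le> K\<^sup>2 * real n * (frob n Y * frob n Z)"
  using AE_op_bounded
proof eventually_elim
  case (elim B)
  have nuc: "nuc_norm n X \<le> sqrt (real n) * frob n X" for X
    by (rule nuc_norm_le_sqrt_rank[OF mrank_le_dim])
  have "\<bar>minner n B Y\<bar> * \<bar>minner n B Z\<bar>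
      \<le> (K * (sqrt (real n) * frob n Y)) * (K * (sqrt (real n) * frob n Z))"
    using K_nonneg by (intro mult_mono abs_minner_le_of_nuc_norm_le[OF elim _ nuc]) auto
  also have "\<dots> = K\<^sup>2 * (sqrt (real n))\<^sup>2 * (frob n Y * frob n Z)"
    by (simp only: power2_eq_square mult_ac)
  finally show ?case
    by (simp add: abs_mult)
qed

lemma integrable_minner_mult: "integrable \<mu> (\<lambda>B. minner n B Y * minner n B Z)"
  using AE_abs_minner_mult_le
  by (intro integrable_const_bound borel_measurable_times borel_measurable_minner sets_eq) simp

lemma minner_EBB_minus_I:
  "minner n (EBB_minus_I n \<mu> Y) Z = (\<integral>B. minner n B Y * minner n B Z \<partial>\<mu>) - minner n Y Z"
proof -
  have entry: "integrable \<mu> (\<lambda>B. minner n B Y * B i j)" if "i < n" "j < n" for i j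
    using integrable_minner_mult[of Y "unit_mat i j"] that by (simp add: minner_unit_mat)
  have "(\<integral>B. minner n B Y * minner n B Z \<partial>\<mu>) = (\<integral>B. (\<Sum>i<n. \<Sum>j<n. minner n B Y * B i j * Z i j) \<partial>\<mu>)"
    by (simp add: minner_def[of n _ Z] sum_distrib_left mult.assoc)
  also have "\<dots> = (\<Sum>i<n. \<integral>B. (\<Sum>j<n. minner n B Y * B i j * Z i j) \<partial>\<mu>)"
    using entry by (intro Bochner_Integration.integral_sum Bochner_Integration.integrable_sum integrable_mult_left) auto
  also have "\<dots> = (\<Sum>i<n. \<Sum>j<n. \<integral>B. minner n B Y * B i j * Z i j \<partial>\<mu>)"
    using entry by (intro sum.cong refl Bochner_Integration.integral_sum integrable_mult_left) auto
  finally show ?thesis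
    by (simp add: minner_def[of n _ Z] EBB_minus_I_def left_diff_distrib sum_subtractf)
qed

lemma abs_minner_EBB_minus_I_le:
  "\<bar>minner n (EBB_minus_I n \<mu> Y) Z\<bar> \<le> (K\<^sup>2 * real n + 1) * frob n Y * frob n Z"
proof -
  have "\<bar>\<integral>B. minner n B Y * minner n B Z \<partial>\<mu>\<bar> \<le> (\<integral>B. \<bar>minner n B Y * minner n B Z\<bar> \<partial>\<mu>)"
    by (rule integral_abs_bound)
  also have "\<dots> \<le> K\<^sup>2 * real n * (frob n Y * frob n Z)"
    by (intro integral_le_const integrable_abs integrable_minner_mult AE_abs_minner_mult_le)
  finally show ?thesis
    using abs_minner_le[of n Y Z] by (simp add: minner_EBB_minus_I distrib_right mult.assoc)
qed

lemma frob_EBB_minus_I_le: "frob n (EBB_minus_I n \<mu> Y) \<le> (K\<^sup>2 * real n + 1) * frob n Y"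
proof (cases "frob n (EBB_minus_I n \<mu> Y) = 0")
  case False
  have "frob n (EBB_minus_I n \<mu> Y) * frob n (EBB_minus_I n \<mu> Y)
      \<le> (K\<^sup>2 * real n + 1) * frob n Y * frob n (EBB_minus_I n \<mu> Y)"
    using abs_minner_EBB_minus_I_le[of Y "EBB_minus_I n \<mu> Y"]
    by (simp add: frob_power2[symmetric] power2_eq_square)
  moreover have "0 < frob n (EBB_minus_I n \<mu> Y)"
    using False by (simp add: less_le)
  ultimately show ?thesis
    by simp
qed simp

lemma frob_EBB_minus_I_le_op_norm_F:
  assumes "X \<in> sqmats n" "frob n X \<le> 1"
  shows "frob n (EBB_minus_I n \<mu> X) \<le> op_norm_F n (EBB_minus_I n \<mu>)"
  unfolding op_norm_F_def
proof (rule cSup_upper)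
  show "bdd_above {frob n (EBB_minus_I n \<mu> Y) | Y. Y \<in> sqmats n \<and> frob n Y \<le> 1}"
  proof (rule bdd_aboveI)
    fix w assume "w \<in> {frob n (EBB_minus_I n \<mu> Y) | Y. Y \<in> sqmats n \<and> frob n Y \<le> 1}"
    then obtain Y where w: "w = frob n (EBB_minus_I n \<mu> Y)" and Y: "frob n Y \<le> 1"
      by auto
    have "(K\<^sup>2 * real n + 1) * frob n Y \<le> (K\<^sup>2 * real n + 1) * 1"
      using Y by (intro mult_left_mono) auto
    then show "w \<le> K\<^sup>2 * real n + 1"
      using frob_EBB_minus_I_le[of Y] w by simp
  qed
qed (use assms in auto)

lemma second_moment_deviation:
  assumes "X \<in> sqmats n" "frob n X = 1"
  shows "\<bar>(\<integral>B. (minner n B X)\<^sup>2 \<partial>\<mu>) - 1\<bar> \<le> op_norm_F n (EBB_minus_I n \<mu>)"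
proof -
  have "(\<integral>B. (minner n B X)\<^sup>2 \<partial>\<mu>) - 1 = minner n (EBB_minus_I n \<mu> X) X"
    using frob_power2[of n X] assms by (simp add: minner_EBB_minus_I power2_eq_square)
  then show ?thesis
    using abs_minner_le[of n "EBB_minus_I n \<mu> X" X] frob_EBB_minus_I_le_op_norm_F[of X] assms by simp
qed

lemma K_pos:
  assumes "op_norm_F n (EBB_minus_I n \<mu>) < 1"
  shows "0 < K"
proof (rule ccontr)
  assume "\<not> 0 < K"
  then have "K = 0"
    using K_nonneg by simp
  have "AE B in \<mu>. (minner n B (unit_mat 0 0))\<^sup>2 = 0"
    using AE_op_bounded
  proof eventually_elim
    case (elim B)
    then show ?case
      using abs_minner_le_nuc_norm[OF elim, of "unit_mat 0 0"] \<open>K = 0\<close> by simp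
  qed
  then have "(\<integral>B. (minner n B (unit_mat 0 0))\<^sup>2 \<partial>\<mu>) = 0"
    by (rule integral_eq_zero_AE)
  then show False
    using second_moment_deviation[of "unit_mat 0 0"] n assms by (simp add: unit_mat_in_sqmats frob_unit_mat)
qed

lemma op_bounded_modification:
  obtains \<Phi> where "\<And>B. B \<in> space \<mu> \<Longrightarrow> op_bounded n K (\<Phi> B)"
    "\<And>X. (\<lambda>B. minner n (\<Phi> B) X) \<in> borel_measurable \<mu>" "AE B in \<mu>. \<Phi> B = B"
proof -
  obtain N where N: "{B \<in> space \<mu>. \<not> op_bounded n K B} \<subseteq> N" "emeasure \<mu> N = 0" "N \<in> sets \<mu>"
    using AE_op_bounded by (rule AE_E)
  have N_null: "N \<in> null_sets \<mu>"
    using N by (simp add: null_sets_def)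
  define \<Phi> where "\<Phi> B = (if B \<in> N then \<lambda>i j. 0 else B)" for B
  show ?thesis
  proof (rule that)
    show "op_bounded n K (\<Phi> B)" if "B \<in> space \<mu>" for B
      using that N(1) K_nonneg by (auto simp: \<Phi>_def op_bounded_def vinner_def mvmult_def)
    show "AE B in \<mu>. \<Phi> B = B"
      using AE_not_in[OF N_null] by eventually_elim (simp add: \<Phi>_def)
    fix X
    note [measurable] = borel_measurable_minner[OF sets_eq, of X] N(3)
    have "minner n (\<Phi> B) X = (if B \<in> N then 0 else minner n B X)" for B
      by (simp add: \<Phi>_def minner_def)
    then show "(\<lambda>B. minner n (\<Phi> B) X) \<in> borel_measurable \<mu>"
      by simp
  qed
qed

end

section \<open>The restricted isometry property over the nuclear cone\<close>

definition nuclear_rip :: "nat \<Rightarrow> nat \<Rightarrow> real \<Rightarrow> real \<Rightarrow> (nat \<Rightarrow> nat \<Rightarrow> nat \<Rightarrow> real) \<Rightarrow> bool" where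
  "nuclear_rip n m s \<delta> Bs \<longleftrightarrow> (\<forall>X\<in>sqmats n. nuc_norm n X \<le> s * frob n X \<longrightarrow>
     \<bar>(vnorm m (meas n Bs X))\<^sup>2 / real m - (frob n X)\<^sup>2\<bar> \<le> \<delta> * (frob n X)\<^sup>2)"

definition rank_rip :: "nat \<Rightarrow> nat \<Rightarrow> nat \<Rightarrow> real \<Rightarrow> (nat \<Rightarrow> nat \<Rightarrow> nat \<Rightarrow> real) \<Rightarrow> bool" where
  "rank_rip n m r \<delta> Bs \<longleftrightarrow> (\<forall>X\<in>sqmats n. mrank n X \<le> r \<longrightarrow>
     \<bar>(vnorm m (meas n Bs X))\<^sup>2 / real m - (frob n X)\<^sup>2\<bar> \<le> \<delta> * (frob n X)\<^sup>2)"

definition stable_recovery :: "nat \<Rightarrow> nat \<Rightarrow> nat \<Rightarrow> real \<Rightarrow> (nat \<Rightarrow> nat \<Rightarrow> nat \<Rightarrow> real) \<Rightarrow> bool" where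
  "stable_recovery n m r C Bs \<longleftrightarrow> (\<forall>\<K> \<subseteq> sqmats n. \<forall>\<epsilon> :: real. \<forall>\<Sigma> y \<Sigma>h.
     mconvex \<K> \<longrightarrow> \<epsilon> \<ge> 0 \<longrightarrow> \<Sigma> \<in> \<K> \<longrightarrow> mrank n \<Sigma> \<le> r \<longrightarrow>
     vnorm m (\<lambda>l. y l - meas n Bs \<Sigma> l) \<le> \<epsilon> \<longrightarrow>
     \<Sigma>h \<in> \<K> \<longrightarrow> vnorm m (\<lambda>l. y l - meas n Bs \<Sigma>h l) \<le> \<epsilon> \<longrightarrow>
     (\<forall>M\<in>\<K>. vnorm m (\<lambda>l. y l - meas n Bs M l) \<le> \<epsilon> \<longrightarrow> nuc_norm n \<Sigma>h \<le> nuc_norm n M) \<longrightarrow>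
     frob n (\<lambda>i j. \<Sigma>h i j - \<Sigma> i j) \<le> C * \<epsilon> / sqrt (real m))"

lemma nuclear_rip_imp_rank_rip:
  assumes "nuclear_rip n m (3 * sqrt (real r)) \<delta> Bs"
  shows "rank_rip n m r \<delta> Bs"
proof -
  have "nuc_norm n X \<le> 3 * sqrt (real r) * frob n X" if "mrank n X \<le> r" for X
    by (rule order_trans[OF nuc_norm_le_sqrt_rank[OF that]]) (simp add: mult_right_mono)
  then show ?thesis
    using assms by (simp add: nuclear_rip_def rank_rip_def)
qed

lemma nuclear_rip_frob_le:
  assumes rip: "nuclear_rip n m s \<delta> Bs" and \<delta>: "\<delta> < 1" and m: "0 < m"
    and X: "X \<in> sqmats n" "nuc_norm n X \<le> s * frob n X" and le: "vnorm m (meas n Bs X) \<le> \<eta>"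
  shows "frob n X \<le> 1 / sqrt (1 - \<delta>) * \<eta> / sqrt (real m)"
proof (rule power2_le_imp_le)
  have "\<bar>(vnorm m (meas n Bs X))\<^sup>2 / real m - (frob n X)\<^sup>2\<bar> \<le> \<delta> * (frob n X)\<^sup>2"
    using rip X by (simp add: nuclear_rip_def)
  then have "(1 - \<delta>) * (frob n X)\<^sup>2 \<le> (vnorm m (meas n Bs X))\<^sup>2 / real m"
    by (simp add: left_diff_distrib)
  also have "\<dots> \<le> \<eta>\<^sup>2 / real m"
    using le by (intro divide_right_mono power_mono) auto
  finally have "(frob n X)\<^sup>2 \<le> \<eta>\<^sup>2 / real m / (1 - \<delta>)"
    using \<delta> by (subst pos_le_divide_eq) (simp_all add: mult.commute)
  also have "\<dots> = (1 / sqrt (1 - \<delta>) * \<eta> / sqrt (real m))\<^sup>2"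
    using \<delta> m by (simp add: power_divide power_mult_distrib)
  finally show "(frob n X)\<^sup>2 \<le> (1 / sqrt (1 - \<delta>) * \<eta> / sqrt (real m))\<^sup>2" .
  show "0 \<le> 1 / sqrt (1 - \<delta>) * \<eta> / sqrt (real m)"
    using order_trans[OF vnorm_nonneg le] \<delta> by simp
qed

lemma nuclear_rip_frob_error_le:
  assumes rip: "nuclear_rip n m (3 * sqrt (real r)) \<delta> Bs" and \<delta>: "\<delta> < 1" and m: "0 < m"
    and X: "X \<in> sqmats n" "mrank n X \<le> r" and Z: "Z \<in> sqmats n"
    and yX: "vnorm m (\<lambda>l. y l - meas n Bs X l) \<le> \<epsilon>" and yZ: "vnorm m (\<lambda>l. y l - meas n Bs Z l) \<le> \<epsilon>"
    and le: "nuc_norm n Z \<le> nuc_norm n X"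
  shows "frob n (\<lambda>i j. Z i j - X i j) \<le> 2 / sqrt (1 - \<delta>) * \<epsilon> / sqrt (real m)"
proof -
  define H where "H = (\<lambda>i j. Z i j - X i j)"
  have "nuc_norm n H \<le> 3 * sqrt (real r) * frob n H"
    using X(2) le by (intro nuc_norm_descent_direction[of n X]) (simp_all add: H_def)
  moreover have "H \<in> sqmats n"
    using X Z by (simp add: sqmats_def H_def)
  moreover have "meas n Bs H = (\<lambda>l. (y l - meas n Bs X l) - (y l - meas n Bs Z l))"
    by (simp add: meas_def H_def minner_diff_right)
  then have "vnorm m (meas n Bs H) \<le> 2 * \<epsilon>"
    using vnorm_diff_le[of m "\<lambda>l. y l - meas n Bs X l" "\<lambda>l. y l - meas n Bs Z l"] yX yZ by simp
  ultimately have "frob n H \<le> 1 / sqrt (1 - \<delta>) * (2 * \<epsilon>) / sqrt (real m)"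
    by (intro nuclear_rip_frob_le[OF rip \<delta> m])
  then show ?thesis
    by (simp add: H_def)
qed

theorem nuclear_rip_imp_stable_recovery:
  assumes "nuclear_rip n m (3 * sqrt (real r)) \<delta> Bs" "\<delta> < 1" "0 < m"
  shows "stable_recovery n m r (2 / sqrt (1 - \<delta>)) Bs"
  unfolding stable_recovery_def
proof (intro allI impI)
  fix \<K> \<epsilon> \<Sigma> y \<Sigma>h
  assume "\<K> \<subseteq> sqmats n" "\<Sigma> \<in> \<K>" "mrank n \<Sigma> \<le> r" "\<Sigma>h \<in> \<K>"
    "vnorm m (\<lambda>l. y l - meas n Bs \<Sigma> l) \<le> \<epsilon>" "vnorm m (\<lambda>l. y l - meas n Bs \<Sigma>h l) \<le> \<epsilon>"
    "\<forall>M\<in>\<K>. vnorm m (\<lambda>l. y l - meas n Bs M l) \<le> \<epsilon> \<longrightarrow> nuc_norm n \<Sigma>h \<le> nuc_norm n M"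
  then show "frob n (\<lambda>i j. \<Sigma>h i j - \<Sigma> i j) \<le> 2 / sqrt (1 - \<delta>) * \<epsilon> / sqrt (real m)"
    by (intro nuclear_rip_frob_error_le[OF assms, where y = y]) auto
qed

lemma meas_near_isometry_of_frob_eq_0:
  assumes "frob n X = 0"
  shows "\<bar>(vnorm m (meas n Bs X))\<^sup>2 / real m - (frob n X)\<^sup>2\<bar> \<le> \<delta> * (frob n X)\<^sup>2"
proof -
  have "minner n (Bs l) X = 0" for l
    using abs_minner_le[of n "Bs l" X] assms by simp
  then show ?thesis
    using assms by (simp add: meas_def vnorm_def)
qed

lemma nuclear_rip_scale_zero: "nuclear_rip n m 0 \<delta> Bs"
  unfolding nuclear_rip_def
proof (intro ballI impI meas_near_isometry_of_frob_eq_0)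
  fix X assume "nuc_norm n X \<le> 0 * frob n X"
  then show "frob n X = 0"
    using frob_le_nuc_norm[of n X] frob_nonneg[of n X] by linarith
qed

lemma vnorm_meas_power2_div: "(vnorm m (meas n Bs X))\<^sup>2 / real m = empirical_mean m (\<lambda>B. (minner n B X)\<^sup>2) Bs"
  by (simp add: vnorm_def meas_def empirical_mean_def sum_nonneg)

lemma nuclear_rip_normalizedI:
  assumes unit: "\<And>X. X \<in> sqmats n \<Longrightarrow> frob n X = 1 \<Longrightarrow> nuc_norm n X \<le> s \<Longrightarrow>
    \<bar>empirical_mean m (\<lambda>B. (minner n B X)\<^sup>2) Bs - 1\<bar> \<le> \<delta>"
  shows "nuclear_rip n m s \<delta> Bs"
  unfolding nuclear_rip_def
proof (intro ballI impI)
  fix X assume X: "X \<in> sqmats n" "nuc_norm n X \<le> s * frob n X"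
  define c where "c = frob n X"
  show "\<bar>(vnorm m (meas n Bs X))\<^sup>2 / real m - (frob n X)\<^sup>2\<bar> \<le> \<delta> * (frob n X)\<^sup>2"
  proof (cases "c = 0")
    case True
    then show ?thesis
      by (intro meas_near_isometry_of_frob_eq_0) (simp add: c_def)
  next
    case False
    then have c: "0 < c"
      by (simp add: c_def less_le)
    have "\<bar>empirical_mean m (\<lambda>B. (minner n B (\<lambda>i j. 1 / c * X i j))\<^sup>2) Bs - 1\<bar> \<le> \<delta>"
    proof (rule unit)
      show "frob n (\<lambda>i j. 1 / c * X i j) = 1"
        unfolding frob_scale using c by (simp add: c_def)
      show "nuc_norm n (\<lambda>i j. 1 / c * X i j) \<le> s"
        using X(2) c by (subst nuc_norm_scale) (auto simp: c_def[symmetric] field_simps)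
      show "(\<lambda>i j. 1 / c * X i j) \<in> sqmats n"
        using X(1) by (simp add: sqmats_def)
    qed
    moreover have "empirical_mean m (\<lambda>B. (minner n B (\<lambda>i j. 1 / c * X i j))\<^sup>2) Bs
        = empirical_mean m (\<lambda>B. (minner n B X)\<^sup>2) Bs / c\<^sup>2"
      unfolding empirical_mean_def minner_scale_right power_mult_distrib sum_distrib_left[symmetric]
      by (simp add: power_divide mult.commute)
    moreover have "empirical_mean m (\<lambda>B. (minner n B X)\<^sup>2) Bs - c\<^sup>2
        = c\<^sup>2 * (empirical_mean m (\<lambda>B. (minner n B X)\<^sup>2) Bs / c\<^sup>2 - 1)"
      using c by (simp add: field_simps)
    ultimately show ?thesis
      unfolding vnorm_meas_power2_div c_def[symmetric]
      using c by (simp add: abs_mult mult.commute[of \<delta>] mult_left_mono)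
  qed
qed

lemma continuous_on_minner: "continuous_on S (minner n B)"
proof -
  have "continuous_on UNIV (\<lambda>X :: nat \<Rightarrow> nat \<Rightarrow> real. X i j)" for i j
    by (rule continuous_on_product_then_coordinatewise[OF continuous_on_product_coordinates])
  then have "continuous_on S (\<lambda>X :: nat \<Rightarrow> nat \<Rightarrow> real. X i j)" for i j
    by (rule continuous_on_subset) simp
  then show ?thesis
    unfolding minner_def[abs_def] by (intro continuous_on_sum continuous_on_mult_left)
qed

lemma nuclear_rip_countable_test_set:
  obtains T where "countable T" "\<And>X. X \<in> T \<Longrightarrow> X \<in> sqmats n \<and> frob n X = 1 \<and> nuc_norm n X \<le> s"
    "\<And>m \<delta> Bs. (\<And>X. X \<in> T \<Longrightarrow> \<bar>empirical_mean m (\<lambda>B. (minner n B X)\<^sup>2) Bs - 1\<bar> \<le> \<delta>) \<Longrightarrow> nuclear_rip n m s \<delta> Bs"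
proof -
  obtain T where T: "countable T" "T \<subseteq> {X \<in> sqmats n. frob n X = 1 \<and> nuc_norm n X \<le> s}"
    "{X \<in> sqmats n. frob n X = 1 \<and> nuc_norm n X \<le> s} \<subseteq> closure T"
    by (rule separable)
  have "nuclear_rip n m s \<delta> Bs"
    if T_le: "\<And>X. X \<in> T \<Longrightarrow> \<bar>empirical_mean m (\<lambda>B. (minner n B X)\<^sup>2) Bs - 1\<bar> \<le> \<delta>" for m \<delta> Bs
  proof (rule nuclear_rip_normalizedI)
    have "closed {X. \<bar>empirical_mean m (\<lambda>B. (minner n B X)\<^sup>2) Bs - 1\<bar> \<le> \<delta>}"
      unfolding empirical_mean_def divide_inverse
      by (intro closed_Collect_le continuous_intros continuous_on_minner)
    then have "closure T \<subseteq> {X. \<bar>empirical_mean m (\<lambda>B. (minner n B X)\<^sup>2) Bs - 1\<bar> \<le> \<delta>}"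
      using T_le by (intro closure_minimal) auto
    then show "\<bar>empirical_mean m (\<lambda>B. (minner n B X)\<^sup>2) Bs - 1\<bar> \<le> \<delta>"
      if "X \<in> sqmats n" "frob n X = 1" "nuc_norm n X \<le> s" for X
      using T(3) that by blast
  qed
  then show ?thesis
    using T(1,2) by (intro that[of T]) auto
qed

lemma (in sampling_parameters) random_measurement_deviation:
  fixes X :: "'q :: countable \<Rightarrow> nat \<Rightarrow> nat \<Rightarrow> real"
  assumes \<mu>: "random_matrix \<mu> n K" and op: "op_norm_F n (EBB_minus_I n \<mu>) \<le> 4 * \<tau>"
    and X: "\<And>q. X q \<in> sqmats n" "\<And>q. frob n (X q) = 1" "\<And>q. nuc_norm n (X q) \<le> s"
    and \<tau>_less: "128 * \<tau> < 1" and small: "2 * real J * exp (- L) \<le> 1 / 16"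
  shows "measure (PiM {..<m} (\<lambda>_. \<mu>)) (deviation_event m (128 * \<tau>) (\<lambda>q B. (minner n B (X q))\<^sup>2) \<mu>)
    \<le> 12 * real J * exp (- L)"
proof -
  interpret random_matrix \<mu> n K by fact
  interpret P: prob_space "PiM {..<m} (\<lambda>_. \<mu>)" by (intro prob_space_PiM prob_space_axioms)
  obtain \<Phi> where modification: "\<And>B. B \<in> space \<mu> \<Longrightarrow> op_bounded n K (\<Phi> B)"
    "\<And>X. (\<lambda>B. minner n (\<Phi> B) X) \<in> borel_measurable \<mu>" "AE B in \<mu>. \<Phi> B = B"
    using op_bounded_modification by blast
  interpret bounded_measurements n m k J K s \<tau> L \<mu> \<Phi> X
  proof
    fix q
    have "(\<integral>B. (minner n (\<Phi> B) (X q))\<^sup>2 \<partial>\<mu>) = (\<integral>B. (minner n B (X q))\<^sup>2 \<partial>\<mu>)"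
      using modification(3) by (intro integral_cong_AE borel_measurable_power modification(2) borel_measurable_minner sets_eq) auto
    then show "\<bar>(\<integral>B. (minner n (\<Phi> B) (X q))\<^sup>2 \<partial>\<mu>) - 1\<bar> \<le> 4 * \<tau>"
      using second_moment_deviation[OF X(1,2), of q] op by simp
  qed (use modification(1,2) X(3) \<tau>_less small in auto)
  have "AE z in PiM {..<m} (\<lambda>_. \<mu>). \<forall>l\<in>{..<m}. \<Phi> (z l) = z l"
    using modification(3) by (intro AE_finite_allI AE_PiM_component prob_space_axioms) auto
  then have "AE z in PiM {..<m} (\<lambda>_. \<mu>). z \<in> deviation_event m (128 * \<tau>) (\<lambda>q B. (minner n B (X q))\<^sup>2) \<mu>
      \<longrightarrow> z \<in> deviation_event m (128 * \<tau>) square \<mu>"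
    by eventually_elim (auto simp: deviation_event_def empirical_mean_def square_def)
  then have "measure (PiM {..<m} (\<lambda>_. \<mu>)) (deviation_event m (128 * \<tau>) (\<lambda>q B. (minner n B (X q))\<^sup>2) \<mu>)
      \<le> measure (PiM {..<m} (\<lambda>_. \<mu>)) (deviation_event m (128 * \<tau>) square \<mu>)"
    by (rule P.finite_measure_mono_AE) (intro deviation_event_sets square_measurable)
  also have "\<dots> \<le> 12 * real J * exp (- L)"
    by (rule measurement_deviation)
  finally show ?thesis .
qed

theorem (in sampling_parameters) nuclear_rip_event:
  assumes \<mu>: "random_matrix \<mu> n K" and op: "op_norm_F n (EBB_minus_I n \<mu>) \<le> 4 * \<tau>"
    and \<tau>_less: "128 * \<tau> < 1" and small: "2 * real J * exp (- L) \<le> 1 / 16"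
  obtains E where "E \<in> sets (PiM {..<m} (\<lambda>_. \<mu>))"
    "1 - 12 * real J * exp (- L) \<le> measure (PiM {..<m} (\<lambda>_. \<mu>)) E"
    "\<And>Bs. Bs \<in> E \<Longrightarrow> nuclear_rip n m s (128 * \<tau>) Bs"
proof -
  interpret random_matrix \<mu> n K by fact
  let ?P = "PiM {..<m} (\<lambda>_. \<mu>)"
  interpret P: prob_space ?P by (intro prob_space_PiM prob_space_axioms)
  obtain T where T: "countable T" "\<And>X. X \<in> T \<Longrightarrow> X \<in> sqmats n \<and> frob n X = 1 \<and> nuc_norm n X \<le> s"
    and test: "\<And>m \<delta> Bs. (\<And>X. X \<in> T \<Longrightarrow> \<bar>empirical_mean m (\<lambda>B. (minner n B X)\<^sup>2) Bs - 1\<bar> \<le> \<delta>)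
      \<Longrightarrow> nuclear_rip n m s \<delta> Bs"
    using nuclear_rip_countable_test_set[of n s] by blast
  show ?thesis
  proof (cases "T = {}")
    case True
    then show ?thesis
      using test P.prob_space by (intro that[of "space ?P"]) auto
  next
    case False
    define X where "X = from_nat_into T"
    have range_X: "range X = T"
      unfolding X_def by (rule range_from_nat_into[OF False T(1)])
    then have X: "X q \<in> sqmats n" "frob n (X q) = 1" "nuc_norm n (X q) \<le> s" for q
      using T(2)[of "X q"] by auto
    define bad where "bad = deviation_event m (128 * \<tau>) (\<lambda>q B. (minner n B (X q))\<^sup>2) \<mu>"
    have bad: "bad \<in> sets ?P" "measure ?P bad \<le> 12 * real J * exp (- L)"
      unfolding bad_def
      using random_measurement_deviation[where X = X, OF \<mu> op X \<tau>_less small]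
      by (auto intro!: deviation_event_sets borel_measurable_power borel_measurable_minner sets_eq)
    have "nuclear_rip n m s (128 * \<tau>) Bs" if "Bs \<in> space ?P - bad" for Bs
      using that by (intro test) (auto simp: bad_def deviation_event_def not_less simp flip: range_X)
    then show ?thesis
      using bad P.prob_compl[OF bad(1)] by (intro that[of "space ?P - bad"]) auto
  qed
qed

section \<open>Choice of parameters\<close>

lemma power_le_sample_size:
  assumes "2 \<le> n" "real n ^ (d + 2) < real (2 * m + 1)"
  shows "real n ^ d \<le> real m"
proof (rule ccontr)
  assume "\<not> ?thesis"
  then have "real (2 * m + 1) \<le> 2 * real n ^ d + 1"
    by simp
  also have "\<dots> \<le> 4 * real n ^ d"
    using one_le_power[of "real n" d] assms(1) by linarith
  also have "\<dots> \<le> (real n)\<^sup>2 * real n ^ d"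
    using assms(1) power_mono[of 2 "real n" 2] by (intro mult_right_mono) auto
  also have "\<dots> = real n ^ (d + 2)"
    by (simp add: power_add power2_eq_square)
  finally show False
    using assms(2) by simp
qed

lemma ln_double_plus_one_le_sqrt:
  assumes "1 \<le> m"
  shows "ln (real (2 * m + 1)) \<le> 4 * sqrt (real m)"
proof -
  have "ln (real (2 * m + 1)) = 2 * ln (sqrt (real (2 * m + 1)))"
    by (simp add: ln_sqrt)
  also have "\<dots> \<le> 2 * sqrt (real (2 * m + 1))"
    using ln_le_minus_one[of "sqrt (real (2 * m + 1))"] by simp
  also have "\<dots> \<le> 2 * sqrt (4 * real m)"
    using assms by simp
  finally show ?thesis
    by (simp add: real_sqrt_mult)
qed

lemma one_le_ln: "3 \<le> x \<Longrightarrow> 1 \<le> ln (x :: real)"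
  using exp_le by (subst ln_ge_iff) auto

text \<open>When \<open>2 m + 1\<close> exceeds \<open>n\<^sup>2\<^sup>0\<close>, its logarithm is not of order \<open>ln n\<close> and is absorbed by
  \<open>\<surd>m\<close> instead.\<close>

lemma ln_sample_size_absorbed:
  assumes n: "3 \<le> n" and m: "1 \<le> m" and C: "0 < C" "4 * C \<le> real n" and a: "0 \<le> a" "a \<le> real n ^ 5"
    and le: "20 * C * a * ln (real n) ^ 7 \<le> real m"
  shows "C * a * ln (real n) ^ 3 * ln (real (2 * m + 1)) \<le> real m"
proof (cases "real (2 * m + 1) \<le> real n ^ 20")
  case True
  then have "ln (real (2 * m + 1)) \<le> ln (real n ^ 20)"
    using n by (subst ln_le_cancel_iff) auto
  also have "\<dots> = 20 * ln (real n)"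
    using n by (simp add: ln_realpow)
  finally have "C * a * ln (real n) ^ 3 * ln (real (2 * m + 1)) \<le> C * a * ln (real n) ^ 3 * (20 * ln (real n))"
    using C a n by (intro mult_left_mono) auto
  also have "\<dots> = 20 * C * a * ln (real n) ^ 4"
    by (simp add: power4_eq_xxxx power3_eq_cube)
  also have "\<dots> \<le> 20 * C * a * ln (real n) ^ 7"
    using C a n one_le_ln[of "real n"] by (intro mult_left_mono power_increasing) auto
  finally show ?thesis
    using le by simp
next
  case False
  have "(real n ^ 9)\<^sup>2 = real n ^ 18"
    by (simp flip: power_mult)
  also have "\<dots> \<le> real m"
    using False n by (intro power_le_sample_size) auto
  finally have sqrt_m: "real n ^ 9 \<le> sqrt (real m)"
    by (rule real_le_rsqrt)
  have "C * a * ln (real n) ^ 3 * ln (real (2 * m + 1)) \<le> C * real n ^ 5 * real n ^ 3 * (4 * sqrt (real m))"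
    using C a n ln_le_minus_one[of "real n"] ln_double_plus_one_le_sqrt[OF m]
    by (intro mult_mono power_mono) auto
  also have "\<dots> = 4 * C * real n ^ 8 * sqrt (real m)"
    by (simp add: power_add[symmetric])
  also have "\<dots> \<le> real n * real n ^ 8 * sqrt (real m)"
    using C by (intro mult_right_mono) auto
  also have "\<dots> = real n ^ 9 * sqrt (real m)"
    by (simp flip: power_Suc)
  also have "\<dots> \<le> sqrt (real m) * sqrt (real m)"
    using sqrt_m by (intro mult_right_mono) auto
  finally show ?thesis
    by simp
qed

lemma log_dimension_ceiling:
  assumes "8 \<le> n"
  obtains k :: nat where "1 \<le> k" "ln (real (2 * n)) \<le> real k" "real k \<le> 2 * ln (real n)"
proof
  have ln_2n: "ln (real (2 * n)) = ln 2 + ln (real n)"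
    using assms by (simp add: ln_mult)
  have "2 \<le> 3 * ln (2 :: real)"
    using ln2_ge_two_thirds by simp
  also have "\<dots> = ln (2 ^ 3)"
    by (subst ln_realpow) simp_all
  also have "\<dots> \<le> ln (real n)"
    using assms by (subst ln_le_cancel_iff) auto
  finally have ln_n: "2 \<le> ln (real n)" .
  show lower: "ln (real (2 * n)) \<le> real (nat \<lceil>ln (real (2 * n))\<rceil>)"
    by (rule real_nat_ceiling_ge)
  have "0 < ln (real (2 * n))"
    using assms by simp
  then show "1 \<le> nat \<lceil>ln (real (2 * n))\<rceil>"
    using lower by linarith
  have "real (nat \<lceil>ln (real (2 * n))\<rceil>) \<le> ln (real (2 * n)) + 1"
    using \<open>0 < ln (real (2 * n))\<close> by linarith
  also have "\<dots> \<le> 2 * ln (real n)"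
    using ln_2n ln_n ln_le_minus_one[of "2 :: real"] by simp
  finally show "real (nat \<lceil>ln (real (2 * n))\<rceil>) \<le> 2 * ln (real n)" .
qed

lemma dyadic_exponent:
  assumes "1 < (x :: real)"
  obtains J :: nat where "1 \<le> J" "x \<le> 2 ^ J" "real J \<le> 3 / 2 * ln x + 1"
proof
  show "x \<le> 2 ^ (nat \<lceil>log 2 x\<rceil>)"
  proof -
    have "x = 2 powr (log 2 x)"
      using assms by simp
    also have "\<dots> \<le> 2 powr (real (nat \<lceil>log 2 x\<rceil>))"
      by (intro powr_mono real_nat_ceiling_ge) auto
    finally show ?thesis
      by (simp add: powr_realpow)
  qed
  have log_pos: "0 < log 2 x"
    using assms by simp
  then show "1 \<le> nat \<lceil>log 2 x\<rceil>"
    by linarith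
  have "real (nat \<lceil>log 2 x\<rceil>) \<le> ln x / ln 2 + 1"
    using log_pos unfolding log_def by linarith
  also have "\<dots> \<le> ln x / (2 / 3) + 1"
    using assms ln2_ge_two_thirds by (intro add_right_mono divide_left_mono) auto
  finally show "real (nat \<lceil>log 2 x\<rceil>) \<le> 3 / 2 * ln x + 1"
    by simp
qed

lemma dyadic_resolution_levels:
  assumes \<tau>: "0 < \<tau>" "\<tau> \<le> 1" and n: "72 / \<tau> \<le> real n"
  obtains J :: nat where "1 \<le> J" "24 * real n ^ 3 / \<tau> \<le> 2 ^ J" "real J \<le> 6 * ln (real n)"
proof -
  define x where "x = 24 * real n ^ 3 / \<tau>"
  have "72 \<le> 72 / \<tau>"
    using \<tau> by (simp add: field_simps)
  then have n72: "72 \<le> real n"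
    using n by simp
  have "24 * 1 / 1 \<le> x"
    unfolding x_def using \<tau> n72 by (intro frac_le mult_mono one_le_power) auto
  then have x: "1 < x"
    by simp
  have "3 * x = (72 / \<tau>) * real n ^ 3"
    by (simp add: x_def)
  also have "\<dots> \<le> real n * real n ^ 3"
    using n by (intro mult_right_mono) auto
  finally have "ln (3 * x) \<le> ln (real n ^ 4)"
    using x n72 by (subst ln_le_cancel_iff) (auto simp: power4_eq_xxxx power3_eq_cube)
  then have ln_x: "ln x + 1 \<le> 4 * ln (real n)"
    using x n72 one_le_ln[of 3] by (simp add: ln_mult_pos ln_realpow)
  obtain J :: nat where "1 \<le> J" "x \<le> 2 ^ J" "real J \<le> 3 / 2 * ln x + 1"
    using x by (rule dyadic_exponent)
  then show ?thesis
    using ln_x by (intro that[of J]) (auto simp: x_def)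
qed

lemma exp_minus_ln_power: "0 < n \<Longrightarrow> exp (- (real d * ln (real n))) = 1 / real n ^ d"
  by (simp add: exp_minus exp_of_nat_mult inverse_eq_divide)

lemma failure_probability_le:
  assumes n: "72 \<le> n" and J: "real J \<le> 6 * ln (real n)"
  shows "12 * real J * exp (- (4 * ln (real n))) \<le> 1 / (real n)\<^sup>2"
    and "2 * real J * exp (- (4 * ln (real n))) \<le> 1 / 16"
proof -
  have "12 * real J \<le> 72 * real n"
    using J ln_le_minus_one[of "real n"] n by simp
  also have "\<dots> \<le> (real n)\<^sup>2"
    using n by (simp add: power2_eq_square)
  finally have "12 * real J / real n ^ 4 \<le> (real n)\<^sup>2 / real n ^ 4"
    by (intro divide_right_mono) auto
  also have "\<dots> = 1 / (real n)\<^sup>2"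
    using n by (simp add: field_simps power2_eq_square power4_eq_xxxx)
  finally show le: "12 * real J * exp (- (4 * ln (real n))) \<le> 1 / (real n)\<^sup>2"
    using exp_minus_ln_power[of n 4] n by simp
  have "1 / (real n)\<^sup>2 \<le> 1 / 4\<^sup>2"
    using n by (intro divide_left_mono power_mono) auto
  then show "2 * real J * exp (- (4 * ln (real n))) \<le> 1 / 16"
    using le by simp
qed

text \<open>The factors come from \<open>J \<le> 6 ln n\<close>, the chaining bound, \<open>s\<^sup>2 = 9 r\<close> and
  \<open>48 k ln (2 m + 1) + 4 ln n \<le> 100 ln n ln (2 m + 1)\<close>.\<close>

definition sample_constant :: "real \<Rightarrow> real" where
  "sample_constant \<tau> = 4 * (6\<^sup>2 * 288 * 9 * 100) / \<tau>\<^sup>2"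

lemma sample_constant_pos: "0 < \<tau> \<Longrightarrow> 0 < sample_constant \<tau>"
  by (simp add: sample_constant_def)

lemma sample_size_suffices:
  assumes \<tau>: "0 < \<tau>" and n: "3 \<le> n" "4 * sample_constant \<tau> \<le> real n" and r: "r \<le> n"
    and K: "0 < K" "K \<le> (real n)\<^sup>2" and m: "1 \<le> m" "20 * sample_constant \<tau> * (real r * K\<^sup>2) * ln (real n) ^ 7 \<le> real m"
    and J: "real J \<le> 6 * ln (real n)" and k: "real k \<le> 2 * ln (real n)"
  shows "(real J)\<^sup>2 * 288 * (3 * sqrt (real r) * K)\<^sup>2 * (48 * real k * ln (real (2 * m + 1)) + 4 * ln (real n))
    \<le> \<tau>\<^sup>2 / 4 * real m"
proof -
  define L l a where "L = ln (real n)" and "l = ln (real (2 * m + 1))" and "a = real r * K\<^sup>2"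
  have L: "1 \<le> L" and l: "1 \<le> l"
    using n m by (auto simp: L_def l_def intro!: one_le_ln)
  have a: "0 \<le> a" "a \<le> real n ^ 5"
  proof -
    have "a \<le> real n * ((real n)\<^sup>2)\<^sup>2"
      unfolding a_def using r K by (intro mult_mono power_mono) auto
    then show "a \<le> real n ^ 5"
      by (simp flip: power_mult power_Suc)
  qed (simp add: a_def)
  have "(real J)\<^sup>2 * 288 * (3 * sqrt (real r) * K)\<^sup>2 * (48 * real k * l + 4 * L)
      \<le> (6 * L)\<^sup>2 * 288 * (9 * a) * (100 * L * l)"
  proof (intro mult_mono)
    show "(real J)\<^sup>2 \<le> (6 * L)\<^sup>2"
      using J by (intro power_mono) (auto simp: L_def)
    show "(3 * sqrt (real r) * K)\<^sup>2 \<le> 9 * a"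
      by (simp add: a_def power_mult_distrib)
    have "real k * l \<le> 2 * L * l"
      using k l by (intro mult_right_mono) (auto simp: L_def)
    moreover have "L \<le> L * l"
      using L l by simp
    ultimately show "48 * real k * l + 4 * L \<le> 100 * L * l"
      by (simp add: algebra_simps)
  qed (use L l a in auto)
  also have "\<dots> = \<tau>\<^sup>2 / 4 * (sample_constant \<tau> * a * L ^ 3 * l)"
    using \<tau> by (simp add: sample_constant_def power2_eq_square power3_eq_cube)
  also have "\<dots> \<le> \<tau>\<^sup>2 / 4 * real m"
    using m a n \<tau> sample_constant_pos[OF \<tau>] unfolding L_def l_def
    by (intro mult_left_mono ln_sample_size_absorbed) (auto simp: a_def)
  finally show ?thesis
    by (simp add: L_def l_def)
qed

lemma sampling_parameters_exist:
  assumes \<tau>: "0 < \<tau>" "\<tau> \<le> 1" and n: "72 / \<tau> \<le> real n" "4 * sample_constant \<tau> \<le> real n"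
    and r: "1 \<le> r" "r \<le> n" and K: "0 < K" "K \<le> (real n)\<^sup>2"
    and m: "1 \<le> m" "20 * sample_constant \<tau> * (real r * K\<^sup>2) * ln (real n) ^ 7 \<le> real m"
  obtains k J where "sampling_parameters n m k J K (3 * sqrt (real r)) \<tau> (4 * ln (real n))"
    "real J \<le> 6 * ln (real n)"
proof -
  have "72 \<le> 72 / \<tau>"
    using \<tau> by (simp add: field_simps)
  then have n72: "72 \<le> n"
    using n by simp
  then have "8 \<le> n"
    by simp
  then obtain k :: nat where k: "1 \<le> k" "ln (real (2 * n)) \<le> real k" "real k \<le> 2 * ln (real n)"
    by (rule log_dimension_ceiling)
  obtain J :: nat where J: "1 \<le> J" "24 * real n ^ 3 / \<tau> \<le> 2 ^ J" "real J \<le> 6 * ln (real n)"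
    using dyadic_resolution_levels[OF \<tau> n(1)] .
  have "3 * sqrt (real r) * K \<le> 3 * real n * (real n)\<^sup>2"
  proof (intro mult_mono)
    have "real r \<le> (real n)\<^sup>2"
      using r n72 by (intro order_trans[OF _ self_le_power]) auto
    then show "sqrt (real r) \<le> real n"
      by (simp add: real_le_lsqrt)
  qed (use K in auto)
  then have resolution: "8 * (3 * sqrt (real r) * K) \<le> \<tau> * 2 ^ J"
    using J(2) \<tau> by (simp add: field_simps power2_eq_square power3_eq_cube)
  have "sampling_parameters n m k J K (3 * sqrt (real r)) \<tau> (4 * ln (real n))"
  proof
    show "(real J)\<^sup>2 * 288 * (3 * sqrt (real r) * K)\<^sup>2 * (48 * real k * ln (real (2 * m + 1)) + 4 * ln (real n))
        \<le> \<tau>\<^sup>2 / 4 * real m"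
      using n72 by (intro sample_size_suffices \<tau>(1) n(2) r(2) K m J(3) k(3)) simp
  qed (use resolution k J K m r n72 \<tau> in auto)
  then show ?thesis
    using J(3) by (rule that)
qed

lemma nuclear_rip_event_exists:
  assumes \<mu>: "random_matrix \<mu> n K" and op: "op_norm_F n (EBB_minus_I n \<mu>) \<le> 4 * \<tau>"
    and \<tau>: "0 < \<tau>" "128 * \<tau> < 1" and n: "72 / \<tau> \<le> real n" "4 * sample_constant \<tau> \<le> real n"
    and r: "1 \<le> r" "r \<le> n" and K: "K \<le> (real n)\<^sup>2"
    and m: "1 \<le> m" "20 * sample_constant \<tau> * (real r * K\<^sup>2) * ln (real n) ^ 7 \<le> real m"
  shows "\<exists>E \<in> sets (PiM {..<m} (\<lambda>_. \<mu>)). 1 - 1 / (real n)\<^sup>2 \<le> measure (PiM {..<m} (\<lambda>_. \<mu>)) E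
    \<and> (\<forall>Bs\<in>E. nuclear_rip n m (3 * sqrt (real r)) (128 * \<tau>) Bs)"
proof -
  have "72 \<le> 72 / \<tau>"
    using \<tau> by (simp add: field_simps)
  then have n72: "72 \<le> n"
    using n by simp
  have "0 < K"
    using random_matrix.K_pos[OF \<mu>] op \<tau> by simp
  moreover have "\<tau> \<le> 1"
    using \<tau> by simp
  ultimately obtain k J where parameters: "sampling_parameters n m k J K (3 * sqrt (real r)) \<tau> (4 * ln (real n))"
    and J: "real J \<le> 6 * ln (real n)"
    using sampling_parameters_exist[OF \<tau>(1) _ n r _ K m] by blast
  obtain E where "E \<in> sets (PiM {..<m} (\<lambda>_. \<mu>))"
    "1 - 12 * real J * exp (- (4 * ln (real n))) \<le> measure (PiM {..<m} (\<lambda>_. \<mu>)) E"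
    "\<And>Bs. Bs \<in> E \<Longrightarrow> nuclear_rip n m (3 * sqrt (real r)) (128 * \<tau>) Bs"
    using sampling_parameters.nuclear_rip_event[OF parameters \<mu> op \<tau>(2) failure_probability_le(2)[OF n72 J]]
    by blast
  then show ?thesis
    using failure_probability_le(1)[OF n72 J] by (intro bexI[of _ E]) auto
qed

lemma nuclear_rip_min_dim:
  assumes rip: "nuclear_rip n m (3 * sqrt (real (min r n))) \<delta> Bs"
  shows "nuclear_rip n m (3 * sqrt (real r)) \<delta> Bs"
proof (cases "r \<le> n")
  case False
  have "nuc_norm n X \<le> 3 * sqrt (real n) * frob n X" for X
    by (rule order_trans[OF nuc_norm_le_sqrt_rank[OF mrank_le_dim]]) (simp add: mult_right_mono)
  then show ?thesis
    using rip False by (simp add: nuclear_rip_def)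
qed (use rip in simp)

lemma nuclear_rip_event_exists_all_ranks:
  assumes \<mu>: "random_matrix \<mu> n K" and op: "op_norm_F n (EBB_minus_I n \<mu>) \<le> 4 * \<tau>"
    and \<tau>: "0 < \<tau>" "128 * \<tau> < 1" and n: "72 / \<tau> \<le> real n" "4 * sample_constant \<tau> \<le> real n"
    and K: "K \<le> (real n)\<^sup>2" and m: "1 \<le> m" "20 * sample_constant \<tau> * real r * K\<^sup>2 * ln (real n) ^ 7 \<le> real m"
  shows "\<exists>E \<in> sets (PiM {..<m} (\<lambda>_. \<mu>)). 1 - 1 / (real n)\<^sup>2 \<le> measure (PiM {..<m} (\<lambda>_. \<mu>)) E
    \<and> (\<forall>Bs\<in>E. nuclear_rip n m (3 * sqrt (real r)) (128 * \<tau>) Bs)"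
proof (cases "r = 0")
  case True
  interpret P: prob_space "PiM {..<m} (\<lambda>_. \<mu>)"
    using \<mu> by (intro prob_space_PiM) (simp add: random_matrix_def)
  show ?thesis
    using True P.prob_space nuclear_rip_scale_zero by (auto intro!: bexI[of _ "space (PiM {..<m} (\<lambda>_. \<mu>))"])
next
  case False
  have "1 \<le> n"
    using \<mu> by (rule random_matrix.n)
  then have "20 * sample_constant \<tau> * (real (min r n) * K\<^sup>2) * ln (real n) ^ 7
      \<le> 20 * sample_constant \<tau> * (real r * K\<^sup>2) * ln (real n) ^ 7"
    using sample_constant_pos[OF \<tau>(1)] by (intro mult_right_mono mult_left_mono) auto
  then have "20 * sample_constant \<tau> * (real (min r n) * K\<^sup>2) * ln (real n) ^ 7 \<le> real m"
    using m(2) by (simp add: mult.assoc)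
  then have "\<exists>E \<in> sets (PiM {..<m} (\<lambda>_. \<mu>)). 1 - 1 / (real n)\<^sup>2 \<le> measure (PiM {..<m} (\<lambda>_. \<mu>)) E
      \<and> (\<forall>Bs\<in>E. nuclear_rip n m (3 * sqrt (real (min r n))) (128 * \<tau>) Bs)"
    using nuclear_rip_event_exists[OF \<mu> op \<tau> n _ _ K m(1)] False \<open>1 \<le> n\<close> by simp
  then show ?thesis
    using nuclear_rip_min_dim by blast
qed

lemma nuclear_rip_high_probability:
  fixes \<delta> c :: real
  assumes \<delta>: "0 < \<delta>" "\<delta> < 1"
  obtains c0 :: real and N :: nat where "0 < c0" "\<And>n m r K \<mu>. N \<le> n \<Longrightarrow> random_matrix \<mu> n K \<Longrightarrow>
      K \<le> (real n)\<^sup>2 \<Longrightarrow> op_norm_F n (EBB_minus_I n \<mu>) \<le> c / real n \<Longrightarrow>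
      c0 * real r * K\<^sup>2 * ln (real n) ^ 7 < real m \<Longrightarrow>
    0 < m \<and> (\<exists>E \<in> sets (PiM {..<m} (\<lambda>_. \<mu>)). 1 - 1 / (real n)\<^sup>2 \<le> measure (PiM {..<m} (\<lambda>_. \<mu>)) E
      \<and> (\<forall>Bs\<in>E. nuclear_rip n m (3 * sqrt (real r)) \<delta> Bs))"
proof -
  define \<tau> where "\<tau> = \<delta> / 128"
  have \<tau>: "0 < \<tau>" "128 * \<tau> < 1" "128 * \<tau> = \<delta>"
    using \<delta> by (auto simp: \<tau>_def)
  obtain N :: nat where N: "max (72 / \<tau>) (max (4 * sample_constant \<tau>) (c / (4 * \<tau>))) \<le> real N"
    using real_arch_simple by blast
  have "0 < m \<and> (\<exists>E \<in> sets (PiM {..<m} (\<lambda>_. \<mu>)). 1 - 1 / (real n)\<^sup>2 \<le> measure (PiM {..<m} (\<lambda>_. \<mu>)) E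
      \<and> (\<forall>Bs\<in>E. nuclear_rip n m (3 * sqrt (real r)) \<delta> Bs))"
    if "N \<le> n" and \<mu>: "random_matrix \<mu> n K" and K: "K \<le> (real n)\<^sup>2"
      and op: "op_norm_F n (EBB_minus_I n \<mu>) \<le> c / real n"
      and m: "20 * sample_constant \<tau> * real r * K\<^sup>2 * ln (real n) ^ 7 < real m" for n m r K \<mu>
  proof -
    have "real N \<le> real n"
      using \<open>N \<le> n\<close> by simp
    then have bounds: "72 / \<tau> \<le> real n" "4 * sample_constant \<tau> \<le> real n" "c / (4 * \<tau>) \<le> real n"
      using N by linarith+
    have n: "1 \<le> n"
      using \<mu> by (rule random_matrix.n)
    then have "0 \<le> 20 * sample_constant \<tau> * real r * K\<^sup>2 * ln (real n) ^ 7"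
      using sample_constant_pos[OF \<tau>(1)] by simp
    then have "0 < real m"
      using m by linarith
    then have m_pos: "1 \<le> m"
      by simp
    have "c / real n \<le> 4 * \<tau>"
      using bounds(3) \<tau>(1) n by (simp add: field_simps)
    with op have op_le: "op_norm_F n (EBB_minus_I n \<mu>) \<le> 4 * \<tau>"
      by (rule order_trans)
    show ?thesis
      using nuclear_rip_event_exists_all_ranks[OF \<mu> op_le \<tau>(1,2) bounds(1,2) K m_pos less_imp_le[OF m]] m_pos
      unfolding \<tau>(3) by simp
  qed
  then show ?thesis
    using sample_constant_pos[OF \<tau>(1)] by (intro that[of "20 * sample_constant \<tau>" N]) auto
qed

lemma random_matrixI:
  assumes "prob_space \<mu>" "sets \<mu> = sets (matsp n)" "1 \<le> n" "AE B in \<mu>. spec_norm n B \<le> K"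
  shows "random_matrix \<mu> n K"
proof -
  interpret prob_space \<mu> by fact
  have "AE B in \<mu>. op_bounded n K B"
    using assms(4) by eventually_elim (rule op_bounded_spec_norm)
  then show ?thesis
    using assms by unfold_locales auto
qed

theorem theorem5:
  fixes c5 \<delta> :: real
  assumes "c5 > 0" and "0 < \<delta>" and "\<delta> < 1"
  shows "\<exists>c0 C2 :: real. c0 > 0 \<and> C2 > 0 \<and> (\<exists>N::nat. \<forall>n\<ge>N. \<forall>(m::nat) (r::nat) (K::real)
      (\<mu> :: (nat \<Rightarrow> nat \<Rightarrow> real) measure).
      prob_space \<mu> \<longrightarrow> sets \<mu> = sets (matsp n) \<longrightarrow>
      K \<le> real n ^ 2 \<longrightarrow>
      (AE B in \<mu>. spec_norm n B \<le> K) \<longrightarrow>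
      op_norm_F n (EBB_minus_I n \<mu>) \<le> c5 / real n \<longrightarrow>
      real m > c0 * real r * K\<^sup>2 * (ln (real n)) ^ 7 \<longrightarrow>
      (\<exists>E \<in> sets (PiM {..<m} (\<lambda>_. \<mu>)).
         measure (PiM {..<m} (\<lambda>_. \<mu>)) E \<ge> 1 - 1 / (real n)\<^sup>2 \<and>
         (\<forall>Bs\<in>E.
           (\<forall>X\<in>sqmats n. mrank n X \<le> r \<longrightarrow>
              \<bar>(vnorm m (meas n Bs X))\<^sup>2 / real m - (frob n X)\<^sup>2\<bar> \<le> \<delta> * (frob n X)\<^sup>2) \<and>
           (\<forall>\<K> \<subseteq> sqmats n. \<forall>\<epsilon>2 :: real. \<forall>\<Sigma> y \<Sigma>h.
              mconvex \<K> \<longrightarrow> \<epsilon>2 \<ge> 0 \<longrightarrow> \<Sigma> \<in> \<K> \<longrightarrow> mrank n \<Sigma> \<le> r \<longrightarrow>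
              vnorm m (\<lambda>l. y l - meas n Bs \<Sigma> l) \<le> \<epsilon>2 \<longrightarrow>
              \<Sigma>h \<in> \<K> \<longrightarrow> vnorm m (\<lambda>l. y l - meas n Bs \<Sigma>h l) \<le> \<epsilon>2 \<longrightarrow>
              (\<forall>M\<in>\<K>. vnorm m (\<lambda>l. y l - meas n Bs M l) \<le> \<epsilon>2 \<longrightarrow> nuc_norm n \<Sigma>h \<le> nuc_norm n M) \<longrightarrow>
              frob n (\<lambda>i j. \<Sigma>h i j - \<Sigma> i j) \<le> C2 * \<epsilon>2 / sqrt (real m)))))"
proof -
  obtain c0 N where c0: "0 < c0" and rip: "\<And>n m r K \<mu>. N \<le> n \<Longrightarrow> random_matrix \<mu> n K \<Longrightarrow>
      K \<le> (real n)\<^sup>2 \<Longrightarrow> op_norm_F n (EBB_minus_I n \<mu>) \<le> c5 / real n \<Longrightarrow>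
      c0 * real r * K\<^sup>2 * ln (real n) ^ 7 < real m \<Longrightarrow>
    0 < m \<and> (\<exists>E \<in> sets (PiM {..<m} (\<lambda>_. \<mu>)). 1 - 1 / (real n)\<^sup>2 \<le> measure (PiM {..<m} (\<lambda>_. \<mu>)) E
      \<and> (\<forall>Bs\<in>E. nuclear_rip n m (3 * sqrt (real r)) \<delta> Bs))"
    using nuclear_rip_high_probability[OF assms(2,3), where c = c5] by blast
  define C2 where "C2 = 2 / sqrt (1 - \<delta>)"
  have C2: "0 < C2"
    using assms(3) by (simp add: C2_def)
  have "\<forall>n\<ge>max N 1. \<forall>m r K \<mu>. prob_space \<mu> \<longrightarrow> sets \<mu> = sets (matsp n) \<longrightarrow> K \<le> real n ^ 2 \<longrightarrow>
      (AE B in \<mu>. spec_norm n B \<le> K) \<longrightarrow> op_norm_F n (EBB_minus_I n \<mu>) \<le> c5 / real n \<longrightarrow>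
      real m > c0 * real r * K\<^sup>2 * ln (real n) ^ 7 \<longrightarrow>
      (\<exists>E \<in> sets (PiM {..<m} (\<lambda>_. \<mu>)). measure (PiM {..<m} (\<lambda>_. \<mu>)) E \<ge> 1 - 1 / (real n)\<^sup>2 \<and>
        (\<forall>Bs\<in>E. rank_rip n m r \<delta> Bs \<and> stable_recovery n m r C2 Bs))"
    unfolding C2_def using rip random_matrixI nuclear_rip_imp_rank_rip nuclear_rip_imp_stable_recovery[OF _ assms(3)]
    by (metis max.bounded_iff)
  then show ?thesis
    unfolding rank_rip_def stable_recovery_def using c0 C2 by (intro exI conjI)
qed

end
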